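(* There is a computable transformation $T$ of $\Omega$ preserving the uniform Bernoulli measure $B_{1/2}$ such that for every nondecreasing unbounded computable function $\sigma(n)$ there exists an infinite sequence $\omega\in\Omega$ with $Km(\omega^n)\ge n-\sigma(n)$ for all $n$ for which, for some computable indicator function $f$, the limit $\lim_{n\to\infty}\frac1n\sum_{i=0}^{n-1}f(T^i\omega)$ does not exist.
   Context: $\Omega=\{0,1\}^\infty$ with the uniform Bernoulli measure $B_{1/2}$ ($B_{1/2}(\Gamma_x)=2^{-l(x)}$ on cylinders). A transformation $T:\Omega\to\Omega$ is computable if it is given by a recursively enumerable set $\hat\psi$ of pairs of strings such that if $(x,y),(x',y')\in\hat\psi$ and $x\subseteq x'$ then $y,y'$ are comparable, $(x,y)\in\hat\psi$ implies $(x,y')\in\hat\psi$ for all prefixes $y'$ of $y$, and $T(\omega)=\sup\{y:x\subseteq\omega,(x,y)\in\hat\psi\}$. Measure preserving: $B_{1/2}(T^{-1}A)=B_{1/2}(A)$ for measurable $A$. $T^0\omega=\omega$, $T^{i+1}\omega=T(T^i\omega)$; $\omega^n$ is the length-$n$ prefix of $\omega$. $Km$ is monotone Kolmogorov complexity $Km(x)=\min\{l(p):x\subseteq\psi(p)\}$ with respect to a fixed optimal monotone computable decoder $\psi$. *)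

theory Defs
  imports "HOL-Probability.Probability" "HOL-Library.Sublist" "HOL-Library.Nat_Bijection"
begin

datatype recf =
    Zero
  | Succ
  | Proj nat
  | Comp recf "recf list"
  | PrimRec recf recf
  | Minim recf

text \<open>\<open>rec_eval r xs y\<close>: the partial recursive function denoted by \<open>r\<close> is defined on the argument
  list \<open>xs\<close> and has value \<open>y\<close>. Primitive recursion and minimization use the first argument.\<close>

inductive rec_eval :: "recf \<Rightarrow> nat list \<Rightarrow> nat \<Rightarrow> bool" where
  Zero: "rec_eval Zero xs 0"
| Succ: "rec_eval Succ (x # xs) (Suc x)"
| Proj: "i < length xs \<Longrightarrow> rec_eval (Proj i) xs (xs ! i)"
| Comp: "list_all2 (\<lambda>g y. rec_eval g xs y) gs ys \<Longrightarrow> rec_eval f ys z \<Longrightarrow> rec_eval (Comp f gs) xs z"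
| PrimRec_0: "rec_eval f xs y \<Longrightarrow> rec_eval (PrimRec f g) (0 # xs) y"
| PrimRec_Suc: "rec_eval (PrimRec f g) (n # xs) y \<Longrightarrow> rec_eval g (n # y # xs) z
    \<Longrightarrow> rec_eval (PrimRec f g) (Suc n # xs) z"
| Minim: "rec_eval f (n # xs) 0 \<Longrightarrow> (\<And>m. m < n \<Longrightarrow> \<exists>y. rec_eval f (m # xs) (Suc y))
    \<Longrightarrow> rec_eval (Minim f) xs n"

inductive_cases rec_eval_ZeroE: "rec_eval Zero xs y"
inductive_cases rec_eval_SuccE: "rec_eval Succ xs y"
inductive_cases rec_eval_ProjE: "rec_eval (Proj i) xs y"
inductive_cases rec_eval_CompE: "rec_eval (Comp f gs) xs y"
inductive_cases rec_eval_PrimRec_0E: "rec_eval (PrimRec f g) (0 # xs) y"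
inductive_cases rec_eval_PrimRec_SucE: "rec_eval (PrimRec f g) (Suc n # xs) y"
inductive_cases rec_eval_MinimE: "rec_eval (Minim f) xs y"

lemma rec_eval_deterministic: "rec_eval r xs y \<Longrightarrow> rec_eval r xs y' \<Longrightarrow> y = y'"
proof (induction arbitrary: y' rule: rec_eval.induct)
  case (Zero xs)
  then show ?case by (rule rec_eval_ZeroE) simp
next
  case (Succ x xs)
  then show ?case by (rule rec_eval_SuccE) simp
next
  case (Proj i xs)
  from Proj.prems show ?case by (rule rec_eval_ProjE) simp
next
  case (Comp xs gs ys f z)
  from Comp.prems obtain ys' where ys': "list_all2 (\<lambda>g y. rec_eval g xs y) gs ys'" "rec_eval f ys' y'"
    by (rule rec_eval_CompE)
  have "ys = ys'"
  proof (rule nth_equalityI)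
    show "length ys = length ys'"
      using list_all2_lengthD[OF Comp.IH(1)] list_all2_lengthD[OF ys'(1)] by (rule subst)
    show "ys ! i = ys' ! i" if "i < length ys" for i
      using list_all2_nthD2[OF Comp.IH(1) that] list_all2_nthD[OF ys'(1), of i] that
        list_all2_lengthD[OF Comp.IH(1)] by metis
  qed
  then show ?case using Comp.IH(2) ys'(2) by blast
next
  case (PrimRec_0 f xs y g)
  from PrimRec_0.prems have "rec_eval f xs y'" by (rule rec_eval_PrimRec_0E)
  then show ?case by (rule PrimRec_0.IH)
next
  case (PrimRec_Suc f g n xs y z)
  from PrimRec_Suc.prems obtain v where v: "rec_eval (PrimRec f g) (n # xs) v" "rec_eval g (n # v # xs) y'"
    by (rule rec_eval_PrimRec_SucE)
  from PrimRec_Suc.IH(1)[OF v(1)] v(2) have "rec_eval g (n # y # xs) y'" by (simp only:)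
  then show ?case by (rule PrimRec_Suc.IH(2))
next
  case (Minim f n xs)
  from Minim.prems have a: "rec_eval f (y' # xs) 0"
    by (rule rec_eval_MinimE)
  from Minim.prems have b: "\<exists>y. rec_eval f (m # xs) (Suc y)" if "m < y'" for m
    by (rule rec_eval_MinimE) (use that in blast)
  have "\<not> n < y'"
  proof
    assume "n < y'"
    with b obtain v where "rec_eval f (n # xs) (Suc v)" by blast
    from Minim.IH(1)[OF this] show False by simp
  qed
  moreover have "\<not> y' < n"
  proof
    assume "y' < n"
    with Minim.IH(2) obtain v where "\<forall>w. rec_eval f (y' # xs) w \<longrightarrow> Suc v = w" by blast
    with a show False by blast
  qed
  ultimately show ?case by simp
qed

definition computable_fun :: "(nat \<Rightarrow> nat) \<Rightarrow> bool" where
  "computable_fun f \<longleftrightarrow> (\<exists>r. \<forall>n. rec_eval r [n] (f n))"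

definition rec_enumerable :: "nat set \<Rightarrow> bool" where
  "rec_enumerable A \<longleftrightarrow> (\<exists>r. \<forall>n. n \<in> A \<longleftrightarrow> (\<exists>y. rec_eval r [n] y))"

definition string_code :: "bool list \<Rightarrow> nat" where
  "string_code x = list_encode (map of_bool x)"

definition seq_prefix :: "(nat \<Rightarrow> bool) \<Rightarrow> nat \<Rightarrow> bool list" where
  "seq_prefix \<omega> n = map \<omega> [0..<n]"

datatype binseq = FinSeq "bool list" | InfSeq "nat \<Rightarrow> bool"

lemma length_seq_prefix [simp]: "length (seq_prefix \<omega> n) = n"
  by (simp add: seq_prefix_def)

lemma take_seq_prefix: "m \<le> n \<Longrightarrow> take m (seq_prefix \<omega> n) = seq_prefix \<omega> m"
  by (simp add: seq_prefix_def take_map)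

instantiation binseq :: order
begin

fun less_eq_binseq :: "binseq \<Rightarrow> binseq \<Rightarrow> bool" where
  "FinSeq x \<le> FinSeq y \<longleftrightarrow> prefix x y"
| "FinSeq x \<le> InfSeq \<omega> \<longleftrightarrow> x = seq_prefix \<omega> (length x)"
| "InfSeq \<omega> \<le> FinSeq y \<longleftrightarrow> False"
| "InfSeq \<omega> \<le> InfSeq \<omega>' \<longleftrightarrow> \<omega> = \<omega>'"

definition less_binseq :: "binseq \<Rightarrow> binseq \<Rightarrow> bool" where
  "less_binseq \<alpha> \<beta> \<longleftrightarrow> \<alpha> \<le> \<beta> \<and> \<not> \<beta> \<le> \<alpha>"

instance
proof
  fix \<alpha> \<beta> \<gamma> :: binseq
  show "\<alpha> < \<beta> \<longleftrightarrow> \<alpha> \<le> \<beta> \<and> \<not> \<beta> \<le> \<alpha>" by (rule less_binseq_def)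
  show "\<alpha> \<le> \<alpha>" by (cases \<alpha>) auto
  show "\<alpha> \<le> \<gamma>" if le: "\<alpha> \<le> \<beta>" "\<beta> \<le> \<gamma>"
  proof (cases \<alpha>; cases \<beta>; cases \<gamma>)
    fix x y \<omega>
    assume eq: "\<alpha> = FinSeq x" "\<beta> = FinSeq y" "\<gamma> = InfSeq \<omega>"
    then obtain z where z: "y = x @ z" and y: "y = seq_prefix \<omega> (length y)"
      using le by (metis less_eq_binseq.simps(1,2) prefixE)
    have "x = take (length x) y" by (simp add: z)
    also have "\<dots> = take (length x) (seq_prefix \<omega> (length y))"
      by (rule arg_cong[OF y])
    also have "\<dots> = seq_prefix \<omega> (length x)"
      by (rule take_seq_prefix) (simp add: z)
    finally show ?thesis unfolding eq by (simp only: less_eq_binseq.simps)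
  next
    fix x y z
    assume "\<alpha> = FinSeq x" "\<beta> = FinSeq y" "\<gamma> = FinSeq z"
    then show ?thesis using le by (simp add: prefix_order.trans[of x y z])
  qed (use le in \<open>simp_all only: less_eq_binseq.simps\<close>)
  show "\<alpha> = \<beta>" if "\<alpha> \<le> \<beta>" "\<beta> \<le> \<alpha>"
    using that by (cases \<alpha>; cases \<beta>) (simp_all only: less_eq_binseq.simps prefix_order.eq_iff binseq.inject)
qed

end

definition computable_operation :: "(bool list \<times> bool list) set \<Rightarrow> bool" where
  "computable_operation \<Psi> \<longleftrightarrow>
     rec_enumerable ((\<lambda>(x, y). prod_encode (string_code x, string_code y)) ` \<Psi>) \<and>
     (\<forall>x y x' y'. (x, y) \<in> \<Psi> \<longrightarrow> (x', y') \<in> \<Psi> \<longrightarrow> prefix x x' \<longrightarrow> prefix y y' \<or> prefix y' y) \<and>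
     (\<forall>x y y'. (x, y) \<in> \<Psi> \<longrightarrow> prefix y' y \<longrightarrow> (x, y') \<in> \<Psi>)"

text \<open>The supremum \<open>sup {y. x \<subseteq> \<alpha>, (x, y) \<in> \<Psi>}\<close>, written as the least upper bound in the prefix order;
  it exists for computable operations because the strings \<open>y\<close> involved are pairwise comparable.\<close>

definition apply_op :: "(bool list \<times> bool list) set \<Rightarrow> binseq \<Rightarrow> binseq" where
  "apply_op \<Psi> \<alpha> = (LEAST \<beta>. \<forall>x y. FinSeq x \<le> \<alpha> \<longrightarrow> (x, y) \<in> \<Psi> \<longrightarrow> FinSeq y \<le> \<beta>)"

definition computable_transformation :: "((nat \<Rightarrow> bool) \<Rightarrow> (nat \<Rightarrow> bool)) \<Rightarrow> bool" where
  "computable_transformation T \<longleftrightarrow>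
     (\<exists>\<Psi>. computable_operation \<Psi> \<and> (\<forall>\<omega>. InfSeq (T \<omega>) = apply_op \<Psi> (InfSeq \<omega>)))"

text \<open>Complexity is \<open>\<infinity>\<close> if \<open>x\<close> has no description.\<close>

definition Km :: "(bool list \<times> bool list) set \<Rightarrow> bool list \<Rightarrow> enat" where
  "Km \<Psi> x = (INF p \<in> {p. FinSeq x \<le> apply_op \<Psi> (FinSeq p)}. enat (length p))"

definition optimal_decoder :: "(bool list \<times> bool list) set \<Rightarrow> bool" where
  "optimal_decoder \<Psi> \<longleftrightarrow> computable_operation \<Psi> \<and>
     (\<forall>\<Phi>. computable_operation \<Phi> \<longrightarrow> (\<exists>c::nat. \<forall>x. Km \<Psi> x \<le> Km \<Phi> x + enat c))"

text \<open>A real function on infinite sequences is computable if arbitrarily good dyadic approximations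
  \<open>z / 2^k\<close> of its value can be enumerated from the prefixes of the argument.\<close>

definition computable_real_fun :: "((nat \<Rightarrow> bool) \<Rightarrow> real) \<Rightarrow> bool" where
  "computable_real_fun f \<longleftrightarrow>
     (\<exists>\<Phi> :: (bool list \<times> int \<times> nat) set.
        rec_enumerable ((\<lambda>(x, z, k). prod_encode (string_code x, prod_encode (int_encode z, k))) ` \<Phi>) \<and>
        (\<forall>x z k \<omega>. (x, z, k) \<in> \<Phi> \<longrightarrow> FinSeq x \<le> InfSeq \<omega> \<longrightarrow>
           \<bar>f \<omega> - real_of_int z / 2 ^ k\<bar> \<le> 1 / 2 ^ k) \<and>
        (\<forall>\<omega> k. \<exists>x z. FinSeq x \<le> InfSeq \<omega> \<and> (x, z, k) \<in> \<Phi>))"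

definition bernoulli_half :: "(nat \<Rightarrow> bool) measure" where
  "bernoulli_half = PiM UNIV (\<lambda>_. measure_pmf (bernoulli_pmf (1/2)))"

lemma space_bernoulli_half: "space bernoulli_half = UNIV"
  by (simp add: bernoulli_half_def space_PiM PiE_def)

lemma emeasure_bernoulli_half_cylinder:
  "emeasure bernoulli_half {\<omega>. seq_prefix \<omega> (length x) = x} = ennreal ((1/2) ^ length x)"
proof -
  let ?M = "\<lambda>_::nat. measure_pmf (bernoulli_pmf (1/2))"
  interpret product_prob_space ?M UNIV
    by unfold_locales
  have iff: "seq_prefix \<omega> (length x) = x \<longleftrightarrow> (\<forall>i<length x. \<omega> i = x ! i)" for \<omega>
    unfolding list_eq_iff_nth_eq[of "seq_prefix \<omega> (length x)"] by (simp add: seq_prefix_def)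
  have cyl: "{\<omega>. seq_prefix \<omega> (length x) = x} =
      prod_emb UNIV ?M {..<length x} (Pi\<^sub>E {..<length x} (\<lambda>i. {x ! i}))" (is "?L = ?R")
  proof (rule set_eqI)
    fix \<omega>
    have "\<omega> \<in> ?R \<longleftrightarrow> restrict \<omega> {..<length x} \<in> Pi\<^sub>E {..<length x} (\<lambda>i. {x ! i})"
      by (simp add: prod_emb_def)
    also have "\<dots> \<longleftrightarrow> (\<forall>i<length x. \<omega> i = x ! i)"
      unfolding PiE_iff by (simp add: Ball_def)
    finally show "\<omega> \<in> ?L \<longleftrightarrow> \<omega> \<in> ?R"
      unfolding mem_Collect_eq iff by (rule sym)
  qed
  have single: "emeasure (?M i) {x ! i} = ennreal (1/2)" for i
    by (cases "x ! i") (simp_all add: emeasure_pmf_single)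
  have "emeasure bernoulli_half {\<omega>. seq_prefix \<omega> (length x) = x} =
      (\<Prod>i<length x. emeasure (?M i) {x ! i})"
    unfolding cyl bernoulli_half_def by (rule emeasure_PiM_emb) auto
  also have "\<dots> = ennreal (1/2) ^ length x"
    unfolding single by (simp only: prod_constant card_lessThan)
  also have "\<dots> = ennreal ((1/2) ^ length x)"
    by (rule ennreal_power) simp
  finally show ?thesis .
qed

definition measure_preserving :: "'a measure \<Rightarrow> ('a \<Rightarrow> 'a) \<Rightarrow> bool" where
  "measure_preserving M T \<longleftrightarrow> T \<in> measurable M M \<and>
     (\<forall>A\<in>sets M. emeasure M (T -` A \<inter> space M) = emeasure M A)"

end

theory Submission imports Defs begin

text \<open>The transformation is built by cutting and stacking: at every level there are two columns of
  equal height, and the columns of level \<open>k + 1\<close> are concatenations of copies of those of level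
  \<open>k\<close>. A column mostly contains copies of the column of its own type, so the two types keep
  different frequencies of ones. But if a number \<open>m\<close> is enumerated at time \<open>k\<close> into a fixed set that
  is recursively enumerable and not recursive, then at level \<open>k\<close> a fraction of about \<open>2 ^ -m\<close> of
  the copies is exchanged between the two columns. A point that lies in exchanged copies at infinitely
  many levels has no ergodic limit. Lying in them at level \<open>k\<close> costs about \<open>m\<close> bits of randomness, in
  positions beyond \<open>k\<close>. As the set is not recursive, \<open>m\<close> is infinitely often at most \<open>\<sigma> k\<close> for every
  computable unbounded \<open>\<sigma>\<close>, so that the cost can be kept below \<open>\<sigma>\<close>. The set
  is taken from the optimal decoder itself, as the set of strings that have a description shorter than themselves.\<close>

section \<open>Computable functions of one variable\<close>

text \<open>One \<open>T\<close> has to serve every \<open>\<sigma>\<close>. To keep the two types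
  apart the exchanged fractions are made summable, so \<open>m\<close> tends to infinity along the
  levels. If it did so at a computable rate, its cost would outgrow a sufficiently slow
  \<open>\<sigma>\<close>. An enumeration avoids this: each \<open>m\<close> occurs at most once, so
  the fractions are summable, and whether \<open>k\<close> is the time of an event is decidable, so
  \<open>T\<close> is computable, yet no computable rate bounds \<open>m\<close> from below. A
  sequence encodes its own place in the columns. Its first \<open>level k\<close> bits determine
  column and height at level \<open>k\<close>, and the next block, least significant bit first, is
  the number of the copy. The exchanged copies are those numbered from \<open>2 ^ z k\<close> up to
  \<open>2 * 2 ^ z k\<close>, where \<open>z k = k + 2 - m\<close>. An initial interval of copies is
  thus singled out by the top bits of the block alone, and forcing \<open>m + 5\<close> of them is
  enough. They lie beyond position \<open>level k\<close>, hence beyond \<open>k\<close>, where a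
  nondecreasing \<open>\<sigma>\<close> has already reached \<open>\<sigma> k\<close>; so only their
  number has to be paid for.\<close>

lemma rec_eval_Comp1:
  "rec_eval g xs a \<Longrightarrow> rec_eval f [a] z \<Longrightarrow> rec_eval (Comp f [g]) xs z"
  by (rule rec_eval.Comp[of xs "[g]" "[a]"]) simp_all

lemma rec_eval_Comp2:
  "rec_eval g xs a \<Longrightarrow> rec_eval h xs b \<Longrightarrow> rec_eval f [a, b] z \<Longrightarrow> rec_eval (Comp f [g, h]) xs z"
  by (rule rec_eval.Comp[of xs "[g, h]" "[a, b]"]) simp_all

lemma rec_eval_Proj: "i < length xs \<Longrightarrow> y = xs ! i \<Longrightarrow> rec_eval (Proj i) xs y"
  by (simp add: rec_eval.Proj)

section \<open>Arithmetic and the Cantor pairing as recursive functions\<close>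

definition recf_add :: recf where "recf_add = PrimRec (Proj 0) (Comp Succ [Proj 1])"

lemma recf_add: "rec_eval recf_add [m, n] (m + n)"
  unfolding recf_add_def
proof (induction m)
  case 0
  then show ?case by (auto intro!: rec_eval.PrimRec_0 rec_eval_Proj)
next
  case (Suc m)
  show ?case unfolding add_Suc
    by (rule rec_eval.PrimRec_Suc[OF Suc]) (auto intro!: rec_eval_Comp1 rec_eval_Proj rec_eval.Succ)
qed

definition recf_pred :: recf where "recf_pred = PrimRec Zero (Proj 0)"

lemma recf_pred: "rec_eval recf_pred [n] (n - 1)"
  unfolding recf_pred_def
proof (induction n)
  case 0
  then show ?case by (auto intro!: rec_eval.PrimRec_0 rec_eval.Zero)
next
  case (Suc n)
  show ?case by (rule rec_eval.PrimRec_Suc[OF Suc]) (auto intro!: rec_eval_Proj)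
qed

definition recf_diff :: recf where "recf_diff = PrimRec (Proj 0) (Comp recf_pred [Proj 1])"

lemma recf_diff: "rec_eval recf_diff [m, n] (n - m)"
  unfolding recf_diff_def
proof (induction m)
  case 0
  then show ?case by (auto intro!: rec_eval.PrimRec_0 rec_eval_Proj)
next
  case (Suc m)
  have "rec_eval recf_pred [n - m] (n - Suc m)" using recf_pred[of "n - m"] by simp
  then show ?case
    by (intro rec_eval.PrimRec_Suc[OF Suc] rec_eval_Comp1) (auto intro!: rec_eval_Proj)
qed

definition recf_triangle :: recf where
  "recf_triangle = PrimRec Zero (Comp recf_add [Comp Succ [Proj 0], Proj 1])"

lemma recf_triangle: "rec_eval recf_triangle [n] (triangle n)"
  unfolding recf_triangle_def
proof (induction n)
  case 0
  then show ?case by (auto intro!: rec_eval.PrimRec_0 rec_eval.Zero)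
next
  case (Suc n)
  have "rec_eval recf_add [Suc n, triangle n] (triangle (Suc n))"
    using recf_add[of "Suc n" "triangle n"] by (simp add: add_ac)
  then show ?case
    by (intro rec_eval.PrimRec_Suc[OF Suc] rec_eval_Comp2)
      (auto intro!: rec_eval_Proj rec_eval_Comp1 rec_eval.Succ)
qed

definition recf_pair :: recf where
  "recf_pair = Comp recf_add [Comp recf_triangle [recf_add], Proj 0]"

lemma recf_pair: "rec_eval recf_pair [m, n] (prod_encode (m, n))"
  unfolding recf_pair_def prod_encode_def prod.case
  by (intro rec_eval_Comp2 rec_eval_Comp1) (auto intro!: rec_eval_Proj recf_add recf_triangle)

definition pfst :: "nat \<Rightarrow> nat" where "pfst n = fst (prod_decode n)"
definition psnd :: "nat \<Rightarrow> nat" where "psnd n = snd (prod_decode n)"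

lemma pfst_prod_encode [simp]: "pfst (prod_encode (a, b)) = a"
  and psnd_prod_encode [simp]: "psnd (prod_encode (a, b)) = b"
  and prod_encode_pfst_psnd [simp]: "prod_encode (pfst n, psnd n) = n"
  by (simp_all add: pfst_def psnd_def)

lemma pfst_0 [simp]: "pfst 0 = 0" and psnd_0 [simp]: "psnd 0 = 0"
  using pfst_prod_encode[of 0 0] psnd_prod_encode[of 0 0]
  by (simp_all add: prod_encode_def del: pfst_prod_encode psnd_prod_encode)

text \<open>Since \<open>prod_encode (m, n) = triangle (m + n) + m\<close>, the diagonal
  \<open>m + n\<close> is the least \<open>k\<close> such that \<open>triangle (Suc k)\<close>
  exceeds the code. Both components follow by subtraction.\<close>

definition recf_width :: recf where
  "recf_width = Minim (Comp recf_diff [Comp recf_triangle [Comp Succ [Proj 0]], Comp Succ [Proj 1]])"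

lemma recf_width: "rec_eval recf_width [prod_encode (m, n)] (m + n)"
proof -
  let ?n = "prod_encode (m, n)"
  let ?f = "Comp recf_diff [Comp recf_triangle [Comp Succ [Proj 0]], Comp Succ [Proj 1]]"
  have f: "rec_eval ?f [k, ?n] (Suc ?n - triangle (Suc k))" for k
    by (intro rec_eval_Comp2 rec_eval_Comp1)
      (auto intro!: rec_eval_Proj rec_eval.Succ recf_triangle recf_diff simp del: triangle_Suc)
  have mono: "triangle a \<le> triangle b" if "a \<le> b" for a b
    using that by (induction rule: dec_induct) auto
  have "Suc ?n - triangle (Suc (m + n)) = 0"
    by (simp add: prod_encode_def)
  then have "rec_eval ?f [m + n, ?n] 0" using f[of "m + n"] by (simp del: triangle_Suc)
  moreover have "\<exists>y. rec_eval ?f [k, ?n] (Suc y)" if "k < m + n" for k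
  proof -
    have "triangle (Suc k) \<le> ?n" using mono[of "Suc k" "m + n"] that
      by (simp add: prod_encode_def del: triangle_Suc)
    then have "Suc ?n - triangle (Suc k) = Suc (?n - triangle (Suc k))" by simp
    then show ?thesis using f[of k] by metis
  qed
  ultimately show ?thesis unfolding recf_width_def by (rule rec_eval.Minim)
qed

definition recf_fst :: recf where
  "recf_fst = Comp recf_diff [Comp recf_triangle [recf_width], Proj 0]"

lemma recf_fst: "rec_eval recf_fst [n] (pfst n)"
proof -
  have "rec_eval recf_fst [prod_encode (a, b)] a" for a b
  proof -
    have "rec_eval recf_diff [triangle (a + b), prod_encode (a, b)] a"
      using recf_diff[of "triangle (a + b)" "prod_encode (a, b)"] by (simp add: prod_encode_def)
    then show ?thesis unfolding recf_fst_def
      by (intro rec_eval_Comp2 rec_eval_Comp1) (auto intro!: rec_eval_Proj recf_width recf_triangle)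
  qed
  from this[of "pfst n" "psnd n"] show ?thesis by simp
qed

definition recf_snd :: recf where
  "recf_snd = Comp recf_diff [recf_fst, recf_width]"

lemma recf_snd: "rec_eval recf_snd [n] (psnd n)"
proof -
  have "rec_eval recf_snd [prod_encode (a, b)] b" for a b
  proof -
    have "rec_eval recf_diff [a, a + b] b" using recf_diff[of a "a + b"] by simp
    moreover have "rec_eval recf_fst [prod_encode (a, b)] a" using recf_fst[of "prod_encode (a, b)"] by simp
    ultimately show ?thesis unfolding recf_snd_def
      by (intro rec_eval_Comp2) (auto intro!: recf_width)
  qed
  from this[of "pfst n" "psnd n"] show ?thesis by simp
qed

section \<open>Closure rules for computable functions and decidable predicates\<close>

named_theorems computable_intros

lemma computable_comp: "computable_fun f \<Longrightarrow> computable_fun g \<Longrightarrow> computable_fun (\<lambda>n. f (g n))"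
  unfolding computable_fun_def by (meson rec_eval_Comp1)

lemma computable_pfst [computable_intros]: "computable_fun f \<Longrightarrow> computable_fun (\<lambda>n. pfst (f n))"
  by (rule computable_comp[of pfst]) (auto simp: computable_fun_def intro!: recf_fst)

lemma computable_psnd [computable_intros]: "computable_fun f \<Longrightarrow> computable_fun (\<lambda>n. psnd (f n))"
  by (rule computable_comp[of psnd]) (auto simp: computable_fun_def intro!: recf_snd)

lemma computable_pair [computable_intros]:
  "computable_fun f \<Longrightarrow> computable_fun g \<Longrightarrow> computable_fun (\<lambda>n. prod_encode (f n, g n))"
  unfolding computable_fun_def by (meson rec_eval_Comp2 recf_pair)

lemma computable_id [computable_intros]: "computable_fun (\<lambda>n. n)"
  unfolding computable_fun_def by (intro exI[of _ "Proj 0"] allI rec_eval_Proj) auto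

lemma computable_Suc [computable_intros]: "computable_fun f \<Longrightarrow> computable_fun (\<lambda>n. Suc (f n))"
  unfolding computable_fun_def by (meson rec_eval_Comp1 rec_eval.Succ)

lemma computable_const [computable_intros]: "computable_fun (\<lambda>n. c)"
proof (induction c)
  case 0
  show ?case unfolding computable_fun_def by (intro exI[of _ Zero] allI rec_eval.Zero)
qed (rule computable_Suc)

text \<open>Functions of several variables are treated as functions of one variable on nested pairs;
  the step function thus receives parameter, counter and previous value through \<open>pfst\<close>
  and \<open>psnd\<close>.\<close>

lemma computable_rec_nat [computable_intros]:
  assumes "computable_fun a" "computable_fun b"
    and "computable_fun (\<lambda>n. G (pfst n) (pfst (psnd n)) (psnd (psnd n)))"
  shows "computable_fun (\<lambda>n. rec_nat (a n) (G n) (b n))"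
proof -
  obtain ra rb rg where ra: "\<And>n. rec_eval ra [n] (a n)" and rb: "\<And>n. rec_eval rb [n] (b n)"
    and rg: "\<And>n. rec_eval rg [n] (G (pfst n) (pfst (psnd n)) (psnd (psnd n)))"
    using assms unfolding computable_fun_def by metis
  let ?g = "Comp rg [Comp recf_pair [Proj 2, Comp recf_pair [Proj 0, Proj 1]]]"
  have g: "rec_eval ?g [m, v, n] (G n m v)" for m v n
    using rg[of "prod_encode (n, prod_encode (m, v))"]
    by (intro rec_eval_Comp2 rec_eval_Comp1) (auto intro!: rec_eval_Proj recf_pair)
  have "rec_eval (PrimRec ra ?g) [m, n] (rec_nat (a n) (G n) m)" for m n
  proof (induction m)
    case 0
    then show ?case by (auto intro!: rec_eval.PrimRec_0 ra)
  next
    case (Suc m)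
    show ?case using rec_eval.PrimRec_Suc[OF Suc g] by simp
  qed
  then have "rec_eval (Comp (PrimRec ra ?g) [rb, Proj 0]) [n] (rec_nat (a n) (G n) (b n))" for n
    by (intro rec_eval_Comp2) (auto intro!: rec_eval_Proj rb)
  then show ?thesis unfolding computable_fun_def by blast
qed

lemma computable_add [computable_intros]:
  "computable_fun f \<Longrightarrow> computable_fun g \<Longrightarrow> computable_fun (\<lambda>n. f n + g n)"
  unfolding computable_fun_def by (meson rec_eval_Comp2 recf_add)

lemma computable_diff [computable_intros]:
  "computable_fun f \<Longrightarrow> computable_fun g \<Longrightarrow> computable_fun (\<lambda>n. f n - g n)"
  unfolding computable_fun_def by (meson rec_eval_Comp2 recf_diff)

lemma computable_mult [computable_intros]:
  assumes "computable_fun f" "computable_fun g" shows "computable_fun (\<lambda>n. f n * g n)"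
proof -
  have "rec_nat 0 (\<lambda>_ v. v + a) m = m * a" for a m :: nat by (induction m) auto
  moreover have "computable_fun (\<lambda>n. rec_nat 0 (\<lambda>_ v. v + g n) (f n))"
    by (intro computable_intros computable_comp[OF assms(2)] assms)
  ultimately show ?thesis by simp
qed

lemma computable_power [computable_intros]:
  assumes "computable_fun f" "computable_fun g" shows "computable_fun (\<lambda>n. f n ^ g n)"
proof -
  have "rec_nat 1 (\<lambda>_ v. v * a) m = a ^ m" for a m :: nat by (induction m) auto
  moreover have "computable_fun (\<lambda>n. rec_nat 1 (\<lambda>_ v. v * f n) (g n))"
    by (intro computable_intros computable_comp[OF assms(1)] assms)
  ultimately show ?thesis by simp
qed

definition computable_pred :: "(nat \<Rightarrow> bool) \<Rightarrow> bool" where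
  "computable_pred P \<longleftrightarrow> computable_fun (\<lambda>n. of_bool (P n))"

lemma computable_of_bool [computable_intros]: "computable_pred P \<Longrightarrow> computable_fun (\<lambda>n. of_bool (P n))"
  by (simp add: computable_pred_def)

lemma computable_pred_eq_0: "computable_fun f \<Longrightarrow> computable_pred (\<lambda>n. f n = 0)"
proof -
  assume f: "computable_fun f"
  have "(\<lambda>n. of_bool (f n = 0)) = (\<lambda>n. 1 - f n)" by auto
  moreover have "computable_fun (\<lambda>n. 1 - f n)"
    by (intro computable_intros f)
  ultimately show ?thesis unfolding computable_pred_def by (simp only:)
qed

lemma computable_pred_not [computable_intros]: "computable_pred P \<Longrightarrow> computable_pred (\<lambda>n. \<not> P n)"
  using computable_pred_eq_0[of "\<lambda>n. of_bool (P n)"] by (simp add: computable_pred_def)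

lemma computable_pred_conj [computable_intros]:
  assumes "computable_pred P" "computable_pred Q" shows "computable_pred (\<lambda>n. P n \<and> Q n)"
proof -
  have "(\<lambda>n. of_bool (P n \<and> Q n)) = (\<lambda>n. of_bool (P n) * (of_bool (Q n) :: nat))" by auto
  moreover have "computable_fun (\<lambda>n. of_bool (P n) * of_bool (Q n))"
    by (intro computable_intros assms)
  ultimately show ?thesis unfolding computable_pred_def by (simp only:)
qed

lemma computable_pred_disj [computable_intros]:
  assumes "computable_pred P" "computable_pred Q" shows "computable_pred (\<lambda>n. P n \<or> Q n)"
  using computable_pred_not[OF computable_pred_conj[OF computable_pred_not[OF assms(1)] computable_pred_not[OF assms(2)]]]
  by simp

lemma computable_pred_imp [computable_intros]:
  assumes "computable_pred P" "computable_pred Q" shows "computable_pred (\<lambda>n. P n \<longrightarrow> Q n)"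
  unfolding imp_conv_disj by (intro computable_intros assms)

lemma computable_pred_le [computable_intros]:
  assumes "computable_fun f" "computable_fun g" shows "computable_pred (\<lambda>n. f n \<le> g n)"
  using computable_pred_eq_0[OF computable_diff[OF assms]] by simp

lemma computable_pred_less [computable_intros]:
  assumes "computable_fun f" "computable_fun g" shows "computable_pred (\<lambda>n. f n < g n)"
  using computable_pred_not[OF computable_pred_le[OF assms(2,1)]] by (simp add: not_le)

lemma computable_pred_eq [computable_intros]:
  fixes f g :: "nat \<Rightarrow> nat"
  assumes "computable_fun f" "computable_fun g" shows "computable_pred (\<lambda>n. f n = g n)"
  using computable_pred_conj[OF computable_pred_le[OF assms] computable_pred_le[OF assms(2,1)]]
  by (simp add: eq_iff)

lemma computable_pred_iff [computable_intros]:
  assumes "computable_pred P" "computable_pred Q" shows "computable_pred (\<lambda>n. P n \<longleftrightarrow> Q n)"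
  unfolding iff_conv_conj_imp by (intro computable_intros assms)

lemma computable_pred_const [computable_intros]: "computable_pred (\<lambda>n. c)"
  unfolding computable_pred_def by (rule computable_const)

lemma computable_if [computable_intros]:
  assumes "computable_pred P" "computable_fun f" "computable_fun g"
  shows "computable_fun (\<lambda>n. if P n then f n else g n)"
proof -
  have "(\<lambda>n. if P n then f n else g n) = (\<lambda>n. of_bool (P n) * f n + of_bool (\<not> P n) * g n)" by auto
  moreover have "computable_fun (\<lambda>n. of_bool (P n) * f n + of_bool (\<not> P n) * g n)"
    by (intro computable_intros assms)
  ultimately show ?thesis by (simp only:)
qed

lemma computable_pred_if [computable_intros]:
  assumes "computable_pred P" "computable_pred Q" "computable_pred R"
  shows "computable_pred (\<lambda>n. if P n then Q n else R n)"
  unfolding if_bool_eq_conj by (intro computable_intros assms)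

lemma computable_pred_comp: "computable_pred P \<Longrightarrow> computable_fun g \<Longrightarrow> computable_pred (\<lambda>n. P (g n))"
  unfolding computable_pred_def by (rule computable_comp)

text \<open>The assumption \<open>ex\<close> keeps the minimization total. Bounded quantifiers and
  division are reduced to this rule.\<close>

lemma computable_Least [computable_intros]:
  assumes P: "computable_pred (\<lambda>n. P (pfst n) (psnd n))" and ex: "\<And>n. \<exists>m. P n m"
  shows "computable_fun (\<lambda>n. LEAST m. P n m)"
proof -
  have "computable_fun (\<lambda>n. of_bool (\<not> P (pfst n) (psnd n)))"
    by (intro computable_intros P)
  then obtain r where r: "\<And>n. rec_eval r [n] (of_bool (\<not> P (pfst n) (psnd n)))"
    unfolding computable_fun_def by blast
  let ?f = "Comp r [Comp recf_pair [Proj 1, Proj 0]]"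
  have f: "rec_eval ?f [m, n] (of_bool (\<not> P n m))" for m n
    using r[of "prod_encode (n, m)"]
    by (intro rec_eval_Comp2 rec_eval_Comp1) (auto intro!: rec_eval_Proj recf_pair)
  have "rec_eval (Minim ?f) [n] (LEAST m. P n m)" for n
  proof (rule rec_eval.Minim)
    show "rec_eval ?f [LEAST m. P n m, n] 0"
      using f[of "LEAST m. P n m" n] LeastI_ex[OF ex[of n]] by simp
    show "\<exists>y. rec_eval ?f [m, n] (Suc y)" if "m < (LEAST m. P n m)" for m
      using f[of m n] not_less_Least[OF that] by auto
  qed
  then show ?thesis unfolding computable_fun_def by blast
qed

lemma computable_pred_ball [computable_intros]:
  assumes "computable_fun b" and P: "computable_pred (\<lambda>n. P (pfst n) (psnd n))"
  shows "computable_pred (\<lambda>n. \<forall>m<b n. P n m)"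
proof -
  \<comment> \<open>A search for a counterexample below \<open>b n\<close>: the value
    \<open>b n\<close> always stops it, so ending there means that none exists.\<close>
  have "(LEAST m. m < b n \<longrightarrow> \<not> P n m) = b n \<longleftrightarrow> (\<forall>m<b n. P n m)" for n
  proof
    assume "(LEAST m. m < b n \<longrightarrow> \<not> P n m) = b n"
    then show "\<forall>m<b n. P n m"
      by (metis (mono_tags, lifting) not_less_Least)
  next
    assume "\<forall>m<b n. P n m"
    then show "(LEAST m. m < b n \<longrightarrow> \<not> P n m) = b n"
      by (intro Least_equality) (auto intro: leI)
  qed
  moreover have "computable_pred (\<lambda>n. (LEAST m. m < b n \<longrightarrow> \<not> P n m) = b n)"
  proof (intro computable_intros computable_comp[OF assms(1)] assms)
    show "\<exists>m. m < b n \<longrightarrow> \<not> P n m" for n by (rule exI[of _ "b n"]) simp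
  qed
  ultimately show ?thesis by simp
qed

lemma computable_pred_bex [computable_intros]:
  assumes "computable_fun b" and P: "computable_pred (\<lambda>n. P (pfst n) (psnd n))"
  shows "computable_pred (\<lambda>n. \<exists>m<b n. P n m)"
proof -
  have "computable_pred (\<lambda>n. \<not> (\<forall>m<b n. \<not> P n m))"
    by (intro computable_intros assms)
  then show ?thesis by simp
qed

lemma computable_div [computable_intros]:
  assumes "computable_fun f" "computable_fun g"
  shows "computable_fun (\<lambda>n. f n div g n)"
proof -
  have "(LEAST q. a < b * Suc q \<or> b = 0) = a div b" for a b :: nat
  proof (cases "b = 0")
    case False
    show ?thesis
    proof (rule Least_equality)
      show "a < b * Suc (a div b) \<or> b = 0" using False by (simp add: dividend_less_times_div)
      show "a div b \<le> q" if "a < b * Suc q \<or> b = 0" for q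
        using that False by (metis less_Suc_eq_le less_mult_imp_div_less mult.commute)
    qed
  qed (auto intro: Least_equality)
  moreover have "computable_fun (\<lambda>n. LEAST q. f n < g n * Suc q \<or> g n = 0)"
  proof (intro computable_intros computable_comp[OF assms(1)] computable_comp[OF assms(2)] assms)
    show "\<exists>m. f n < g n * Suc m \<or> g n = 0" for n
      by (metis dividend_less_times_div neq0_conv mult_Suc_right)
  qed
  ultimately show ?thesis by simp
qed

lemma computable_mod [computable_intros]:
  "computable_fun f \<Longrightarrow> computable_fun g \<Longrightarrow> computable_fun (\<lambda>n. f n mod g n)"
  unfolding minus_mult_div_eq_mod[symmetric] by (intro computable_intros)

lemma rec_enumerableI:
  assumes P: "computable_pred (\<lambda>n. P (pfst n) (psnd n))"
  shows "rec_enumerable {n. \<exists>s. P n s}"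
proof -
  have "computable_fun (\<lambda>n. of_bool (\<not> P (pfst n) (psnd n)))"
    by (intro computable_intros P)
  then obtain r where r: "\<And>n. rec_eval r [n] (of_bool (\<not> P (pfst n) (psnd n)))"
    unfolding computable_fun_def by blast
  let ?f = "Comp r [Comp recf_pair [Proj 1, Proj 0]]"
  have f: "rec_eval ?f [m, n] (of_bool (\<not> P n m))" for m n
    using r[of "prod_encode (n, m)"]
    by (intro rec_eval_Comp2 rec_eval_Comp1) (auto intro!: rec_eval_Proj recf_pair)
  have "(\<exists>s. P n s) \<longleftrightarrow> (\<exists>y. rec_eval (Minim ?f) [n] y)" for n
  proof
    assume ex: "\<exists>s. P n s"
    have "rec_eval (Minim ?f) [n] (LEAST m. P n m)"
    proof (rule rec_eval.Minim)
      show "rec_eval ?f [LEAST m. P n m, n] 0"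
        using f[of "LEAST m. P n m" n] LeastI_ex[OF ex] by simp
      show "\<exists>y. rec_eval ?f [m, n] (Suc y)" if "m < (LEAST m. P n m)" for m
        using f[of m n] not_less_Least[OF that] by auto
    qed
    then show "\<exists>y. rec_eval (Minim ?f) [n] y" by blast
  next
    assume "\<exists>y. rec_eval (Minim ?f) [n] y"
    then obtain y where "rec_eval ?f [y, n] 0" by (blast elim: rec_eval_MinimE)
    from rec_eval_deterministic[OF f this] show "\<exists>s. P n s" by auto
  qed
  then show ?thesis unfolding rec_enumerable_def by blast
qed

lemma rec_enumerable_decidable: "computable_pred P \<Longrightarrow> rec_enumerable {n. P n}"
  using rec_enumerableI[of "\<lambda>n _. P n"] computable_pred_comp[of P pfst] computable_pfst[OF computable_id] by simp

section \<open>String codes and step-bounded evaluation\<close>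

lemma computable_comp2:
  assumes "computable_fun (\<lambda>n. F (pfst n) (psnd n))" "computable_fun f" "computable_fun g"
  shows "computable_fun (\<lambda>n. F (f n) (g n))"
  using computable_comp[OF assms(1) computable_pair[OF assms(2,3)]] by simp

lemma computable_pred_comp2:
  assumes "computable_pred (\<lambda>n. P (pfst n) (psnd n))" "computable_fun f" "computable_fun g"
  shows "computable_pred (\<lambda>n. P (f n) (g n))"
  using computable_pred_comp[OF assms(1) computable_pair[OF assms(2,3)]] by simp

definition code_hd :: "nat \<Rightarrow> nat" where "code_hd v = pfst (v - 1)"
definition code_tl :: "nat \<Rightarrow> nat" where "code_tl v = psnd (v - 1)"
definition code_drop :: "nat \<Rightarrow> nat \<Rightarrow> nat" where "code_drop v i = rec_nat v (\<lambda>_. code_tl) i"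
definition code_nth :: "nat \<Rightarrow> nat \<Rightarrow> nat" where "code_nth v i = code_hd (code_drop v i)"
definition code_length :: "nat \<Rightarrow> nat" where "code_length v = (LEAST i. code_drop v i = 0)"

lemma list_encode_eq_0 [simp]: "list_encode xs = 0 \<longleftrightarrow> xs = []"
  by (cases xs) auto

lemma code_hd_Cons [simp]: "code_hd (list_encode (x # xs)) = x"
  and code_tl_Cons [simp]: "code_tl (list_encode (x # xs)) = list_encode xs"
  by (simp_all add: code_hd_def code_tl_def)

lemma code_hd_0 [simp]: "code_hd 0 = 0" and code_tl_0 [simp]: "code_tl 0 = 0"
  by (simp_all add: code_hd_def code_tl_def)

lemma code_tl_list_encode: "code_tl (list_encode xs) = list_encode (tl xs)"
  by (cases xs) (auto simp del: list_encode.simps(2))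

lemma code_drop_list_encode [simp]: "code_drop (list_encode xs) i = list_encode (drop i xs)"
  unfolding code_drop_def
  by (induction i) (auto simp: code_tl_list_encode drop_Suc tl_drop)

lemma code_nth_list_encode: "code_nth (list_encode xs) i = (if i < length xs then xs ! i else 0)"
proof (cases "i < length xs")
  case True
  then have "drop i xs = xs ! i # drop (Suc i) xs" by (simp only: Cons_nth_drop_Suc)
  with True show ?thesis unfolding code_nth_def code_drop_list_encode
    by (simp only: code_hd_Cons if_True)
qed (simp add: code_nth_def)

lemma code_length_list_encode [simp]: "code_length (list_encode xs) = length xs"
  unfolding code_length_def by (rule Least_equality) auto

lemma computable_code_hd [computable_intros]: "computable_fun f \<Longrightarrow> computable_fun (\<lambda>n. code_hd (f n))"
  unfolding code_hd_def by (intro computable_intros)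

lemma computable_code_tl [computable_intros]: "computable_fun f \<Longrightarrow> computable_fun (\<lambda>n. code_tl (f n))"
  unfolding code_tl_def by (intro computable_intros)

lemma computable_code_drop [computable_intros]:
  "computable_fun f \<Longrightarrow> computable_fun g \<Longrightarrow> computable_fun (\<lambda>n. code_drop (f n) (g n))"
  unfolding code_drop_def by (intro computable_intros)

lemma computable_code_nth [computable_intros]:
  "computable_fun f \<Longrightarrow> computable_fun g \<Longrightarrow> computable_fun (\<lambda>n. code_nth (f n) (g n))"
  unfolding code_nth_def by (intro computable_intros)

lemma computable_code_length [computable_intros]:
  assumes "computable_fun f" shows "computable_fun (\<lambda>n. code_length (f n))"
proof (rule computable_comp[OF _ assms])
  have ex: "\<exists>m. code_drop n m = 0" for n
    using code_drop_list_encode[of "list_decode n" "length (list_decode n)"]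
    by (intro exI[of _ "length (list_decode n)"]) simp
  show "computable_fun code_length"
    unfolding code_length_def[abs_def] by (intro computable_intros ex)
qed

lemma length_list_decode: "length (list_decode v) = code_length v"
  using code_length_list_encode[of "list_decode v"] by simp

definition is_string :: "nat \<Rightarrow> bool" where "is_string v \<longleftrightarrow> (\<forall>i<code_length v. code_nth v i < 2)"

lemma computable_is_string [computable_intros]:
  "computable_fun f \<Longrightarrow> computable_pred (\<lambda>n. is_string (f n))"
  unfolding is_string_def
  by (rule computable_pred_comp) (intro computable_intros)

lemma code_length_string_code [simp]: "code_length (string_code x) = length x"
  by (simp add: string_code_def)

lemma code_nth_string_code: "code_nth (string_code x) i = of_bool (i < length x \<and> x ! i)"
  by (simp add: string_code_def code_nth_list_encode)

lemma inj_string_code: "inj string_code"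
proof (rule injI)
  fix x y assume "string_code x = string_code y"
  then have "map of_bool x = (map of_bool y :: nat list)"
    unfolding string_code_def using inj_list_encode[of UNIV] by (auto dest: injD)
  moreover have "inj (of_bool :: bool \<Rightarrow> nat)" by (auto intro!: injI simp: of_bool_def split: if_splits)
  ultimately show "x = y" by (metis inj_map_eq_map)
qed

lemma string_code_eq_iff [simp]: "string_code x = string_code y \<longleftrightarrow> x = y"
  using inj_string_code by (auto dest: injD)

lemma is_string_string_code [simp]: "is_string (string_code x)"
  by (simp add: is_string_def code_nth_string_code)

lemma is_stringE:
  assumes "is_string v" obtains x where "v = string_code x"
proof
  let ?xs = "list_decode v"
  have "\<forall>i<length ?xs. ?xs ! i < 2"
    using assms code_nth_list_encode[of ?xs] by (auto simp: is_string_def length_list_decode)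
  then have "map of_bool (map (\<lambda>a. a = 1) ?xs) = ?xs"
    by (intro nth_equalityI) (auto simp: less_2_cases_iff)
  then show "v = string_code (map (\<lambda>a. a = 1) ?xs)"
    unfolding string_code_def by simp
qed

lemma rec_enumerable_string_pairs:
  assumes P: "computable_pred (\<lambda>n. P (pfst n) (psnd n))"
    and iff: "\<And>x y. (x, y) \<in> \<Psi> \<longleftrightarrow> P (string_code x) (string_code y)"
  shows "rec_enumerable ((\<lambda>(x, y). prod_encode (string_code x, string_code y)) ` \<Psi>)"
proof -
  have "(\<lambda>(x, y). prod_encode (string_code x, string_code y)) ` \<Psi> =
      {n. is_string (pfst n) \<and> is_string (psnd n) \<and> P (pfst n) (psnd n)}"
  proof (intro equalityI subsetI)
    fix n assume "n \<in> {n. is_string (pfst n) \<and> is_string (psnd n) \<and> P (pfst n) (psnd n)}"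
    then obtain x y where "pfst n = string_code x" "psnd n = string_code y" "P (string_code x) (string_code y)"
      by (metis (mono_tags, lifting) is_stringE mem_Collect_eq)
    then show "n \<in> (\<lambda>(x, y). prod_encode (string_code x, string_code y)) ` \<Psi>"
      using iff prod_encode_pfst_psnd[of n] by (intro image_eqI[of _ _ "(x, y)"]) auto
  qed (auto simp: iff)
  then show ?thesis
    by (simp only:) (intro rec_enumerable_decidable computable_intros P)
qed

text \<open>\<open>C\<close> simulates \<open>r\<close> with a step bound: \<open>C e s\<close> is \<open>0\<close> while no value has been found and
  \<open>Suc y\<close> once the value \<open>y\<close> is known.\<close>

definition clock :: "(nat \<Rightarrow> nat \<Rightarrow> nat) \<Rightarrow> (nat list \<Rightarrow> nat \<Rightarrow> bool) \<Rightarrow> bool" where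
  "clock C R \<longleftrightarrow> computable_fun (\<lambda>n. C (pfst n) (psnd n)) \<and>
     (\<forall>e s s' y. C e s = Suc y \<longrightarrow> s \<le> s' \<longrightarrow> C e s' = Suc y) \<and>
     (\<forall>xs y. R xs y \<longleftrightarrow> (\<exists>s. C (list_encode xs) s = Suc y))"

lemma clockI:
  assumes "computable_fun (\<lambda>n. C (pfst n) (psnd n))"
    "\<And>e s s' y. C e s = Suc y \<Longrightarrow> s \<le> s' \<Longrightarrow> C e s' = Suc y"
    "\<And>xs y. R xs y \<Longrightarrow> \<exists>s. C (list_encode xs) s = Suc y"
    "\<And>xs y s. C (list_encode xs) s = Suc y \<Longrightarrow> R xs y"
  shows "clock C R"
  unfolding clock_def using assms by blast

lemma clock_computable: "clock C R \<Longrightarrow> computable_fun (\<lambda>n. C (pfst n) (psnd n))"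
  and clock_mono: "clock C R \<Longrightarrow> C e s = Suc y \<Longrightarrow> s \<le> s' \<Longrightarrow> C e s' = Suc y"
  and clock_iff: "clock C R \<Longrightarrow> R xs y \<longleftrightarrow> (\<exists>s. C (list_encode xs) s = Suc y)"
  unfolding clock_def by blast+

text \<open>The values of all \<open>gs\<close> are bundled into one list code, so that a list of
  results fits the type of \<open>clock\<close> and composition needs only two clocks.\<close>

lemma clock_list_all2:
  assumes "\<And>g. g \<in> set gs \<Longrightarrow> \<exists>C. clock C (rec_eval g)"
  shows "\<exists>D. clock D (\<lambda>xs v. list_all2 (\<lambda>g y. rec_eval g xs y) gs (list_decode v))"
  using assms
proof (induction gs)
  case Nil
  have "clock (\<lambda>_ _. Suc 0) (\<lambda>xs v. list_all2 (\<lambda>g y. rec_eval g xs y) [] (list_decode v))"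
  proof (rule clockI)
    fix xs and v :: nat
    assume "list_all2 (\<lambda>g y. rec_eval g xs y) [] (list_decode v)"
    then have "list_decode v = []" by simp
    then show "\<exists>s. Suc 0 = Suc v" using list_decode_inverse[of v] by simp
  qed (auto intro: computable_intros)
  then show ?case by blast
next
  case (Cons g gs)
  from Cons.IH[OF Cons.prems] obtain D
    where D: "clock D (\<lambda>xs v. list_all2 (\<lambda>g y. rec_eval g xs y) gs (list_decode v))" by auto
  from Cons.prems obtain C where C: "clock C (rec_eval g)" by auto
  let ?E = "\<lambda>e s. if C e s = 0 \<or> D e s = 0 then 0 else Suc (Suc (prod_encode (C e s - 1, D e s - 1)))"
  have E: "?E e s = Suc v \<longleftrightarrow> (\<exists>y w. C e s = Suc y \<and> D e s = Suc w \<and> v = Suc (prod_encode (y, w)))" for e s v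
    by (cases "C e s"; cases "D e s") auto
  have "clock ?E (\<lambda>xs v. list_all2 (\<lambda>g y. rec_eval g xs y) (g # gs) (list_decode v))"
  proof (rule clockI)
    show "computable_fun (\<lambda>n. ?E (pfst n) (psnd n))"
      by (intro computable_intros computable_comp2[OF clock_computable[OF C]]
          computable_comp2[OF clock_computable[OF D]])
  next
    fix e s s' v assume "?E e s = Suc v" "s \<le> s'"
    then show "?E e s' = Suc v" unfolding E using clock_mono[OF C] clock_mono[OF D] by blast
  next
    fix xs v assume "list_all2 (\<lambda>g y. rec_eval g xs y) (g # gs) (list_decode v)"
    then obtain y ys where y: "rec_eval g xs y" "list_all2 (\<lambda>g y. rec_eval g xs y) gs ys"
      and v: "list_decode v = y # ys" by (auto simp: list_all2_Cons1)
    from v have v': "v = Suc (prod_encode (y, list_encode ys))"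
      by (metis list_decode_inverse list_encode.simps(2))
    from y(1) obtain s1 where s1: "C (list_encode xs) s1 = Suc y" unfolding clock_iff[OF C] by blast
    from y(2) have "list_all2 (\<lambda>g y. rec_eval g xs y) gs (list_decode (list_encode ys))" by simp
    then obtain s2 where s2: "D (list_encode xs) s2 = Suc (list_encode ys)" unfolding clock_iff[OF D] by blast
    have "?E (list_encode xs) (max s1 s2) = Suc v"
      unfolding E v' using clock_mono[OF C s1, of "max s1 s2"] clock_mono[OF D s2, of "max s1 s2"] by auto
    then show "\<exists>s. ?E (list_encode xs) s = Suc v" by blast
  next
    fix xs v s assume "?E (list_encode xs) s = Suc v"
    then obtain y w where "C (list_encode xs) s = Suc y" "D (list_encode xs) s = Suc w"
      and v: "v = Suc (prod_encode (y, w))" unfolding E by blast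
    then have "rec_eval g xs y" "list_all2 (\<lambda>g y. rec_eval g xs y) gs (list_decode w)"
      using clock_iff[OF C] clock_iff[OF D] by blast+
    then show "list_all2 (\<lambda>g y. rec_eval g xs y) (g # gs) (list_decode v)" unfolding v by simp
  qed
  then show ?case by blast
qed

lemma clock_Comp:
  assumes C: "clock C (rec_eval f)"
    and D: "clock D (\<lambda>xs v. list_all2 (\<lambda>g y. rec_eval g xs y) gs (list_decode v))"
  shows "clock (\<lambda>e s. if D e s = 0 then 0 else C (D e s - 1) s) (rec_eval (Comp f gs))"
proof (rule clockI)
  let ?E = "\<lambda>e s. if D e s = 0 then 0 else C (D e s - 1) s"
  have E: "?E e s = Suc v \<longleftrightarrow> (\<exists>w. D e s = Suc w \<and> C w s = Suc v)" for e s v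
    by (cases "D e s") auto
  show "computable_fun (\<lambda>n. ?E (pfst n) (psnd n))"
    by (intro computable_intros computable_comp2[OF clock_computable[OF C]]
          computable_comp2[OF clock_computable[OF D]])
  fix e s s' v
  show "?E e s' = Suc v" if "?E e s = Suc v" "s \<le> s'"
    using that unfolding E using clock_mono[OF C] clock_mono[OF D] by blast
  fix xs
  show "\<exists>s. ?E (list_encode xs) s = Suc v" if "rec_eval (Comp f gs) xs v"
  proof -
    from that obtain ys where y: "list_all2 (\<lambda>g y. rec_eval g xs y) gs ys" "rec_eval f ys v"
      by (rule rec_eval_CompE)
    from y(2) obtain s1 where s1: "C (list_encode ys) s1 = Suc v" unfolding clock_iff[OF C] by blast
    from y(1) have "list_all2 (\<lambda>g y. rec_eval g xs y) gs (list_decode (list_encode ys))" by simp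
    then obtain s2 where s2: "D (list_encode xs) s2 = Suc (list_encode ys)" unfolding clock_iff[OF D] by blast
    have "?E (list_encode xs) (max s1 s2) = Suc v"
      unfolding E using clock_mono[OF C s1, of "max s1 s2"] clock_mono[OF D s2, of "max s1 s2"] by auto
    then show ?thesis by blast
  qed
  show "rec_eval (Comp f gs) xs v" if "?E (list_encode xs) s = Suc v"
  proof -
    from that obtain w where "D (list_encode xs) s = Suc w" "C (list_encode (list_decode w)) s = Suc v"
      unfolding E by auto
    then have "list_all2 (\<lambda>g y. rec_eval g xs y) gs (list_decode w)" "rec_eval f (list_decode w) v"
      using clock_iff[OF C] clock_iff[OF D] by blast+
    then show ?thesis by (rule rec_eval.Comp)
  qed
qed

lemma clock_PrimRec:
  assumes C: "clock C (rec_eval f)" and D: "clock D (rec_eval g)"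
  shows "clock (\<lambda>e s. if e = 0 then 0 else rec_nat (C (code_tl e) s)
    (\<lambda>m v. if v = 0 then 0 else D (Suc (prod_encode (m, Suc (prod_encode (v - 1, code_tl e))))) s)
    (code_hd e)) (rec_eval (PrimRec f g))"
proof -
  let ?R = "\<lambda>e s. rec_nat (C e s)
    (\<lambda>m v. if v = 0 then 0 else D (Suc (prod_encode (m, Suc (prod_encode (v - 1, e))))) s)"
  let ?E = "\<lambda>e s. if e = 0 then 0 else ?R (code_tl e) s (code_hd e)"
  have R: "?R e s (Suc m) = Suc v \<longleftrightarrow>
      (\<exists>w. ?R e s m = Suc w \<and> D (Suc (prod_encode (m, Suc (prod_encode (w, e))))) s = Suc v)" for e s m v
    by (cases "?R e s m") auto
  have mono: "?R e s' m = Suc v" if "?R e s m = Suc v" "s \<le> s'" for e s s' m v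
    using that(1)
  proof (induction m arbitrary: v)
    case 0
    then show ?case using clock_mono[OF C _ that(2)] by simp
  next
    case (Suc m)
    then show ?case unfolding R using clock_mono[OF D _ that(2)] by blast
  qed
  have complete: "\<exists>s. ?R (list_encode xs) s m = Suc v" if "rec_eval (PrimRec f g) (m # xs) v" for xs m v
    using that
  proof (induction m arbitrary: v)
    case 0
    then have "rec_eval f xs v" by (rule rec_eval_PrimRec_0E)
    then show ?case unfolding clock_iff[OF C] by simp
  next
    case (Suc m)
    then obtain w where w: "rec_eval (PrimRec f g) (m # xs) w" "rec_eval g (m # w # xs) v"
      by (auto elim: rec_eval_PrimRec_SucE)
    from Suc.IH[OF w(1)] obtain s1 where s1: "?R (list_encode xs) s1 m = Suc w" by blast
    from w(2) obtain s2 where s2: "D (list_encode (m # w # xs)) s2 = Suc v"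
      unfolding clock_iff[OF D] by blast
    have "?R (list_encode xs) (max s1 s2) (Suc m) = Suc v"
      unfolding R using mono[OF s1, of "max s1 s2"] clock_mono[OF D s2, of "max s1 s2"] by auto
    then show ?case by blast
  qed
  have sound: "rec_eval (PrimRec f g) (m # xs) v" if "?R (list_encode xs) s m = Suc v" for xs s m v
    using that
  proof (induction m arbitrary: v)
    case 0
    then have "rec_eval f xs v" unfolding clock_iff[OF C] by auto
    then show ?case by (rule rec_eval.PrimRec_0)
  next
    case (Suc m)
    then obtain w where w: "?R (list_encode xs) s m = Suc w" "D (list_encode (m # w # xs)) s = Suc v"
      unfolding R by auto
    from w(2) have "rec_eval g (m # w # xs) v" unfolding clock_iff[OF D] by blast
    with Suc.IH[OF w(1)] show ?case by (rule rec_eval.PrimRec_Suc)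
  qed
  show ?thesis
  proof (rule clockI)
    show "computable_fun (\<lambda>n. ?E (pfst n) (psnd n))"
      by (intro computable_intros computable_comp2[OF clock_computable[OF C]]
          computable_comp2[OF clock_computable[OF D]])
    show "?E e s' = Suc v" if "?E e s = Suc v" "s \<le> s'" for e s s' v
    proof (cases "e = 0")
      case False
      with that(1) have "?R (code_tl e) s (code_hd e) = Suc v" by (simp only: if_False)
      from mono[OF this that(2)] False show ?thesis by (simp only: if_False)
    qed (use that in simp)
    show "\<exists>s. ?E (list_encode xs) s = Suc v" if "rec_eval (PrimRec f g) xs v" for xs v
    proof (cases xs)
      case Nil
      with that show ?thesis by (auto elim: rec_eval.cases)
    next
      case (Cons m ys)
      with complete[of m ys v] that show ?thesis
        by (simp only: code_hd_Cons code_tl_Cons list_encode_eq_0 list.distinct if_False)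
    qed
    show "rec_eval (PrimRec f g) xs v" if "?E (list_encode xs) s = Suc v" for xs v s
    proof (cases xs)
      case Nil
      with that show ?thesis by simp
    next
      case (Cons m ys)
      with sound[of ys s m v] that show ?thesis
        by (simp only: code_hd_Cons code_tl_Cons list_encode_eq_0 list.distinct if_False)
    qed
  qed
qed

lemma clock_Minim:
  assumes C: "clock C (rec_eval f)"
  shows "\<exists>E. clock E (rec_eval (Minim f))"
proof -
  let ?c = "\<lambda>e s m. C (Suc (prod_encode (m, e))) s"
  \<comment> \<open>In a clock, \<open>0\<close> means undecided, \<open>1\<close> the value
    \<open>0\<close>, and anything larger a positive value. The search halts at the first argument
    not known to have a positive value; the bound \<open>s\<close> makes it total, and only a clock
    value of exactly \<open>1\<close> counts as success.\<close>
  let ?N = "\<lambda>e s. LEAST m. m \<ge> s \<or> ?c e s m \<le> 1"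
  let ?E = "\<lambda>e s. if ?N e s < s \<and> ?c e s (?N e s) = 1 then Suc (?N e s) else 0"
  have E: "?E e s = Suc m \<longleftrightarrow> m < s \<and> ?c e s m = Suc 0 \<and> (\<forall>k<m. \<exists>y. ?c e s k = Suc (Suc y))" for e s m
  proof
    assume a: "?E e s = Suc m"
    then have m: "m = ?N e s" "m < s" "?c e s m = Suc 0" by (auto split: if_splits)
    have "\<exists>y. ?c e s k = Suc (Suc y)" if "k < m" for k
    proof -
      have "\<not> ?c e s k \<le> 1" using not_less_Least[of k "\<lambda>m. m \<ge> s \<or> ?c e s m \<le> 1"] that m(1) by simp
      then show ?thesis by (metis One_nat_def not_less_eq_eq old.nat.exhaust zero_le)
    qed
    with m show "m < s \<and> ?c e s m = Suc 0 \<and> (\<forall>k<m. \<exists>y. ?c e s k = Suc (Suc y))" by blast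
  next
    assume a: "m < s \<and> ?c e s m = Suc 0 \<and> (\<forall>k<m. \<exists>y. ?c e s k = Suc (Suc y))"
    have "?N e s = m"
    proof (rule Least_equality)
      show "m \<ge> s \<or> ?c e s m \<le> 1" using a by simp
      show "m \<le> k" if "k \<ge> s \<or> ?c e s k \<le> 1" for k
        using that a by (metis One_nat_def Suc_n_not_le_n leI le_trans less_imp_le not_less_eq_eq zero_le)
    qed
    then show "?E e s = Suc m" using a by simp
  qed
  have "clock ?E (rec_eval (Minim f))"
  proof (rule clockI)
    have ex: "\<exists>m. m \<ge> s \<or> ?c e s m \<le> 1" for e s by blast
    have "computable_fun (\<lambda>n. ?N (pfst n) (psnd n))"
      by (intro computable_intros ex computable_comp2[OF clock_computable[OF C]])
    note N = computable_comp2[OF this]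
    show "computable_fun (\<lambda>n. ?E (pfst n) (psnd n))"
      by (intro N computable_intros computable_comp2[OF clock_computable[OF C]])
    show "?E e s' = Suc v" if "?E e s = Suc v" "s \<le> s'" for e s s' v
    proof -
      note m = clock_mono[OF C _ that(2)]
      from that show ?thesis unfolding E by (meson m less_le_trans)
    qed
    show "\<exists>s. ?E (list_encode xs) s = Suc v" if "rec_eval (Minim f) xs v" for xs v
    proof -
      from that have "rec_eval f (v # xs) 0" by (rule rec_eval_MinimE)
      then obtain s1 where s1: "?c (list_encode xs) s1 v = Suc 0" unfolding clock_iff[OF C] by auto
      from that have "\<forall>k<v. \<exists>y. rec_eval f (k # xs) (Suc y)" by (rule rec_eval_MinimE) blast
      then have "\<forall>k<v. \<exists>s y. ?c (list_encode xs) s k = Suc (Suc y)" unfolding clock_iff[OF C] by fastforce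
      then obtain S Y where S: "\<And>k. k < v \<Longrightarrow> ?c (list_encode xs) (S k) k = Suc (Suc (Y k))" by metis
      let ?s = "s1 + Suc v + (\<Sum>k<v. S k)"
      have "S k \<le> ?s" if "k < v" for k
        using member_le_sum[of k "{..<v}" S] that by simp
      then have "\<forall>k<v. ?c (list_encode xs) ?s k = Suc (Suc (Y k))"
        using clock_mono[OF C S] by blast
      moreover have "?c (list_encode xs) ?s v = Suc 0" using clock_mono[OF C s1] by simp
      ultimately have "?E (list_encode xs) ?s = Suc v" unfolding E by auto
      then show ?thesis by blast
    qed
    show "rec_eval (Minim f) xs v" if "?E (list_encode xs) s = Suc v" for xs v s
    proof (rule rec_eval.Minim)
      from that have a: "?c (list_encode xs) s v = Suc 0"
        "\<forall>k<v. \<exists>y. ?c (list_encode xs) s k = Suc (Suc y)" unfolding E by blast+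
      show "rec_eval f (v # xs) 0" unfolding clock_iff[OF C] using a(1) by auto
      show "\<exists>y. rec_eval f (m # xs) (Suc y)" if "m < v" for m
        unfolding clock_iff[OF C] using a(2) that by fastforce
    qed
  qed
  then show ?thesis by blast
qed

lemma clock_exists: "\<exists>C. clock C (rec_eval r)"
proof (induction r)
  case Zero
  have "clock (\<lambda>_ _. Suc 0) (rec_eval Zero)"
    by (rule clockI) (auto intro: computable_intros rec_eval.Zero elim: rec_eval_ZeroE)
  then show ?case by blast
next
  case Succ
  have "clock (\<lambda>e s. if e = 0 then 0 else Suc (Suc (code_hd e))) (rec_eval Succ)"
  proof (rule clockI)
    show "\<exists>s. (if list_encode xs = 0 then 0 else Suc (Suc (code_hd (list_encode xs)))) = Suc y"
      if "rec_eval Succ xs y" for xs y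
      using that by (rule rec_eval_SuccE) (simp del: list_encode.simps(2))
    show "rec_eval Succ xs y"
      if "(if list_encode xs = 0 then 0 else Suc (Suc (code_hd (list_encode xs)))) = Suc y" for xs y
      using that by (cases xs) (auto simp del: list_encode.simps(2) intro: rec_eval.Succ)
  qed (auto intro!: computable_intros split: if_splits)
  then show ?case by blast
next
  case (Proj i)
  have "clock (\<lambda>e s. if i < code_length e then Suc (code_nth e i) else 0) (rec_eval (Proj i))"
  proof (rule clockI)
    show "\<exists>s. (if i < code_length (list_encode xs) then Suc (code_nth (list_encode xs) i) else 0) = Suc y"
      if "rec_eval (Proj i) xs y" for xs y
      using that by (rule rec_eval_ProjE) (simp add: code_nth_list_encode)
    show "rec_eval (Proj i) xs y"
      if "(if i < code_length (list_encode xs) then Suc (code_nth (list_encode xs) i) else 0) = Suc y" for xs y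
      using that by (auto simp: code_nth_list_encode intro!: rec_eval_Proj split: if_splits)
  qed (auto intro!: computable_intros split: if_splits)
  then show ?case by blast
next
  case (Comp f gs)
  then show ?case using clock_list_all2[of gs] clock_Comp by blast
next
  case (PrimRec f g)
  then show ?case using clock_PrimRec by blast
next
  case (Minim f)
  then show ?case using clock_Minim by blast
qed

text \<open>Converse of \<open>rec_enumerableI\<close>, and the purpose of the clocks: the witness
  is a number of steps after which the enumeration has halted.\<close>

lemma rec_enumerable_projection:
  assumes "rec_enumerable A"
  obtains P where "computable_pred (\<lambda>n. P (pfst n) (psnd n))" "A = {n. \<exists>s. P n s}"
proof -
  from assms obtain r where r: "\<And>n. n \<in> A \<longleftrightarrow> (\<exists>y. rec_eval r [n] y)" unfolding rec_enumerable_def by blast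
  from clock_exists obtain C where C: "clock C (rec_eval r)" by blast
  show ?thesis
  proof
    show "computable_pred (\<lambda>n. C (Suc (prod_encode (pfst n, 0))) (psnd n) \<noteq> 0)"
      by (intro computable_intros computable_comp2[OF clock_computable[OF C]])
    show "A = {n. \<exists>s. C (Suc (prod_encode (n, 0))) s \<noteq> 0}"
      using r unfolding clock_iff[OF C] by (fastforce simp: gr0_conv_Suc)
  qed
qed

section \<open>Monotone operations\<close>

lemma FinSeq_le_comparable:
  assumes "FinSeq x \<le> \<alpha>" "FinSeq y \<le> \<alpha>" "length x \<le> length y"
  shows "prefix x y"
proof (cases \<alpha>)
  case (FinSeq z)
  then show ?thesis using assms by (auto intro: prefix_length_prefix)
next
  case (InfSeq \<omega>)
  then have "x = seq_prefix \<omega> (length x)" "y = seq_prefix \<omega> (length y)" using assms by auto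
  then show ?thesis using take_seq_prefix[OF assms(3), of \<omega>] by (metis take_is_prefix)
qed

lemma FinSeq_le_InfSeq_iff: "FinSeq x \<le> InfSeq \<omega> \<longleftrightarrow> (\<forall>i<length x. x ! i = \<omega> i)"
  unfolding less_eq_binseq.simps list_eq_iff_nth_eq[of x] by (simp add: seq_prefix_def)

lemma binseq_le_iff: "\<beta> \<le> \<gamma> \<longleftrightarrow> (\<forall>x. FinSeq x \<le> \<beta> \<longrightarrow> FinSeq x \<le> \<gamma>)"
proof
  show "\<forall>x. FinSeq x \<le> \<beta> \<longrightarrow> FinSeq x \<le> \<gamma>" if "\<beta> \<le> \<gamma>" using that by (auto intro: order_trans)
next
  assume le: "\<forall>x. FinSeq x \<le> \<beta> \<longrightarrow> FinSeq x \<le> \<gamma>"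
  show "\<beta> \<le> \<gamma>"
  proof (cases \<beta>)
    case (FinSeq x)
    then show ?thesis using le by blast
  next
    case \<beta>: (InfSeq \<omega>)
    then have pre: "FinSeq (seq_prefix \<omega> n) \<le> \<gamma>" for n using le by simp
    show ?thesis
    proof (cases \<gamma>)
      case (FinSeq z)
      then show ?thesis using pre[of "Suc (length z)"] by (auto dest: prefix_length_le)
    next
      case (InfSeq \<omega>')
      have "\<omega> i = \<omega>' i" for i
        using pre[of "Suc i"] unfolding InfSeq FinSeq_le_InfSeq_iff by (simp add: seq_prefix_def del: upt_Suc)
      then show ?thesis unfolding \<beta> InfSeq by auto
    qed
  qed
qed

text \<open>A chain of bounded length has a longest element; otherwise bit \<open>i\<close> of the
  limit is read off any member longer than \<open>i\<close>. The empty string is listed separately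
  because it lies below every \<open>\<beta>\<close> even if \<open>Y\<close> is empty.\<close>

lemma prefix_chain_Sup:
  assumes chain: "\<And>x y. x \<in> Y \<Longrightarrow> y \<in> Y \<Longrightarrow> prefix x y \<or> prefix y x"
    and closed: "\<And>x y. y \<in> Y \<Longrightarrow> prefix x y \<Longrightarrow> x \<in> Y"
  shows "\<exists>\<beta>. \<forall>x. FinSeq x \<le> \<beta> \<longleftrightarrow> x = [] \<or> x \<in> Y"
proof (cases "\<exists>N. \<forall>y\<in>Y. length y \<le> N")
  case True
  then obtain N where N: "\<And>y. y \<in> Y \<Longrightarrow> length y \<le> N" by blast
  show ?thesis
  proof (cases "Y = {}")
    case True
    then show ?thesis by (intro exI[of _ "FinSeq []"]) auto
  next
    case False
    then obtain y0 where "y0 \<in> Y" by blast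
    moreover have "\<forall>y. y \<in> Y \<longrightarrow> length y < Suc N" using N by (simp add: less_Suc_eq_le)
    ultimately obtain y where y: "y \<in> Y" "\<And>x. x \<in> Y \<Longrightarrow> length x \<le> length y"
      using ex_has_greatest_nat[of "\<lambda>y. y \<in> Y" y0 length "Suc N"] by metis
    have "prefix x y" if "x \<in> Y" for x
      using chain[OF that y(1)] prefix_length_prefix[OF prefix_order.refl _ y(2)[OF that]] by blast
    then have "FinSeq x \<le> FinSeq y \<longleftrightarrow> x = [] \<or> x \<in> Y" for x
      unfolding less_eq_binseq.simps using closed[OF y(1), of x] Nil_prefix by metis
    then show ?thesis by blast
  qed
next
  case False
  then have "\<forall>N. \<exists>y\<in>Y. N < length y" by (metis not_le)
  then obtain ys where ys: "\<And>N. ys N \<in> Y" "\<And>N. N < length (ys N)" by metis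
  let ?\<omega> = "\<lambda>i. ys i ! i"
  have nth: "y ! i = ?\<omega> i" if "y \<in> Y" "i < length y" for y i
    using chain[OF that(1) ys(1)[of i]] that(2) ys(2)[of i] by (auto simp: prefix_def nth_append)
  have "FinSeq x \<le> InfSeq ?\<omega> \<longleftrightarrow> x = [] \<or> x \<in> Y" for x
  proof
    assume "FinSeq x \<le> InfSeq ?\<omega>"
    then have "\<forall>i<length x. x ! i = ys (length x) ! i"
      unfolding FinSeq_le_InfSeq_iff using nth[OF ys(1)[of "length x"]] ys(2)[of "length x"] by auto
    then have "x = take (length x) (ys (length x))"
      using ys(2)[of "length x"] by (intro nth_equalityI) auto
    then show "x = [] \<or> x \<in> Y" using closed[OF ys(1)] by (metis take_is_prefix)
  next
    assume "x = [] \<or> x \<in> Y"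
    then show "FinSeq x \<le> InfSeq ?\<omega>" unfolding FinSeq_le_InfSeq_iff using nth by auto
  qed
  then show ?thesis by blast
qed

text \<open>Replaces \<open>LEAST\<close> by a membership test. Compatibility makes the outputs
  along \<open>\<alpha>\<close> a prefix-closed chain, whose supremum is the least upper
  bound.\<close>

lemma FinSeq_le_apply_op:
  assumes "computable_operation \<Psi>"
  shows "FinSeq x \<le> apply_op \<Psi> \<alpha> \<longleftrightarrow> x = [] \<or> (\<exists>p. FinSeq p \<le> \<alpha> \<and> (p, x) \<in> \<Psi>)"
proof -
  let ?Y = "{y. \<exists>p. FinSeq p \<le> \<alpha> \<and> (p, y) \<in> \<Psi>}"
  have compat: "prefix y y' \<or> prefix y' y" if "(x, y) \<in> \<Psi>" "(x', y') \<in> \<Psi>" "prefix x x'" for x x' y y'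
    using assms that unfolding computable_operation_def by blast
  have "\<exists>\<beta>. \<forall>x. FinSeq x \<le> \<beta> \<longleftrightarrow> x = [] \<or> x \<in> ?Y"
  proof (rule prefix_chain_Sup)
    fix y y' assume "y \<in> ?Y" "y' \<in> ?Y"
    then show "prefix y y' \<or> prefix y' y"
      using compat FinSeq_le_comparable nat_le_linear by blast
  next
    fix y y' assume "y \<in> ?Y" "prefix y' y"
    then show "y' \<in> ?Y" using assms unfolding computable_operation_def by blast
  qed
  then obtain \<beta> where \<beta>: "\<And>x. FinSeq x \<le> \<beta> \<longleftrightarrow> x = [] \<or> x \<in> ?Y" by blast
  have "apply_op \<Psi> \<alpha> = \<beta>"
    unfolding apply_op_def
  proof (rule Least_equality)
    show "\<forall>x y. FinSeq x \<le> \<alpha> \<longrightarrow> (x, y) \<in> \<Psi> \<longrightarrow> FinSeq y \<le> \<beta>" using \<beta> by blast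
    fix \<gamma> assume \<gamma>: "\<forall>x y. FinSeq x \<le> \<alpha> \<longrightarrow> (x, y) \<in> \<Psi> \<longrightarrow> FinSeq y \<le> \<gamma>"
    have "FinSeq [] \<le> \<gamma>" by (cases \<gamma>) (auto simp: seq_prefix_def)
    then show "\<beta> \<le> \<gamma>" unfolding binseq_le_iff[of \<beta>] \<beta> using \<gamma> by blast
  qed
  then show ?thesis using \<beta> by simp
qed

lemma apply_op_mono: "computable_operation \<Psi> \<Longrightarrow> \<alpha> \<le> \<beta> \<Longrightarrow> apply_op \<Psi> \<alpha> \<le> apply_op \<Psi> \<beta>"
  unfolding binseq_le_iff[of "apply_op \<Psi> \<alpha>"] FinSeq_le_apply_op by (meson order_trans)

lemma prefixI_nth:
  assumes "length x \<le> length y" "\<And>i. i < length x \<Longrightarrow> x ! i = y ! i" shows "prefix x y"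
proof -
  have "x = take (length x) y" using assms by (intro nth_equalityI) auto
  then show ?thesis by (metis take_is_prefix)
qed

lemma prefix_iff_nth: "prefix x y \<longleftrightarrow> length x \<le> length y \<and> (\<forall>i<length x. x ! i = y ! i)"
proof
  show "length x \<le> length y \<and> (\<forall>i<length x. x ! i = y ! i)" if "prefix x y"
    using that by (auto simp: prefix_def nth_append)
qed (simp add: prefixI_nth)

text \<open>\<open>M\<close> is a computable modulus of continuity: \<open>M i\<close> input bits
  settle output bit \<open>i\<close>, so \<open>T\<close> may be evaluated on a finite string padded
  with \<open>False\<close>. Reading \<open>code_nth\<close> beyond the end yields \<open>0\<close>,
  which is this padding.\<close>

lemma computable_transformationI:
  assumes M: "computable_fun M"
    and local: "\<And>\<omega> \<omega>' i. (\<And>j. j < M i \<Longrightarrow> \<omega> j = \<omega>' j) \<Longrightarrow> T \<omega> i = T \<omega>' i"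
    and T: "computable_pred (\<lambda>n. T (\<lambda>j. code_nth (pfst n) j = 1) (psnd n))"
  shows "computable_transformation T"
proof -
  let ?ext = "\<lambda>x j. j < length x \<and> x ! j"
  define \<Psi> where "\<Psi> = {(x, y). \<forall>i<length y. M i \<le> length x \<and> y ! i = T (?ext x) i}"
  have ext: "T (?ext x) i = T \<omega> i" if "M i \<le> length x" "\<And>j. j < M i \<Longrightarrow> x ! j = \<omega> j" for x \<omega> i
    using that by (intro local) auto
  have "computable_operation \<Psi>"
    unfolding computable_operation_def
  proof (intro conjI allI impI)
    let ?P = "\<lambda>v w. \<forall>i<code_length w. M i \<le> code_length v \<and>
      (code_nth w i = 1 \<longleftrightarrow> T (\<lambda>j. code_nth v j = 1) i)"
    show "rec_enumerable ((\<lambda>(x, y). prod_encode (string_code x, string_code y)) ` \<Psi>)"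
    proof (rule rec_enumerable_string_pairs)
      show "computable_pred (\<lambda>n. ?P (pfst n) (psnd n))"
        by (intro computable_intros computable_comp[OF M]
            computable_pred_comp2[where P = "\<lambda>v. T (\<lambda>j. code_nth v j = 1)", OF T])
      show "(x, y) \<in> \<Psi> \<longleftrightarrow> ?P (string_code x) (string_code y)" for x y
        by (auto simp: \<Psi>_def code_nth_string_code)
    qed
  next
    fix x y x' y' assume a: "(x, y) \<in> \<Psi>" "(x', y') \<in> \<Psi>" "prefix x x'"
    have eq: "y ! i = y' ! i" if "i < length y" "i < length y'" for i
    proof -
      have "T (?ext x) i = T (?ext x') i"
        using a(1,3) that by (intro ext) (auto simp: \<Psi>_def prefix_iff_nth)
      then show ?thesis using a that by (auto simp: \<Psi>_def)
    qed
    show "prefix y y' \<or> prefix y' y"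
      using prefixI_nth[of y y'] prefixI_nth[of y' y] eq by (cases "length y \<le> length y'") auto
  next
    fix x y y' assume "(x, y) \<in> \<Psi>" "prefix y' y"
    then show "(x, y') \<in> \<Psi>" by (auto simp: \<Psi>_def prefix_iff_nth)
  qed
  moreover have "InfSeq (T \<omega>) = apply_op \<Psi> (InfSeq \<omega>)" for \<omega>
  proof -
    have "FinSeq y \<le> apply_op \<Psi> (InfSeq \<omega>) \<longleftrightarrow> FinSeq y \<le> InfSeq (T \<omega>)" for y
      unfolding FinSeq_le_apply_op[OF \<open>computable_operation \<Psi>\<close>]
    proof
      assume "y = [] \<or> (\<exists>p. FinSeq p \<le> InfSeq \<omega> \<and> (p, y) \<in> \<Psi>)"
      then show "FinSeq y \<le> InfSeq (T \<omega>)"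
      proof
        assume "\<exists>p. FinSeq p \<le> InfSeq \<omega> \<and> (p, y) \<in> \<Psi>"
        then obtain p where p: "FinSeq p \<le> InfSeq \<omega>" "(p, y) \<in> \<Psi>" by blast
        show ?thesis unfolding FinSeq_le_InfSeq_iff
        proof (intro allI impI)
          fix i assume i: "i < length y"
          have "T (?ext p) i = T \<omega> i"
            using p i unfolding FinSeq_le_InfSeq_iff by (intro ext) (auto simp: \<Psi>_def)
          then show "y ! i = T \<omega> i" using p(2) i by (auto simp: \<Psi>_def)
        qed
      qed (simp add: seq_prefix_def)
    next
      assume y: "FinSeq y \<le> InfSeq (T \<omega>)"
      let ?n = "\<Sum>i<length y. M i"
      let ?p = "seq_prefix \<omega> ?n"
      have "M i \<le> ?n" if "i < length y" for i using member_le_sum[of i "{..<length y}" M] that by simp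
      moreover have "?p ! j = \<omega> j" if "j < ?n" for j using that by (simp add: seq_prefix_def)
      ultimately have "T (?ext ?p) i = T \<omega> i" if "i < length y" for i
        using that by (intro ext) (auto intro: less_le_trans)
      then have "(?p, y) \<in> \<Psi>"
        using y \<open>\<And>i. i < length y \<Longrightarrow> M i \<le> ?n\<close> unfolding \<Psi>_def FinSeq_le_InfSeq_iff by auto
      then show "y = [] \<or> (\<exists>p. FinSeq p \<le> InfSeq \<omega> \<and> (p, y) \<in> \<Psi>)"
        by (intro disjI2 exI[of _ ?p]) auto
    qed
    then show ?thesis by (intro antisym; subst binseq_le_iff) blast+
  qed
  ultimately show ?thesis unfolding computable_transformation_def by blast
qed

section \<open>Sequences of small randomness deficiency\<close>

lemma bernoulli_half_agree:
  assumes "finite J"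
  shows "{\<omega>. \<forall>i\<in>J. \<omega> i = a i} \<in> sets bernoulli_half" (is "?A \<in> _")
    and "emeasure bernoulli_half {\<omega>. \<forall>i\<in>J. \<omega> i = a i} = ennreal ((1/2) ^ card J)"
proof -
  let ?M = "\<lambda>_::nat. measure_pmf (bernoulli_pmf (1/2))"
  interpret product_prob_space ?M UNIV
    by unfold_locales
  have A: "?A = prod_emb UNIV ?M J (Pi\<^sub>E J (\<lambda>i. {a i}))"
  proof (rule set_eqI)
    fix \<omega> :: "nat \<Rightarrow> bool"
    have "\<omega> \<in> prod_emb UNIV ?M J (Pi\<^sub>E J (\<lambda>i. {a i})) \<longleftrightarrow> restrict \<omega> J \<in> Pi\<^sub>E J (\<lambda>i. {a i})"
      by (simp add: prod_emb_def)
    also have "\<dots> \<longleftrightarrow> (\<forall>i\<in>J. \<omega> i = a i)"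
      unfolding PiE_iff by simp
    finally show "\<omega> \<in> ?A \<longleftrightarrow> \<omega> \<in> prod_emb UNIV ?M J (Pi\<^sub>E J (\<lambda>i. {a i}))" by simp
  qed
  show "?A \<in> sets bernoulli_half"
    unfolding A bernoulli_half_def using assms by (intro sets_PiM_I) auto
  have single: "emeasure (?M i) {a i} = ennreal (1/2)" for i
    by (cases "a i") (simp_all add: emeasure_pmf_single)
  have "emeasure bernoulli_half ?A = (\<Prod>i\<in>J. emeasure (?M i) {a i})"
    unfolding A bernoulli_half_def using assms by (intro emeasure_PiM_emb) auto
  also have "\<dots> = ennreal (1/2) ^ card J"
    unfolding single by (simp only: prod_constant)
  also have "\<dots> = ennreal ((1/2) ^ card J)"
    by (rule ennreal_power) simp
  finally show "emeasure bernoulli_half ?A = ennreal ((1/2) ^ card J)" .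
qed

lemma emeasure_bernoulli_half_UNIV: "emeasure bernoulli_half UNIV = 1"
  using bernoulli_half_agree(2)[of "{}"] by simp

lemma enat_le_Km_iff:
  "enat m \<le> Km \<psi> x \<longleftrightarrow> (\<forall>p. FinSeq x \<le> apply_op \<psi> (FinSeq p) \<longrightarrow> m \<le> length p)"
  unfolding Km_def le_INF_iff by auto

text \<open>The programs that compress some prefix too much and are minimal with this property form an
  antichain, so the corresponding cylinders have total measure at most \<open>1\<close>; the set of
  sequences that they compress, even after fixing the bits in \<open>F\<close>, has at most half that measure.\<close>

lemma exists_small_deficiency:
  fixes F :: "nat set" and a :: "nat \<Rightarrow> bool"
  assumes \<psi>: "computable_operation \<psi>" and F: "\<And>n. card (F \<inter> {..<n}) \<le> \<sigma> n"
  shows "\<exists>\<omega>. (\<forall>i\<in>F. \<omega> i = a i) \<and> (\<forall>n. enat (n - \<sigma> n) \<le> Km \<psi> (seq_prefix \<omega> n))"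
proof -
  define out where "out p x \<longleftrightarrow> FinSeq x \<le> apply_op \<psi> (FinSeq p)" for p x
  \<comment> \<open>As \<open>n - \<sigma> n\<close> need not be monotone, \<open>N p\<close> is the
    least length at which a program of the length of \<open>p\<close> is too short; it lies below
    every other such length.\<close>
  define N where "N p = (LEAST n. length p < n - \<sigma> n)" for p :: "bool list"
  define P where "P = {p. \<exists>n x. length p < n - \<sigma> n \<and> length x = n \<and> out p x}"
  define Q where "Q = {p \<in> P. \<forall>q. strict_prefix q p \<longrightarrow> q \<notin> P}"
  have N: "length p < N p - \<sigma> (N p)" "N p \<le> n" if "length p < n - \<sigma> n" for p n
    using LeastI[of "\<lambda>n. length p < n - \<sigma> n", OF that] Least_le[of "\<lambda>n. length p < n - \<sigma> n", OF that]
    by (simp_all add: N_def)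
  have "\<exists>x. length x = N p \<and> out p x" if "p \<in> P" for p
  proof -
    from that obtain n x where x: "length p < n - \<sigma> n" "length x = n" "out p x" unfolding P_def by blast
    have "FinSeq (take (N p) x) \<le> FinSeq x" by (simp add: take_is_prefix)
    then have "out p (take (N p) x)" using x(3) order_trans unfolding out_def by blast
    moreover have "length (take (N p) x) = N p" using N(2)[OF x(1)] x(2) by simp
    ultimately show ?thesis by blast
  qed
  then obtain X where X: "\<And>p. p \<in> P \<Longrightarrow> length (X p) = N p" "\<And>p. p \<in> P \<Longrightarrow> out p (X p)"
    by metis
  have minimal: "\<exists>q\<in>Q. prefix q p" if "p \<in> P" for p
    using that
  proof (induction "length p" arbitrary: p rule: less_induct)
    case less
    show ?case
    proof (cases "p \<in> Q")
      case False
      then obtain q where "strict_prefix q p" "q \<in> P" using less.prems unfolding Q_def by blast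
      then obtain q' where "q' \<in> Q" "prefix q' q" using less.hyps[of q] prefix_length_less by blast
      then show ?thesis using \<open>strict_prefix q p\<close> prefix_order.trans by (auto simp: strict_prefix_def)
    qed auto
  qed
  \<comment> \<open>Positions in \<open>F\<close> are ignored, so \<open>\<eta>\<close> is in
    \<open>C q\<close> as soon as overwriting it by \<open>a\<close> on \<open>F\<close> produces an
    extension of \<open>X q\<close>.\<close>
  define C where "C q = {\<eta>. \<forall>i\<in>{..<N q} - F. \<eta> i = X q ! i}" for q
  define \<Gamma> where "\<Gamma> q = {\<eta>. \<forall>i\<in>{..<length q}. \<eta> i = q ! i}" for q :: "bool list"
  have sets: "C q \<in> sets bernoulli_half" "\<Gamma> q \<in> sets bernoulli_half" for q
    unfolding C_def \<Gamma>_def by (auto intro!: bernoulli_half_agree)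
  have C_le: "emeasure bernoulli_half (C q) \<le> ennreal (1/2) * emeasure bernoulli_half (\<Gamma> q)" if "q \<in> Q" for q
  proof -
    from that obtain n where n: "length q < n - \<sigma> n" unfolding Q_def P_def by blast
    have "card ({..<N q} - F) = N q - card (F \<inter> {..<N q})"
      by (subst card_Diff_subset_Int) (auto simp: Int_commute)
    \<comment> \<open>\<open>N q\<close> is strictly above \<open>length q + \<sigma> (N q)\<close>,
      and ignoring \<open>F\<close> gives back at most \<open>\<sigma> (N q)\<close> positions. The
      one position left is the factor \<open>1/2\<close>.\<close>
    then have le: "Suc (length q) \<le> card ({..<N q} - F)" using N(1)[OF n] F[of "N q"] by linarith
    have "emeasure bernoulli_half (C q) = ennreal ((1/2) ^ card ({..<N q} - F))"
      unfolding C_def by (rule bernoulli_half_agree) simp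
    also have "\<dots> \<le> ennreal ((1/2) ^ Suc (length q))"
      using le by (intro ennreal_leI power_decreasing) auto
    also have "\<dots> = ennreal (1/2) * ennreal ((1/2) ^ length q)"
      by (subst ennreal_mult[symmetric]) auto
    also have "ennreal ((1/2) ^ length q) = emeasure bernoulli_half (\<Gamma> q)"
      unfolding \<Gamma>_def by (subst bernoulli_half_agree) auto
    finally show ?thesis .
  qed
  \<comment> \<open>Strings are indexed by natural numbers to use countable sums; the second
    condition keeps an index that is not a code from repeating a string.\<close>
  define V where "V k \<longleftrightarrow> (from_nat k :: bool list) \<in> Q \<and> to_nat (from_nat k :: bool list) = k" for k
  define CC where "CC k = (if V k then C (from_nat k) else {})" for k
  define GG where "GG k = (if V k then \<Gamma> (from_nat k) else {})" for k
  have "disjoint_family GG"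
    unfolding disjoint_family_on_def
  proof (intro ballI impI)
    fix k l :: nat assume "k \<noteq> l"
    show "GG k \<inter> GG l = {}"
    proof (rule ccontr)
      assume "GG k \<inter> GG l \<noteq> {}"
      then obtain \<eta> where V: "V k" "V l" and \<eta>: "\<eta> \<in> \<Gamma> (from_nat k)" "\<eta> \<in> \<Gamma> (from_nat l)"
        unfolding GG_def by (auto split: if_splits)
      let ?p = "from_nat k :: bool list" and ?q = "from_nat l :: bool list"
      have "?p \<noteq> ?q" using V \<open>k \<noteq> l\<close> unfolding V_def by metis
      moreover have "prefix ?p ?q \<or> prefix ?q ?p"
        using prefixI_nth[of ?p ?q] prefixI_nth[of ?q ?p] \<eta> unfolding \<Gamma>_def
        by (cases "length ?p \<le> length ?q") auto
      ultimately show False using V unfolding V_def Q_def by (auto simp: strict_prefix_def)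
    qed
  qed
  moreover have "range GG \<subseteq> sets bernoulli_half" using sets by (auto simp: GG_def)
  ultimately have "(\<Sum>k. emeasure bernoulli_half (GG k)) = emeasure bernoulli_half (\<Union>k. GG k)"
    by (intro suminf_emeasure)
  also have "\<dots> \<le> 1"
    using emeasure_space[of bernoulli_half] by (simp add: space_bernoulli_half emeasure_bernoulli_half_UNIV)
  finally have G: "(\<Sum>k. emeasure bernoulli_half (GG k)) \<le> 1" .
  have "emeasure bernoulli_half (\<Union>k. CC k) \<le> (\<Sum>k. emeasure bernoulli_half (CC k))"
    using sets by (intro emeasure_subadditive_countably) (auto simp: CC_def)
  also have "\<dots> \<le> (\<Sum>k. ennreal (1/2) * emeasure bernoulli_half (GG k))"
    using C_le by (intro suminf_le) (auto simp: CC_def GG_def V_def)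
  also have "\<dots> = ennreal (1/2) * (\<Sum>k. emeasure bernoulli_half (GG k))"
    by (rule ennreal_suminf_cmult)
  also have "\<dots> \<le> ennreal (1/2) * 1" using G by (rule mult_left_mono) simp
  also have "\<dots> < 1" using ennreal_lessI[of 1 "1/2"] by (simp add: mult_1_right)
  finally have "(\<Union>k. CC k) \<noteq> UNIV" using emeasure_bernoulli_half_UNIV by auto
  then obtain \<eta> where \<eta>: "\<eta> \<notin> (\<Union>k. CC k)" by blast
  let ?\<omega> = "\<lambda>i. if i \<in> F then a i else \<eta> i"
  have "enat (n - \<sigma> n) \<le> Km \<psi> (seq_prefix ?\<omega> n)" for n
    unfolding enat_le_Km_iff
  proof (intro allI impI, rule ccontr)
    fix p assume p: "FinSeq (seq_prefix ?\<omega> n) \<le> apply_op \<psi> (FinSeq p)" "\<not> n - \<sigma> n \<le> length p"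
    then have "p \<in> P" unfolding P_def out_def by (intro CollectI exI[of _ n] exI[of _ "seq_prefix ?\<omega> n"]) auto
    from minimal[OF this] obtain q where q: "q \<in> Q" "prefix q p" by blast
    then have qP: "q \<in> P" unfolding Q_def by blast
    have "length q < n - \<sigma> n" using p(2) prefix_length_le[OF q(2)] by linarith
    then have "N q \<le> n" by (rule N)
    have "FinSeq (X q) \<le> apply_op \<psi> (FinSeq p)"
      using X(2)[OF qP] apply_op_mono[OF \<psi>, of "FinSeq q" "FinSeq p"] q(2) order_trans
      unfolding out_def by (metis less_eq_binseq.simps(1))
    then have "prefix (X q) (seq_prefix ?\<omega> n)"
      using p(1) X(1)[OF qP] \<open>N q \<le> n\<close> by (intro FinSeq_le_comparable) auto
    then have nth: "\<forall>i<N q. X q ! i = ?\<omega> i" 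
      using X(1)[OF qP] \<open>N q \<le> n\<close> unfolding prefix_iff_nth by (auto simp: seq_prefix_def)
    have "\<eta> \<in> C q" unfolding C_def
    proof (intro CollectI ballI)
      fix i assume "i \<in> {..<N q} - F"
      then show "\<eta> i = X q ! i" using nth[rule_format, of i] by auto
    qed
    then have "\<eta> \<in> CC (to_nat q)" using q(1) unfolding CC_def V_def by simp
    with \<eta> show False by blast
  qed
  then show ?thesis by (intro exI[of _ ?\<omega>]) simp
qed


text \<open>An oracle for short programs would compute incompressible strings \<open>z m\<close> of length \<open>2 * m\<close>,
  but a machine printing \<open>z m\<close> on input \<open>1\<^sup>m0\<close> compresses them.\<close>

lemma short_programs_undecidable:
  assumes opt: "optimal_decoder \<psi>" and D: "computable_pred D"
    and D_iff: "\<And>x. D (string_code x) \<longleftrightarrow> (\<exists>p. length p < length x \<and> (p, x) \<in> \<psi>)"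
  shows False
proof -
  from opt have \<psi>: "computable_operation \<psi>" unfolding optimal_decoder_def by blast
  have incompressible: "\<exists>x. length x = n \<and> \<not> D (string_code x)" for n
  proof -
    obtain \<omega> where "\<And>n. enat (n - 0) \<le> Km \<psi> (seq_prefix \<omega> n)"
      using exists_small_deficiency[OF \<psi>, of "{}" "\<lambda>_. 0"] by auto
    then have "n \<le> length p" if "FinSeq (seq_prefix \<omega> n) \<le> apply_op \<psi> (FinSeq p)" for p
      using that unfolding enat_le_Km_iff by simp
    moreover have "FinSeq (seq_prefix \<omega> n) \<le> apply_op \<psi> (FinSeq p)" if "(p, seq_prefix \<omega> n) \<in> \<psi>" for p
      unfolding FinSeq_le_apply_op[OF \<psi>] using that by auto
    ultimately show ?thesis unfolding D_iff by (intro exI[of _ "seq_prefix \<omega> n"]) (auto simp: not_less)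
  qed
  let ?P = "\<lambda>m v. is_string v \<and> code_length v = 2 * m \<and> \<not> D v"
  define Z where "Z m = (LEAST v. ?P m v)" for m
  have "\<exists>v. ?P m v" for m using incompressible[of "2 * m"] by (metis code_length_string_code is_string_string_code)
  then have "?P m (Z m)" for m unfolding Z_def by (rule LeastI_ex)
  then have "\<exists>x. Z m = string_code x \<and> length x = 2 * m \<and> \<not> D (string_code x)" for m
    using is_stringE[of "Z m"] by (metis code_length_string_code)
  then obtain z where z: "Z m = string_code (z m)" "length (z m) = 2 * m" "\<not> D (string_code (z m))" for m
    by metis
  have Z: "computable_fun Z"
    unfolding Z_def[abs_def]
    by (intro computable_intros computable_pred_comp[OF D] \<open>\<And>m. \<exists>v. ?P m v\<close>)
  \<comment> \<open>The final \<open>False\<close> makes the inputs for different \<open>m\<close>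
    incomparable, so no compatibility between different \<open>z m\<close> is required.\<close>
  define \<Phi> where "\<Phi> = {(x, y). \<exists>m. x = replicate m True @ [False] \<and> prefix y (z m)}"
  have "computable_operation \<Phi>"
    unfolding computable_operation_def
  proof (intro conjI allI impI)
    let ?Q = "\<lambda>v w. code_length v \<noteq> 0 \<and> code_nth v (code_length v - 1) = 0 \<and>
      (\<forall>i<code_length v - 1. code_nth v i = 1) \<and> code_length w \<le> 2 * (code_length v - 1) \<and>
      (\<forall>i<code_length w. code_nth w i = code_nth (Z (code_length v - 1)) i)"
    show "rec_enumerable ((\<lambda>(x, y). prod_encode (string_code x, string_code y)) ` \<Phi>)"
    proof (rule rec_enumerable_string_pairs)
      show "computable_pred (\<lambda>n. ?Q (pfst n) (psnd n))"
        by (intro computable_intros computable_comp[OF Z])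
      show "(x, y) \<in> \<Phi> \<longleftrightarrow> ?Q (string_code x) (string_code y)" for x y
      proof -
        have "?Q (string_code x) (string_code y) \<longleftrightarrow> x \<noteq> [] \<and> \<not> x ! (length x - 1) \<and>
            (\<forall>i<length x - 1. x ! i) \<and> prefix y (z (length x - 1))"
        proof -
          have "(\<forall>i<length x - 1. code_nth (string_code x) i = 1) \<longleftrightarrow> (\<forall>i<length x - 1. x ! i)"
            by (intro all_cong) (simp add: code_nth_string_code)
          moreover have "(\<forall>i<length y. code_nth (string_code y) i = code_nth (Z (length x - 1)) i) \<longleftrightarrow>
              (\<forall>i<length y. y ! i = z (length x - 1) ! i)" if "length y \<le> 2 * (length x - 1)"
          proof (intro all_cong)
            fix i assume "i < length y"
            with that have "i < length (z (length x - 1))" unfolding z(2) by simp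
            with \<open>i < length y\<close> show "code_nth (string_code y) i = code_nth (Z (length x - 1)) i \<longleftrightarrow>
                y ! i = z (length x - 1) ! i"
              unfolding z(1) code_nth_string_code by simp
          qed
          moreover have "code_nth (string_code x) (length x - 1) = 0 \<longleftrightarrow> \<not> x ! (length x - 1)" if "x \<noteq> []"
            using that by (simp add: code_nth_string_code)
          ultimately show ?thesis
            unfolding prefix_iff_nth code_length_string_code z(2) length_0_conv by blast
        qed
        also have "\<dots> \<longleftrightarrow> (x, y) \<in> \<Phi>"
        proof
          assume a: "x \<noteq> [] \<and> \<not> x ! (length x - 1) \<and> (\<forall>i<length x - 1. x ! i) \<and> prefix y (z (length x - 1))"
          have "x = replicate (length x - 1) True @ [False]"
          proof (rule nth_equalityI)
            show "x ! i = (replicate (length x - 1) True @ [False]) ! i" if "i < length x" for i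
              using a that by (cases "i = length x - 1") (auto simp: nth_append)
          qed (use a in simp)
          then show "(x, y) \<in> \<Phi>" using a unfolding \<Phi>_def by blast
        qed (auto simp: \<Phi>_def nth_append)
        finally show ?thesis by blast
      qed
    qed
  next
    fix x y x' y' assume a: "(x, y) \<in> \<Phi>" "(x', y') \<in> \<Phi>" "prefix x x'"
    then obtain m m' where m: "x = replicate m True @ [False]" "prefix y (z m)"
      "x' = replicate m' True @ [False]" "prefix y' (z m')" unfolding \<Phi>_def by blast
    have "m = m'"
    proof (rule ccontr)
      assume "m \<noteq> m'"
      moreover have "m \<le> m'" using prefix_length_le[OF a(3)] unfolding m by simp
      ultimately have "m < m'" by simp
      then show False using a(3) unfolding prefix_iff_nth m by (auto simp: nth_append dest!: spec[of _ m])
    qed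
    then show "prefix y y' \<or> prefix y' y" using m(2,4) prefix_same_cases by blast
  next
    fix x y y' assume "(x, y) \<in> \<Phi>" "prefix y' y"
    then show "(x, y') \<in> \<Phi>" unfolding \<Phi>_def using prefix_order.trans by blast
  qed
  moreover from this opt obtain c where c: "\<And>x. Km \<psi> x \<le> Km \<Phi> x + enat c"
    unfolding optimal_decoder_def by blast
  \<comment> \<open>Any \<open>m > c + 1\<close> makes the length \<open>2 * m\<close> exceed the
    bound \<open>m + 1 + c\<close>.\<close>
  define m where "m = c + 2"
  have "Km \<Phi> (z m) \<le> enat (length (replicate m True @ [False]))"
    unfolding Km_def
  proof (rule INF_lower, intro CollectI)
    show "FinSeq (z m) \<le> apply_op \<Phi> (FinSeq (replicate m True @ [False]))"
      unfolding FinSeq_le_apply_op[OF \<open>computable_operation \<Phi>\<close>]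
      unfolding \<Phi>_def using prefix_order.refl by blast
  qed
  then have "Km \<psi> (z m) \<le> enat (m + 1) + enat c"
    using c[of "z m"] add_right_mono[of "Km \<Phi> (z m)" "enat (m + 1)" "enat c"] order_trans by fastforce
  moreover have "enat (2 * m) \<le> Km \<psi> (z m)"
    unfolding enat_le_Km_iff
  proof (intro allI impI)
    fix p assume "FinSeq (z m) \<le> apply_op \<psi> (FinSeq p)"
    moreover have "z m \<noteq> []" using z(2)[of m] m_def by auto
    ultimately obtain q where q: "prefix q p" "(q, z m) \<in> \<psi>"
      unfolding FinSeq_le_apply_op[OF \<psi>] by auto
    then have "2 * m \<le> length q" using z(3)[of m] z(2)[of m] unfolding D_iff by (metis not_le)
    then show "2 * m \<le> length p" using prefix_length_le[OF q(1)] by simp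
  qed
  ultimately have "enat (2 * m) \<le> enat (m + 1 + c)" by (metis order_trans plus_enat_simps(1))
  then show False by (simp add: m_def)
qed

text \<open>The events enumerate a set that is not recursive, so their times are not
  dominated by any computable function of the enumerated numbers.\<close>

lemma exists_events:
  assumes opt: "optimal_decoder \<psi>"
  shows "\<exists>E. computable_pred E \<and> inj_on pfst {k. E k} \<and>
    (\<forall>\<sigma> :: nat \<Rightarrow> nat. mono \<sigma> \<longrightarrow> \<not> bdd_above (range \<sigma>) \<longrightarrow> computable_fun \<sigma> \<longrightarrow>
      (\<forall>d k0. \<exists>k>k0. E k \<and> pfst k + d \<le> \<sigma> k))"
proof -
  from opt have "computable_operation \<psi>" unfolding optimal_decoder_def by blast
  then have "rec_enumerable ((\<lambda>(x, y). prod_encode (string_code x, string_code y)) ` \<psi>)"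
    unfolding computable_operation_def by blast
  then obtain R where R: "computable_pred (\<lambda>n. R (pfst n) (psnd n))"
    and R_eq: "(\<lambda>(x, y). prod_encode (string_code x, string_code y)) ` \<psi> = {n. \<exists>s. R n s}"
    by (rule rec_enumerable_projection)
  have R_iff: "(p, x) \<in> \<psi> \<longleftrightarrow> (\<exists>s. R (prod_encode (string_code p, string_code x)) s)" for p x
  proof -
    have "(p, x) \<in> \<psi> \<longleftrightarrow> prod_encode (string_code p, string_code x) \<in>
        (\<lambda>(x, y). prod_encode (string_code x, string_code y)) ` \<psi>"
      by (auto intro!: image_eqI[of _ _ "(p, x)"])
    then show ?thesis unfolding R_eq by simp
  qed
  \<comment> \<open>The witness \<open>t\<close> packs the code of a shorter program together with a
    step bound.\<close>
  define P where "P v t \<longleftrightarrow> is_string (pfst t) \<and> code_length (pfst t) < code_length v \<and>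
    R (prod_encode (pfst t, v)) (psnd t)" for v t
  have P: "computable_pred (\<lambda>n. P (pfst n) (psnd n))"
    unfolding P_def by (intro computable_intros computable_pred_comp2[OF R])
  have P_iff: "(\<exists>t. P (string_code x) t) \<longleftrightarrow> (\<exists>p. length p < length x \<and> (p, x) \<in> \<psi>)" for x
  proof
    assume "\<exists>t. P (string_code x) t"
    then obtain t where t: "P (string_code x) t" by blast
    then obtain p where "pfst t = string_code p" unfolding P_def by (blast elim: is_stringE)
    with t show "\<exists>p. length p < length x \<and> (p, x) \<in> \<psi>" unfolding P_def R_iff by auto
  next
    assume "\<exists>p. length p < length x \<and> (p, x) \<in> \<psi>"
    then obtain p s where "length p < length x" "R (prod_encode (string_code p, string_code x)) s"
      unfolding R_iff by blast
    then have "P (string_code x) (prod_encode (string_code p, s))" unfolding P_def by simp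
    then show "\<exists>t. P (string_code x) t" by blast
  qed
  \<comment> \<open>An event is the code of an element together with its first witness: this is
    decidable, happens at most once per element, and the code itself serves as the time.\<close>
  define E where "E k \<longleftrightarrow> P (pfst k) (psnd k) \<and> (\<forall>t<psnd k. \<not> P (pfst k) t)" for k
  have E: "computable_pred E"
    unfolding E_def[abs_def] by (intro computable_intros computable_pred_comp2[OF P])
  have inj: "inj_on pfst {k. E k}"
  proof (rule inj_onI)
    fix k l assume "k \<in> {k. E k}" "l \<in> {k. E k}" and eq: "pfst k = pfst l"
    then have "\<not> psnd k < psnd l" "\<not> psnd l < psnd k" unfolding E_def by auto
    then have "psnd k = psnd l" by simp
    with eq show "k = l" by (metis prod_encode_pfst_psnd)
  qed
  have "\<exists>k>k0. E k \<and> pfst k + d \<le> \<sigma> k"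
    if \<sigma>: "mono \<sigma>" "\<not> bdd_above (range \<sigma>)" "computable_fun \<sigma>" for \<sigma> :: "nat \<Rightarrow> nat" and d k0
  proof (rule ccontr)
    assume neg: "\<not> (\<exists>k>k0. E k \<and> pfst k + d \<le> \<sigma> k)"
    \<comment> \<open>If no event after \<open>k0\<close> satisfied the bound, an element
      \<open>n\<close> would have its first witness at most \<open>g n\<close>, and a bounded search
      would decide the set.\<close>
    define g where "g n = (LEAST k. k0 < k \<and> n + d \<le> \<sigma> k)" for n
    have ex: "\<exists>k. k0 < k \<and> n + d \<le> \<sigma> k" for n
    proof -
      from \<sigma>(2) obtain k where "n + d \<le> \<sigma> k"
        unfolding bdd_above_def by (metis nat_le_linear rangeE)
      then have "n + d \<le> \<sigma> (max k (Suc k0))" using monoD[OF \<sigma>(1), of k "max k (Suc k0)"] by simp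
      then show ?thesis by (intro exI[of _ "max k (Suc k0)"]) auto
    qed
    have g: "k0 < g n" "n + d \<le> \<sigma> (g n)" for n
      unfolding g_def using LeastI_ex[OF ex[of n]] by auto
    have "computable_fun g"
      unfolding g_def[abs_def] by (intro computable_intros computable_comp[OF \<sigma>(3)] ex)
    then have "computable_pred (\<lambda>n. \<exists>t<Suc (g n). P n t)"
      by (intro computable_intros computable_pred_comp2[OF P])
    moreover have "(\<exists>t<Suc (g n). P n t) \<longleftrightarrow> (\<exists>t. P n t)" for n
    proof
      assume "\<exists>t. P n t"
      define t where "t = (LEAST t. P n t)"
      have t: "P n t" "\<forall>u<t. \<not> P n u"
        unfolding t_def using LeastI_ex[OF \<open>\<exists>t. P n t\<close>] not_less_Least by blast+
      then have E: "E (prod_encode (n, t))" unfolding E_def by simp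
      have "t \<le> g n"
      proof (rule ccontr)
        assume "\<not> t \<le> g n"
        then have le: "g n < prod_encode (n, t)" using le_prod_encode_2[of t n] by simp
        then have "n + d \<le> \<sigma> (prod_encode (n, t))"
          using g(2)[of n] monoD[OF \<sigma>(1), of "g n" "prod_encode (n, t)"] by simp
        with E neg le g(1)[of n] show False by (metis less_trans pfst_prod_encode)
      qed
      with t(1) show "\<exists>t<Suc (g n). P n t" by (auto simp: less_Suc_eq_le)
    qed auto
    ultimately show False
      using short_programs_undecidable[OF opt, of "\<lambda>n. \<exists>t<Suc (g n). P n t"] P_iff by simp
  qed
  with E inj show ?thesis by (intro exI[of _ E] conjI allI impI)
qed

section \<open>The cutting and stacking transformation\<close>

lemma bit_add_mult_power:
  fixes v i :: nat
  assumes "v < 2 ^ a"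
  shows "bit (v + 2 ^ a * i) q \<longleftrightarrow> (if q < a then bit v q else bit i (q - a))"
proof (cases "q < a")
  case True
  then have "2 ^ a = (2 ^ q * (2 * 2 ^ (a - Suc q)) :: nat)"
    by (simp flip: power_add power_Suc)
  then have "(v + 2 ^ a * i) div 2 ^ q = v div 2 ^ q + 2 * (2 ^ (a - Suc q) * i)"
    by (simp add: mult.assoc)
  with True show ?thesis unfolding bit_iff_odd by simp
next
  case False
  then have "2 ^ q = (2 ^ a * 2 ^ (q - a) :: nat)" by (simp flip: power_add)
  then have "(v + 2 ^ a * i) div 2 ^ q = i div 2 ^ (q - a)"
    using assms by (simp add: div_mult2_eq)
  with False show ?thesis unfolding bit_iff_odd by simp
qed

text \<open>Least significant bit first, so that lengthening the prefix only adds higher digits and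
  keeps the residue modulo \<open>2 ^ n\<close>.\<close>

definition prefix_value :: "(nat \<Rightarrow> bool) \<Rightarrow> nat \<Rightarrow> nat" where
  "prefix_value \<omega> n = (\<Sum>j<n. of_bool (\<omega> j) * 2 ^ j)"

lemma prefix_value_bit: "prefix_value (bit v) n = v mod 2 ^ n"
  unfolding prefix_value_def take_bit_eq_mod[symmetric] take_bit_sum
  by (simp add: push_bit_eq_mult lessThan_atLeast0)

lemma prefix_value_Suc: "prefix_value \<omega> (Suc n) = prefix_value \<omega> n + of_bool (\<omega> n) * 2 ^ n"
  by (simp add: prefix_value_def)

lemma prefix_value_less: "prefix_value \<omega> n < 2 ^ n"
  by (induction n) (auto simp: prefix_value_Suc prefix_value_def[of _ 0])

lemma prefix_value_cong: "(\<And>j. j < n \<Longrightarrow> \<omega> j = \<omega>' j) \<Longrightarrow> prefix_value \<omega> n = prefix_value \<omega>' n"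
  unfolding prefix_value_def by (intro sum.cong) auto

lemma bit_prefix_value: "bit (prefix_value \<omega> n) q \<longleftrightarrow> q < n \<and> \<omega> q"
proof (induction n)
  case 0
  then show ?case by (simp add: prefix_value_def)
next
  case (Suc n)
  have "prefix_value \<omega> (Suc n) = prefix_value \<omega> n + 2 ^ n * of_bool (\<omega> n)" by (simp add: prefix_value_Suc)
  then show ?case
    by (auto simp: bit_add_mult_power[OF prefix_value_less] Suc bit_of_bool_iff less_Suc_eq)
qed

lemma prefix_value_add: "prefix_value \<omega> (m + n) = prefix_value \<omega> m + 2 ^ m * prefix_value (\<lambda>j. \<omega> (m + j)) n"
  by (induction n) (auto simp: prefix_value_Suc prefix_value_def[of _ 0] power_add algebra_simps)

lemma all_bits_imp_eq:
  fixes i :: nat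
  assumes "i < 2 ^ m" "\<And>j. j < m \<Longrightarrow> bit i j" shows "i = 2 ^ m - 1"
proof -
  have "i = take_bit m i" using assms(1) by (simp add: take_bit_eq_mod)
  also have "\<dots> = mask m" by (rule bit_eqI) (auto simp: bit_take_bit_iff bit_mask_iff assms(2))
  finally show ?thesis by (simp add: mask_eq_exp_minus_1)
qed

text \<open>A sequence is read as a bit \<open>t\<close> followed by blocks of \<open>k + 6\<close> bits, \<open>k = 0, 1, \<dots>\<close>;
  the \<open>k\<close>-th block occupies the positions from \<open>level k\<close> on.\<close>

fun level :: "nat \<Rightarrow> nat" where
  "level 0 = 1"
| "level (Suc k) = level k + (k + 6)"

text \<open>The lowest point of column \<open>t\<close> of level \<open>k\<close> has at most one
  nonzero bit among its first \<open>level k\<close>; it is at this position and equals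
  \<open>t\<close> (see \<open>state_0\<close>).\<close>

fun bottom :: "nat \<Rightarrow> nat" where
  "bottom 0 = 0"
| "bottom (Suc k) = level k"

lemma level_pos: "0 < level k" by (induction k) auto

lemma less_level: "k < level k" by (induction k) auto

lemma level_mono: "m \<le> n \<Longrightarrow> level m \<le> level n"
  by (induction rule: dec_induct) auto

lemma bottom_less_level: "bottom k < level k"
  by (cases k) auto

text \<open>Two columns of this height together exhaust the \<open>2 ^ level k\<close>
  prefixes.\<close>

definition height :: "nat \<Rightarrow> nat" where "height k = 2 ^ (level k - 1)"

lemma height_pos: "0 < height k" by (simp add: height_def)

lemma height_Suc: "height (Suc k) = height k * 2 ^ (k + 6)"
  using level_pos[of k] by (simp add: height_def flip: power_add)

lemma power_level: "2 ^ level k = 2 * height k"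
  using level_pos[of k] by (simp add: height_def flip: power_Suc)

definition splice_bits :: "nat \<Rightarrow> nat \<Rightarrow> (nat \<Rightarrow> bool) \<Rightarrow> nat \<Rightarrow> bool" where
  "splice_bits n v r p = (if p < level n then bit v p else r p)"

lemma splice_bits_prefix_value: "splice_bits n (prefix_value \<omega> (level n)) \<omega> = \<omega>"
  by (rule ext) (auto simp: splice_bits_def bit_prefix_value)

lemma splice_bits_Suc:
  assumes "v < 2 ^ level n"
  shows "splice_bits (Suc n) (v + 2 ^ level n * i) r = splice_bits n v (splice_bits (Suc n) (2 ^ level n * i) r)"
proof
  fix p
  show "splice_bits (Suc n) (v + 2 ^ level n * i) r p = splice_bits n v (splice_bits (Suc n) (2 ^ level n * i) r) p"
    using bit_add_mult_power[OF assms, of i p] bit_add_mult_power[of 0 "level n" i p]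
    by (auto simp: splice_bits_def)
qed

locale tower =
  fixes z :: "nat \<Rightarrow> nat"
  assumes z_bounds: "z k = 0 \<or> 2 \<le> z k \<and> z k \<le> k + 2"
begin

text \<open>Columns \<open>0\<close> and \<open>1\<close> of level \<open>k + 1\<close> are both cut from \<open>2 ^ (k + 6)\<close> copies of columns of level \<open>k\<close>.
  Column \<open>t\<close> begins with copies of column \<open>0\<close> and column \<open>1\<close>, which makes the transformation
  continuous, and goes on with copies of column \<open>t\<close>, except in the positions \<open>j\<close> with
  \<open>swapped k j\<close>, where copies of column \<open>1 - t\<close> occur.\<close>

definition swapped :: "nat \<Rightarrow> nat \<Rightarrow> bool" where
  "swapped k j \<longleftrightarrow> z k \<noteq> 0 \<and> 2 ^ z k \<le> j \<and> j < 2 * 2 ^ z k"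

lemma swapped_ge: "swapped k j \<Longrightarrow> 4 \<le> j"
proof -
  assume s: "swapped k j"
  then have "2 \<le> z k" using z_bounds[of k] by (auto simp: swapped_def)
  then have "(2::nat) ^ 2 \<le> 2 ^ z k" by (intro power_increasing) auto
  with s show ?thesis by (simp add: swapped_def)
qed

lemma swapped_less: "swapped k j \<Longrightarrow> j < 2 ^ (k + 3)"
proof -
  assume s: "swapped k j"
  have "(2::nat) ^ Suc (z k) \<le> 2 ^ (k + 3)" using z_bounds[of k] by (intro power_increasing) auto
  with s show ?thesis by (simp add: swapped_def)
qed

text \<open>Position \<open>j\<close> of column \<open>t\<close> holds the copy number \<open>sub_copy t j\<close> of the column \<open>sub_column k t j\<close>;
  \<open>next_column\<close> and \<open>next_copy\<close> give the successor of a copy \<open>i\<close> of column \<open>t\<close>.\<close>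

definition sub_column :: "nat \<Rightarrow> nat \<Rightarrow> nat \<Rightarrow> nat" where
  "sub_column k t j = (if j < 2 then j else (t + of_bool (swapped k j)) mod 2)"

definition sub_copy :: "nat \<Rightarrow> nat \<Rightarrow> nat" where
  "sub_copy t j = (if j < 2 then t else j)"

definition next_column :: "nat \<Rightarrow> nat \<Rightarrow> nat \<Rightarrow> nat" where
  "next_column k t i = (if i < 2 then (if t = 0 then 1 else i)
     else (t + of_bool (swapped k i) + of_bool (swapped k (Suc i))) mod 2)"

definition next_copy :: "nat \<Rightarrow> nat \<Rightarrow> nat" where
  "next_copy t i = (if i < 2 then (if t = 0 then i else 2) else Suc i)"

text \<open>The first \<open>level (Suc k)\<close> bits of the image when copy \<open>i\<close> of
  column \<open>t\<close> has been traversed: the bottom of the next copy, followed by the number of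
  that copy.\<close>

definition next_word :: "nat \<Rightarrow> nat \<Rightarrow> nat \<Rightarrow> nat" where
  "next_word k t i = next_column k t i * 2 ^ bottom k + 2 ^ level k * next_copy t i"

definition block :: "(nat \<Rightarrow> bool) \<Rightarrow> nat \<Rightarrow> nat" where
  "block \<omega> k = prefix_value (\<lambda>j. \<omega> (level k + j)) (k + 6)"

text \<open>The first block not consisting of ones, truncated at \<open>Suc (Suc p)\<close>; the bit at position \<open>p\<close>
  of the image does not depend on later blocks.\<close>

definition carry :: "(nat \<Rightarrow> bool) \<Rightarrow> nat \<Rightarrow> nat" where
  "carry \<omega> p = (LEAST k. Suc p < k \<or> (\<exists>q<level (Suc k). 0 < q \<and> \<not> \<omega> q))"

definition T :: "(nat \<Rightarrow> bool) \<Rightarrow> nat \<Rightarrow> bool" where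
  "T \<omega> p = (if Suc p < carry \<omega> p then False
     else if p < level (Suc (carry \<omega> p))
     then bit (next_word (carry \<omega> p) (of_bool (\<omega> 0)) (block \<omega> (carry \<omega> p))) p
     else \<omega> p)"

text \<open>Justifies the default \<open>False\<close> in \<open>T\<close>: below
  \<open>bottom k\<close> the image is zero for every column and copy, so bit \<open>p\<close> is
  known before the carry has been located.\<close>

lemma bit_next_word_bottom:
  assumes "p < bottom k" shows "\<not> bit (next_word k t i) p"
proof -
  have "2 ^ level k = (2 ^ bottom k * 2 ^ (level k - bottom k) :: nat)"
    using bottom_less_level[of k] by (simp flip: power_add)
  then have "next_word k t i = 0 + 2 ^ bottom k * (next_column k t i + 2 ^ (level k - bottom k) * next_copy t i)"
    by (simp add: next_word_def algebra_simps)
  then show ?thesis using bit_add_mult_power[of 0 "bottom k" _ p] assms by simp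
qed

text \<open>Removes the truncation of \<open>carry\<close>: if the search was cut off, then
  \<open>p < bottom n\<close>, where both sides are zero.\<close>

lemma T_eq:
  assumes ones: "\<And>q. 0 < q \<Longrightarrow> q < level n \<Longrightarrow> \<omega> q"
    and zero: "0 < q" "q < level (Suc n)" "\<not> \<omega> q"
  shows "T \<omega> p = (if p < level (Suc n) then bit (next_word n (of_bool (\<omega> 0)) (block \<omega> n)) p else \<omega> p)"
proof -
  have ones': "\<not> (\<exists>q<level (Suc k). 0 < q \<and> \<not> \<omega> q)" if "k < n" for k
    using that ones level_mono[of "Suc k" n] by (metis Suc_leI less_le_trans)
  show ?thesis
  proof (cases "n \<le> Suc p")
    case True
    have "carry \<omega> p = n"
      unfolding carry_def
    proof (rule Least_equality)
      show "Suc p < n \<or> (\<exists>q<level (Suc n). 0 < q \<and> \<not> \<omega> q)" using zero by blast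
      show "n \<le> k" if "Suc p < k \<or> (\<exists>q<level (Suc k). 0 < q \<and> \<not> \<omega> q)" for k
        using that True ones'[of k] by (meson leI le_trans less_imp_le)
    qed
    with True show ?thesis by (simp add: T_def)
  next
    case False
    have "carry \<omega> p = Suc (Suc p)"
      unfolding carry_def
    proof (rule Least_equality)
      show "Suc (Suc p) \<le> k" if "Suc p < k \<or> (\<exists>q<level (Suc k). 0 < q \<and> \<not> \<omega> q)" for k
        using that False ones'[of k] by (meson Suc_leI leI le_less_trans not_le)
    qed simp
    moreover obtain m where m: "n = Suc m" "p < m" using False by (cases n) auto
    have "p < bottom n" using m less_level[of m] by simp
    moreover from this have "p < level (Suc n)"
      using bottom_less_level[of n] level_mono[of n "Suc n"] by linarith
    ultimately show ?thesis using bit_next_word_bottom by (simp add: T_def)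
  qed
qed

text \<open>At the top of a column of level \<open>m\<close> the copy that follows depends on later
  blocks, but all bottoms share a long run of zeros, which fixes the first bits of the
  image.\<close>

lemma T_top:
  assumes "\<And>q. 0 < q \<Longrightarrow> q < level m \<Longrightarrow> \<omega> q" "Suc (Suc p) \<le> m"
  shows "\<not> T \<omega> p"
proof -
  have "Suc p < carry \<omega> p \<or> (\<exists>q<level (Suc (carry \<omega> p)). 0 < q \<and> \<not> \<omega> q)"
    unfolding carry_def by (rule LeastI[of _ "Suc (Suc p)"]) simp
  moreover have "\<not> (\<exists>q<level (Suc k). 0 < q \<and> \<not> \<omega> q)" if "k \<le> Suc p" for k
    using assms that level_mono[of "Suc k" m] by (metis Suc_le_mono le_trans less_le_trans)
  ultimately have "Suc p < carry \<omega> p" by (metis leI)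
  then show ?thesis by (simp add: T_def)
qed

lemma T_local:
  assumes agree: "\<And>j. j < level (Suc (Suc p)) \<Longrightarrow> \<omega> j = \<omega>' j"
  shows "T \<omega> p = T \<omega>' p"
proof -
  have "(Suc p < k \<or> (\<exists>q<level (Suc k). 0 < q \<and> \<not> \<omega> q)) \<longleftrightarrow>
      (Suc p < k \<or> (\<exists>q<level (Suc k). 0 < q \<and> \<not> \<omega>' q))" for k
  proof (cases "Suc p < k")
    case False
    then have "level (Suc k) \<le> level (Suc (Suc p))" by (intro level_mono) simp
    then show ?thesis using agree by (metis less_le_trans)
  qed simp
  then have carry: "carry \<omega> p = carry \<omega>' p" unfolding carry_def by simp
  show ?thesis
  proof (cases "Suc p < carry \<omega> p")
    case False
    then have le: "level (Suc (carry \<omega> p)) \<le> level (Suc (Suc p))" by (intro level_mono) simp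
    have "block \<omega> (carry \<omega> p) = block \<omega>' (carry \<omega> p)"
      unfolding block_def using le by (intro prefix_value_cong agree) simp
    moreover have "\<omega> 0 = \<omega>' 0" by (intro agree level_pos)
    moreover have "\<omega> p = \<omega>' p" using less_level[of "Suc (Suc p)"] by (intro agree) simp
    ultimately show ?thesis unfolding T_def carry by simp
  qed (simp add: T_def carry)
qed

section \<open>Points of a column by height, and the action of \<open>T\<close> along the
  column\<close>

definition col_top :: "nat \<Rightarrow> nat \<Rightarrow> nat" where
  "col_top n t = t + 2 * (height n - 1)"

lemma col_top_less: "t < 2 \<Longrightarrow> col_top n t < 2 ^ level n"
  using height_pos[of n] by (simp add: col_top_def power_level)

lemma bit_col_top_0: "t < 2 \<Longrightarrow> bit (col_top n t) 0 \<longleftrightarrow> t = 1"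
  by (auto simp: col_top_def bit_0 less_2_cases_iff)

lemma bit_col_top:
  assumes "t < 2" "0 < q" "q < level n" shows "bit (col_top n t) q"
proof -
  obtain r where r: "q = Suc r" using assms(2) by (cases q) auto
  have "col_top n t div 2 = mask (level n - 1)"
    using assms(1) by (auto simp: col_top_def height_def mask_eq_exp_minus_1 less_2_cases_iff)
  then show ?thesis using assms(3) by (simp add: r bit_Suc bit_mask_iff)
qed

lemma T_splice_top:
  assumes t: "t < 2" and i: "i < 2 ^ (n + 6) - 1"
  shows "T (splice_bits (Suc n) (col_top n t + 2 ^ level n * i) r) = splice_bits (Suc n) (next_word n t i) r"
proof
  fix p
  let ?\<omega> = "splice_bits (Suc n) (col_top n t + 2 ^ level n * i) r"
  have bits: "?\<omega> q \<longleftrightarrow> (if q < level n then bit (col_top n t) q else bit i (q - level n))" if "q < level (Suc n)" for q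
    using that bit_add_mult_power[OF col_top_less[OF t], of n i q] by (simp add: splice_bits_def)
  have zero: "of_bool (?\<omega> 0) = t"
    using bits[of 0] level_pos[of n] level_pos[of "Suc n"] t by (auto simp: bit_col_top_0 less_2_cases_iff)
  have "block ?\<omega> n = prefix_value (bit i) (n + 6)"
    unfolding block_def by (intro prefix_value_cong) (simp add: bits)
  then have block: "block ?\<omega> n = i" using i by (simp add: prefix_value_bit)
  have "\<exists>j<n + 6. \<not> bit i j" using all_bits_imp_eq[of i "n + 6"] i by (metis diff_le_self less_irrefl less_le_trans)
  then obtain j where j: "j < n + 6" "\<not> bit i j" by blast
  show "T ?\<omega> p = splice_bits (Suc n) (next_word n t i) r p"
  proof (subst T_eq[where n = n and q = "level n + j"])
    show "?\<omega> q" if "0 < q" "q < level n" for q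
      using that bits[of q] bit_col_top[OF t] by simp
    show "0 < level n + j" using level_pos[of n] by simp
    show "level n + j < level (Suc n)" using j by simp
    show "\<not> ?\<omega> (level n + j)" using bits[of "level n + j"] j by simp
  qed (simp only: zero block, simp add: splice_bits_def)
qed

text \<open>The value of the first \<open>level n\<close> bits at height \<open>q\<close> of column
  \<open>t\<close>. The quotient of \<open>q\<close> is the position inside the column, whose copy
  number fills the last block; the remainder is the height inside that copy.\<close>

fun state :: "nat \<Rightarrow> nat \<Rightarrow> nat \<Rightarrow> nat" where
  "state 0 t q = t"
| "state (Suc n) t q = state n (sub_column n t (q div height n)) (q mod height n) +
     2 ^ level n * sub_copy t (q div height n)"

lemma sub_column_less: "sub_column n t j < 2"
  by (simp add: sub_column_def)

lemma position_less: "q < height (Suc n) \<Longrightarrow> q div height n < 2 ^ (n + 6)"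
  by (simp add: height_Suc less_mult_imp_div_less mult.commute)

lemma power_ge_64: "64 \<le> (2 ^ (n + 6) :: nat)"
  using one_le_power[of "2::nat" n] by (simp add: power_add)

lemma sub_copy_less: "t < 2 \<Longrightarrow> j < 2 ^ (n + 6) \<Longrightarrow> sub_copy t j < 2 ^ (n + 6)"
  using power_ge_64[of n] by (auto simp: sub_copy_def simp del: power_add)

lemma add_mult_power_less:
  fixes v i :: nat
  assumes "v < 2 ^ level n" "i < 2 ^ (n + 6)" shows "v + 2 ^ level n * i < 2 ^ level (Suc n)"
proof -
  have "v + 2 ^ level n * i < 2 ^ level n * Suc i" using assms(1) by simp
  also have "\<dots> \<le> 2 ^ level n * 2 ^ (n + 6)" using assms(2) by (intro mult_le_mono2) simp
  finally show ?thesis by (simp add: power_add)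
qed

lemma state_less: "t < 2 \<Longrightarrow> q < height n \<Longrightarrow> state n t q < 2 ^ level n"
proof (induction n arbitrary: t q)
  case (Suc n)
  show ?case unfolding state.simps
    by (intro add_mult_power_less Suc.IH sub_column_less sub_copy_less Suc.prems position_less
        mod_less_divisor height_pos)
qed simp

lemma state_0: "state n t 0 = t * 2 ^ bottom n"
proof (induction n arbitrary: t)
  case (Suc n)
  then show ?case by (simp add: sub_column_def sub_copy_def)
qed simp

text \<open>The last position of a column is never swapped and carries its own index as copy number,
  so all blocks of the top consist of ones and only bit \<open>0\<close> tells the columns
  apart.\<close>

lemma state_top: "t < 2 \<Longrightarrow> state n t (height n - 1) = col_top n t"
proof (induction n arbitrary: t)
  case 0
  then show ?case by (simp add: col_top_def height_def)
next
  case (Suc n)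
  let ?q = "height (Suc n) - 1" and ?N = "2 ^ (n + 6) :: nat"
  have N: "64 \<le> ?N" by (rule power_ge_64)
  have q: "?q = height n - 1 + height n * (?N - 1)"
    using height_pos[of n] N by (simp add: height_Suc diff_mult_distrib2)
  have div_mod: "(m + height n * j) div height n = j" "(m + height n * j) mod height n = m"
    if "m < height n" for m j using that by simp_all
  have "?q div height n = ?N - 1" "?q mod height n = height n - 1"
    unfolding q by (simp_all only: div_mod[of "height n - 1"] height_pos diff_less zero_less_one)
  moreover have "\<not> swapped n (?N - 1)"
    using swapped_less[of n "?N - 1"] by (auto simp: power_add)
  moreover have "\<not> ?N - 1 < 2" using N by linarith
  ultimately have "state (Suc n) t ?q = col_top n t + 2 ^ level n * (?N - 1)"
    using Suc.prems by (simp only: state.simps sub_column_def sub_copy_def if_False of_bool_eq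
      add_0_right mod_less Suc.IH)
  also have "\<dots> = col_top (Suc n) t"
  proof -
    obtain h m where "height n = Suc h" "?N = Suc m" using height_pos[of n] N by (metis Suc_pred' gr0I not_numeral_le_zero)
    then show ?thesis unfolding col_top_def power_level height_Suc by (simp del: power_Suc)
  qed
  finally show ?case .
qed

lemma next_sub_column:
  assumes "t < 2"
  shows "next_column n (sub_column n t j) (sub_copy t j) = sub_column n t (Suc j)"
    and "next_copy (sub_column n t j) (sub_copy t j) = sub_copy t (Suc j)"
proof -
  \<comment> \<open>\<open>next_column\<close> sends the shared copy \<open>i < 2\<close> of column
    \<open>1\<close> to column \<open>i\<close> without looking at \<open>swapped\<close>, so
    position \<open>2\<close> must hold the column's own type.\<close>
  have no: "\<not> swapped n (Suc (Suc 0))" using swapped_ge[of n "Suc (Suc 0)"] by auto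
  consider "j = 0" | "j = 1" | "2 \<le> j" by linarith
  then have "next_column n (sub_column n t j) (sub_copy t j) = sub_column n t (Suc j) \<and>
      next_copy (sub_column n t j) (sub_copy t j) = sub_copy t (Suc j)"
  proof cases
    case 3
    then have "\<not> j < 2" "\<not> Suc j < 2" by auto
    moreover have "((t + a) mod 2 + a + b) mod 2 = (t + b) mod 2" if "a < 2" for a b :: nat
      using assms that by (auto simp: less_2_cases_iff mod_Suc_eq)
    ultimately show ?thesis
      by (simp add: next_column_def sub_column_def next_copy_def sub_copy_def)
  qed (use assms no in \<open>auto simp: next_column_def sub_column_def next_copy_def sub_copy_def\<close>)
  then show "next_column n (sub_column n t j) (sub_copy t j) = sub_column n t (Suc j)"
    and "next_copy (sub_column n t j) (sub_copy t j) = sub_copy t (Suc j)" by blast+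
qed

text \<open>Induction on the level. Inside a copy the step is that of the lower level; at the top of
  a copy \<open>T\<close> jumps to the bottom of the next one, which by
  \<open>next_sub_column\<close> is the following position of the layout.\<close>

lemma T_state:
  assumes "t < 2" "Suc q < height n"
  shows "T (splice_bits n (state n t q) r) = splice_bits n (state n t (Suc q)) r"
  using assms
proof (induction n arbitrary: t q r)
  case 0
  then show ?case by (simp add: height_def)
next
  case (Suc n)
  let ?H = "height n"
  define j where "j = q div ?H"
  define m where "m = q mod ?H"
  have q: "q = m + ?H * j" by (simp add: j_def m_def)
  have m: "m < ?H" using height_pos[of n] by (simp add: m_def)
  have less: "sub_column n t j < 2" by (rule sub_column_less)
  have state: "state (Suc n) t q = state n (sub_column n t j) m + 2 ^ level n * sub_copy t j"
    by (simp add: j_def m_def)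
  show ?case
  proof (cases "Suc m < ?H")
    case True
    have "Suc q div ?H = j" "Suc q mod ?H = Suc m"
      using True by (simp_all add: q flip: add_Suc)
    then have "state (Suc n) t (Suc q) = state n (sub_column n t j) (Suc m) + 2 ^ level n * sub_copy t j"
      by simp
    then show ?thesis
      unfolding state using Suc.IH[OF less True] state_less[OF less m] state_less[OF less True]
      by (simp only: splice_bits_Suc)
  next
    case False
    with m have m_eq: "m = ?H - 1" and Suc_m: "Suc m = ?H" by auto
    have Sq: "Suc q = ?H * Suc j" using Suc_m by (simp add: q flip: add_Suc)
    have "?H * Suc j < ?H * 2 ^ (n + 6)" using Suc.prems(2) unfolding Sq height_Suc .
    then have j: "Suc j < 2 ^ (n + 6)" by (simp only: mult_less_cancel1)
    have "Suc q div ?H = Suc j" "Suc q mod ?H = 0" unfolding Sq using height_pos[of n] by simp_all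
    then have "state (Suc n) t (Suc q) = next_word n (sub_column n t j) (sub_copy t j)"
      using next_sub_column[OF Suc.prems(1)] by (simp add: state_0 next_word_def)
    moreover have "sub_copy t j < 2 ^ (n + 6) - 1"
    proof -
      show ?thesis using power_ge_64[of n] j Suc.prems(1) by (auto simp: sub_copy_def)
    qed
    ultimately show ?thesis
      unfolding state m_eq state_top[OF less] using T_splice_top[OF less] by simp
  qed
qed

lemma T_power_state:
  assumes "t < 2" "q + k < height n"
  shows "(T ^^ k) (splice_bits n (state n t q) r) = splice_bits n (state n t (q + k)) r"
  using assms(2)
proof (induction k)
  case (Suc k)
  then show ?case using T_state[OF assms(1), of "q + k" n r] by simp
qed simp

lemma state_surj:
  assumes "v < 2 ^ level n" obtains t q where "t < 2" "q < height n" "state n t q = v"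
proof -
  have "\<exists>t<2. \<exists>q<height n. state n t q = v"
    using assms
  proof (induction n arbitrary: v)
    case 0
    then show ?case by (auto simp: height_def)
  next
    case (Suc n)
    let ?H = "height n"
    define i where "i = v div 2 ^ level n"
    have v: "v = v mod 2 ^ level n + 2 ^ level n * i" by (simp add: i_def)
    have i: "i < 2 ^ (n + 6)"
      using Suc.prems unfolding i_def by (intro less_mult_imp_div_less) (simp add: power_add mult.commute)
    obtain t q where tq: "t < 2" "q < ?H" "state n t q = v mod 2 ^ level n"
      using Suc.IH[of "v mod 2 ^ level n"] by auto
    \<comment> \<open>Inverts the layout: copy \<open>i < 2\<close> of column \<open>t\<close> sits
      at position \<open>t\<close> of column \<open>i\<close>, every other copy \<open>i\<close> at
      position \<open>i\<close>.\<close>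
    have "\<exists>s<2. \<exists>j<2 ^ (n + 6). sub_column n s j = t \<and> sub_copy s j = i"
    proof (cases "i < 2")
      case True
      have "2 \<le> (2::nat) ^ (n + 6)" using one_le_power[of "2::nat" "n + 5"] by (simp add: power_add)
      then show ?thesis using True tq(1)
        by (intro exI[of _ i] conjI exI[of _ t]) (auto simp: sub_column_def sub_copy_def)
    next
      case False
      then show ?thesis using i tq(1)
        by (intro exI[of _ "(t + of_bool (swapped n i)) mod 2"] conjI exI[of _ i])
          (auto simp: sub_column_def sub_copy_def less_2_cases_iff)
    qed
    then obtain s j where sj: "s < 2" "j < 2 ^ (n + 6)" "sub_column n s j = t" "sub_copy s j = i" by blast
    have "q + ?H * j < ?H * Suc j" using tq(2) by simp
    also have "\<dots> \<le> height (Suc n)" unfolding height_Suc using sj(2) by (intro mult_le_mono2) simp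
    finally have "q + ?H * j < height (Suc n)" .
    moreover have "state (Suc n) s (q + ?H * j) = v"
      using tq sj v height_pos[of n] by simp
    ultimately show ?case using sj(1) by blast
  qed
  then show ?thesis using that by blast
qed

end

section \<open>Invariance of the measure and computability\<close>

lemma prefix_value_eq_iff:
  assumes "v < 2 ^ M" shows "prefix_value \<omega> M = v \<longleftrightarrow> (\<forall>i\<in>{..<M}. \<omega> i = bit v i)"
proof
  show "\<forall>i\<in>{..<M}. \<omega> i = bit v i" if "prefix_value \<omega> M = v"
    using that by (auto simp: bit_prefix_value)
  assume "\<forall>i\<in>{..<M}. \<omega> i = bit v i"
  then have "prefix_value \<omega> M = prefix_value (bit v) M" by (intro prefix_value_cong) simp
  then show "prefix_value \<omega> M = v" using assms by (simp add: prefix_value_bit)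
qed

lemma bernoulli_half_prefix_value:
  shows "{\<omega>. prefix_value \<omega> M \<in> S} \<in> sets bernoulli_half"
    and "emeasure bernoulli_half {\<omega>. prefix_value \<omega> M \<in> S} =
      of_nat (card {v. v < 2 ^ M \<and> v \<in> S}) * ennreal ((1/2) ^ M)"
proof -
  let ?A = "{v. v < 2 ^ M \<and> v \<in> S}"
  let ?C = "\<lambda>v. {\<omega>. prefix_value \<omega> M = v}"
  have U: "{\<omega>. prefix_value \<omega> M \<in> S} = (\<Union>v\<in>?A. ?C v)"
    using prefix_value_less by auto
  have C: "?C v = {\<omega>. \<forall>i\<in>{..<M}. \<omega> i = bit v i}" if "v \<in> ?A" for v
    using that prefix_value_eq_iff by blast
  have meas: "?C v \<in> sets bernoulli_half" "emeasure bernoulli_half (?C v) = ennreal ((1/2) ^ M)"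
    if "v \<in> ?A" for v
    unfolding C[OF that] using bernoulli_half_agree[of "{..<M}"] by simp_all
  show "{\<omega>. prefix_value \<omega> M \<in> S} \<in> sets bernoulli_half"
    unfolding U using meas(1) by (intro sets.finite_UN) auto
  have "emeasure bernoulli_half (\<Union>v\<in>?A. ?C v) = (\<Sum>v\<in>?A. emeasure bernoulli_half (?C v))"
    using meas(1) by (intro sum_emeasure[symmetric]) (auto simp: disjoint_family_on_def)
  also have "\<dots> = (\<Sum>v\<in>?A. ennreal ((1/2) ^ M))" using meas(2) by (rule sum.cong[OF refl])
  also have "\<dots> = of_nat (card ?A) * ennreal ((1/2) ^ M)" by (rule sum_constant)
  finally show "emeasure bernoulli_half {\<omega>. prefix_value \<omega> M \<in> S} = of_nat (card ?A) * ennreal ((1/2) ^ M)"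
    unfolding U .
qed

lemma measurable_prefix_value: "(\<lambda>\<omega>. prefix_value \<omega> M) \<in> measurable bernoulli_half (count_space UNIV)"
proof -
  have "(\<lambda>\<omega>. prefix_value \<omega> M) -` {v} \<inter> space bernoulli_half \<in> sets bernoulli_half" for v
  proof -
    have "(\<lambda>\<omega>. prefix_value \<omega> M) -` {v} \<inter> space bernoulli_half = {\<omega>. prefix_value \<omega> M \<in> {v}}"
      by (auto simp: space_bernoulli_half)
    then show ?thesis using bernoulli_half_prefix_value(1) by metis
  qed
  then show ?thesis by (subst measurable_count_space_eq2_countable) auto
qed

lemma measurable_local:
  assumes "\<And>\<omega> \<omega>' p. (\<And>j. j < M p \<Longrightarrow> \<omega> j = \<omega>' j) \<Longrightarrow> S \<omega> p = S \<omega>' p"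
  shows "S \<in> measurable bernoulli_half bernoulli_half"
proof -
  have eq: "(\<lambda>\<omega>. S \<omega> p) = (\<lambda>\<omega>. S (bit (prefix_value \<omega> (M p))) p)" for p
    by (intro ext assms) (simp add: bit_prefix_value)
  have "(\<lambda>\<omega>. S \<omega> p) \<in> measurable bernoulli_half (count_space UNIV)" for p
    unfolding eq by (rule measurable_compose[OF measurable_prefix_value]) simp
  then have "(\<lambda>\<omega> p. S \<omega> p) \<in> measurable bernoulli_half (PiM UNIV (\<lambda>_. measure_pmf (bernoulli_pmf (1/2))))"
    by (intro measurable_PiM_single') (auto simp: PiE_def)
  then show ?thesis by (simp add: bernoulli_half_def[symmetric])
qed

text \<open>Sets depending on finitely many coordinates determine the product measure, and each of
  them is a set of prefixes of length \<open>level n\<close> for some \<open>n\<close>.\<close>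

lemma measure_preservingI_prefix_value:
  assumes meas: "S \<in> measurable bernoulli_half bernoulli_half"
    and eq: "\<And>n A. emeasure bernoulli_half {\<omega>. prefix_value (S \<omega>) (level n) \<in> A} =
      emeasure bernoulli_half {\<omega>. prefix_value \<omega> (level n) \<in> A}"
  shows "measure_preserving bernoulli_half S"
proof -
  let ?M = "\<lambda>_::nat. measure_pmf (bernoulli_pmf (1/2))"
  have "distr bernoulli_half bernoulli_half S = bernoulli_half"
  proof (rule measure_eqI_PiM_infinite)
    fix A :: "nat \<Rightarrow> bool set" and J :: "nat set"
    assume "finite J"
    let ?X = "prod_emb UNIV ?M J (Pi\<^sub>E J A)"
    from \<open>finite J\<close> obtain n where n: "\<And>j. j \<in> J \<Longrightarrow> j < n"
      unfolding finite_nat_set_iff_bounded by blast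
    have X: "?X = {\<omega>. \<forall>i\<in>J. \<omega> i \<in> A i}"
    proof (rule set_eqI)
      fix \<omega> :: "nat \<Rightarrow> bool"
      have "\<omega> \<in> ?X \<longleftrightarrow> restrict \<omega> J \<in> Pi\<^sub>E J A" by (simp add: prod_emb_def)
      also have "\<dots> \<longleftrightarrow> \<omega> \<in> {\<omega>. \<forall>i\<in>J. \<omega> i \<in> A i}" unfolding PiE_iff by simp
      finally show "\<omega> \<in> ?X \<longleftrightarrow> \<omega> \<in> {\<omega>. \<forall>i\<in>J. \<omega> i \<in> A i}" .
    qed
    have "bit (prefix_value \<omega> (level n)) i = \<omega> i" if "i \<in> J" for \<omega> i
      using n[OF that] less_level[of n] by (simp add: bit_prefix_value)
    then have X': "?X = {\<omega>. prefix_value \<omega> (level n) \<in> {v. \<forall>i\<in>J. bit v i \<in> A i}}"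
      unfolding X by simp
    have "emeasure (distr bernoulli_half bernoulli_half S) ?X =
        emeasure bernoulli_half (S -` ?X \<inter> space bernoulli_half)"
      using meas by (rule emeasure_distr) (simp only: X' bernoulli_half_prefix_value(1))
    also have "S -` ?X \<inter> space bernoulli_half =
        {\<omega>. prefix_value (S \<omega>) (level n) \<in> {v. \<forall>i\<in>J. bit v i \<in> A i}}"
      unfolding X' space_bernoulli_half by auto
    also have "emeasure bernoulli_half \<dots> = emeasure bernoulli_half ?X"
      unfolding X' by (rule eq)
    finally show "emeasure (distr bernoulli_half bernoulli_half S) ?X = emeasure bernoulli_half ?X" .
  next
    show "finite_measure (distr bernoulli_half bernoulli_half S)"
    proof (rule finite_measureI)
      have "emeasure (distr bernoulli_half bernoulli_half S) (space (distr bernoulli_half bernoulli_half S)) =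
          emeasure bernoulli_half (S -` UNIV \<inter> space bernoulli_half)"
        using emeasure_distr[OF meas sets.top] by (simp add: space_bernoulli_half)
      then show "emeasure (distr bernoulli_half bernoulli_half S) (space (distr bernoulli_half bernoulli_half S)) \<noteq> \<infinity>"
        by (simp add: space_bernoulli_half emeasure_bernoulli_half_UNIV)
    qed
  qed (simp_all add: bernoulli_half_def)
  then have "emeasure bernoulli_half (S -` A \<inter> space bernoulli_half) = emeasure bernoulli_half A"
    if "A \<in> sets bernoulli_half" for A
    using emeasure_distr[OF meas that] by simp
  with meas show ?thesis unfolding measure_preserving_def by blast
qed

lemma card_Collect_bij_betw:
  assumes "bij_betw h X Y" shows "card {x\<in>X. P (h x)} = card {y\<in>Y. P y}"
proof -
  have "h ` {x\<in>X. P (h x)} = {y\<in>Y. P y}" using assms unfolding bij_betw_def by auto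
  moreover have "inj_on h {x\<in>X. P (h x)}" using assms unfolding bij_betw_def by (auto intro: inj_on_subset)
  ultimately show ?thesis using card_image by metis
qed

lemma computable_level [computable_intros]:
  assumes "computable_fun f" shows "computable_fun (\<lambda>n. level (f n))"
proof -
  have "level k = rec_nat 1 (\<lambda>k v. v + (k + 6)) k" for k by (induction k) auto
  then show ?thesis by (simp only:) (intro computable_intros assms)
qed

lemma computable_bottom [computable_intros]:
  assumes "computable_fun f" shows "computable_fun (\<lambda>n. bottom (f n))"
proof -
  have "bottom k = (if k = 0 then 0 else level (k - 1))" for k by (cases k) auto
  then show ?thesis by (simp only:) (intro computable_intros assms)
qed

lemma computable_bit [computable_intros]:
  fixes f g :: "nat \<Rightarrow> nat"
  assumes "computable_fun f" "computable_fun g" shows "computable_pred (\<lambda>n. bit (f n) (g n))"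
proof -
  have "bit v q \<longleftrightarrow> v div 2 ^ q mod 2 = 1" for v q :: nat
    by (simp add: bit_iff_odd odd_iff_mod_2_eq_one)
  then show ?thesis by (simp only:) (intro computable_intros assms)
qed

context tower
begin

definition shift :: "nat \<Rightarrow> nat \<times> nat \<Rightarrow> nat \<times> nat" where
  "shift m = (\<lambda>(t, q). (t, if Suc q < height m then Suc q else 0))"

lemma bij_betw_shift: "bij_betw (shift m) ({..<2::nat} \<times> {..<height m}) ({..<2::nat} \<times> {..<height m})"
proof -
  have "inj_on (shift m) ({..<2::nat} \<times> {..<height m})"
    by (auto simp: inj_on_def shift_def split: if_splits)
  moreover have "shift m ` ({..<2::nat} \<times> {..<height m}) \<subseteq> {..<2::nat} \<times> {..<height m}"
    using height_pos[of m] by (auto simp: shift_def)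
  ultimately show ?thesis unfolding bij_betw_def by (intro conjI endo_inj_surj) auto
qed

lemma bij_betw_state: "bij_betw (\<lambda>(t, q). state m t q) ({..<2::nat} \<times> {..<height m}) {..<2 ^ level m}"
proof -
  have im: "(\<lambda>(t, q). state m t q) ` ({..<2::nat} \<times> {..<height m}) = {..<2 ^ level m}"
  proof (intro equalityI subsetI)
    fix v assume "v \<in> {..<(2::nat) ^ level m}"
    then obtain t q where "t < 2" "q < height m" "state m t q = v" using state_surj by blast
    then show "v \<in> (\<lambda>(t, q). state m t q) ` ({..<2::nat} \<times> {..<height m})"
      by (intro image_eqI[of _ _ "(t, q)"]) auto
  qed (auto simp: state_less)
  moreover have "card ({..<2::nat} \<times> {..<height m}) = card {..<(2::nat) ^ level m}"
    by (simp add: power_level)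
  ultimately show ?thesis unfolding bij_betw_def by (metis eq_card_imp_inj_on finite_SigmaI finite_lessThan)
qed

text \<open>Seen through \<open>level n\<close> bits, \<open>T\<close> is the cyclic permutation
  \<open>shift m\<close> of the states of a higher level: the image of a top and the bottom of the
  same column both begin with \<open>level n\<close> zeros. A permutation preserves the uniform
  distribution, whence the invariance of the measure.\<close>

lemma prefix_value_T_state:
  assumes "t < 2" "q < height m" "level n + 2 \<le> m"
  shows "prefix_value (T (bit (state m t q))) (level n) =
    (case shift m (t, q) of (t, q) \<Rightarrow> state m t q) mod 2 ^ level n"
proof -
  have splice: "bit v = splice_bits m v (bit v)" for v :: nat
    by (auto simp: splice_bits_def)
  show ?thesis
  proof (cases "Suc q < height m")
    case True
    have "T (bit (state m t q)) = splice_bits m (state m t (Suc q)) (bit (state m t q))"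
      using T_state[OF assms(1) True] splice by metis
    moreover have "level n \<le> level m" using assms(3) less_level[of n] by (intro level_mono) simp
    ultimately have "prefix_value (T (bit (state m t q))) (level n) = prefix_value (bit (state m t (Suc q))) (level n)"
      by (intro prefix_value_cong) (simp add: splice_bits_def)
    with True show ?thesis by (simp add: prefix_value_bit shift_def)
  next
    case False
    then have q: "q = height m - 1" using assms(2) by simp
    have "\<not> T (bit (state m t q)) p" if "p < level n" for p
      unfolding q state_top[OF assms(1)] using bit_col_top[OF assms(1)] that assms(3)
      by (intro T_top[of m]) auto
    then have "prefix_value (T (bit (state m t q))) (level n) = 0"
      by (simp add: prefix_value_def)
    moreover obtain m' where m': "m = Suc m'" using assms(3) by (cases m) auto
    then have "level n \<le> bottom m" using assms(3) less_level[of n] by (auto intro: level_mono)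
    then have "state m t 0 mod 2 ^ level n = 0"
      unfolding state_0 by (simp add: le_imp_power_dvd)
    ultimately show ?thesis using False by (simp add: prefix_value_bit shift_def)
  qed
qed

lemma T_measure_preserving: "measure_preserving bernoulli_half T"
proof (rule measure_preservingI_prefix_value)
  show "T \<in> measurable bernoulli_half bernoulli_half"
    using T_local by (rule measurable_local)
  fix n and A :: "nat set"
  \<comment> \<open>Two levels beyond \<open>level n\<close> suffice for bits
    \<open>p < level n\<close>, both in \<open>T_local\<close> and in
    \<open>prefix_value_T_state\<close>.\<close>
  define m where "m = level n + 2"
  define F where "F v = prefix_value (T (bit v)) (level n)" for v :: nat
  let ?X = "{..<2::nat} \<times> {..<height m}" and ?s = "\<lambda>(t, q). state m t q"
  have "level (Suc (Suc p)) \<le> level m" if "p < level n" for p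
    unfolding m_def using that by (intro level_mono) simp
  then have "prefix_value (T \<omega>) (level n) = F (prefix_value \<omega> (level m))" for \<omega>
    unfolding F_def by (intro prefix_value_cong T_local) (auto simp: bit_prefix_value dest: less_le_trans)
  then have "emeasure bernoulli_half {\<omega>. prefix_value (T \<omega>) (level n) \<in> A} =
      of_nat (card {v. v < 2 ^ level m \<and> F v \<in> A}) * ennreal ((1/2) ^ level m)"
    using bernoulli_half_prefix_value(2)[of "level m" "F -` A"] by simp
  also have "card {v. v < 2 ^ level m \<and> F v \<in> A} = card {x\<in>?X. F (?s x) \<in> A}"
    using card_Collect_bij_betw[OF bij_betw_state, where P = "\<lambda>v. F v \<in> A"] by simp
  also have "{x\<in>?X. F (?s x) \<in> A} = {x\<in>?X. ?s (shift m x) mod 2 ^ level n \<in> A}"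
    using prefix_value_T_state[of _ _ m n] unfolding F_def m_def by auto
  also have "card \<dots> = card {x\<in>?X. ?s x mod 2 ^ level n \<in> A}"
    by (rule card_Collect_bij_betw[OF bij_betw_shift, where P = "\<lambda>x. ?s x mod 2 ^ level n \<in> A"])
  also have "\<dots> = card {v. v < 2 ^ level m \<and> v mod 2 ^ level n \<in> A}"
    using card_Collect_bij_betw[OF bij_betw_state, where P = "\<lambda>v. v mod 2 ^ level n \<in> A"] by simp
  also have "of_nat \<dots> * ennreal ((1/2) ^ level m) =
      emeasure bernoulli_half {\<omega>. prefix_value \<omega> (level m) mod 2 ^ level n \<in> A}"
    using bernoulli_half_prefix_value(2)[of "level m" "{v. v mod 2 ^ level n \<in> A}"] by simp
  also have "{\<omega>. prefix_value \<omega> (level m) mod 2 ^ level n \<in> A} = {\<omega>. prefix_value \<omega> (level n) \<in> A}"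
  proof -
    have "level n \<le> level m" unfolding m_def using less_level[of n] by (intro level_mono) simp
    then obtain d where d: "level m = level n + d" using le_Suc_ex by blast
    have "prefix_value \<omega> (level m) mod 2 ^ level n = prefix_value \<omega> (level n)" for \<omega>
      unfolding d prefix_value_add using prefix_value_less by simp
    then show ?thesis by simp
  qed
  finally show "emeasure bernoulli_half {\<omega>. prefix_value (T \<omega>) (level n) \<in> A} =
    emeasure bernoulli_half {\<omega>. prefix_value \<omega> (level n) \<in> A}" .
qed

lemma computable_block [computable_intros]:
  assumes "computable_fun f" "computable_fun g"
  shows "computable_fun (\<lambda>n. block (\<lambda>j. code_nth (f n) j = 1) (g n))"
proof -
  have "block \<omega> k = rec_nat 0 (\<lambda>j v. v + of_bool (\<omega> (level k + j)) * 2 ^ j) (k + 6)" for \<omega> k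
  proof -
    have "prefix_value \<omega>' m = rec_nat 0 (\<lambda>j v. v + of_bool (\<omega>' j) * 2 ^ j) m" for \<omega>' m
      by (induction m) (auto simp: prefix_value_Suc prefix_value_def[of _ 0])
    then show ?thesis unfolding block_def by simp
  qed
  then show ?thesis
    by (simp only:) (intro computable_intros computable_comp[OF assms(1)] computable_comp[OF assms(2)] assms)
qed

lemma computable_carry:
  assumes "computable_fun f" "computable_fun g"
  shows "computable_fun (\<lambda>n. carry (\<lambda>j. code_nth (f n) j = 1) (g n))"
  unfolding carry_def
proof (intro computable_intros computable_comp[OF assms(1)] computable_comp[OF assms(2)] assms)
  show "\<exists>k. Suc (g n) < k \<or> (\<exists>q<level (Suc k). 0 < q \<and> \<not> code_nth (f n) q = 1)" for n by blast
qed

lemma T_computable: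
  assumes z: "computable_fun z" shows "computable_transformation T"
proof (rule computable_transformationI)
  show "computable_fun (\<lambda>p. level (Suc (Suc p)))" by (intro computable_intros)
  show "T \<omega> p = T \<omega>' p" if "\<And>j. j < level (Suc (Suc p)) \<Longrightarrow> \<omega> j = \<omega>' j" for \<omega> \<omega>' p
    using that by (rule T_local)
  have swapped: "computable_pred (\<lambda>n. swapped (f n) (g n))" if "computable_fun f" "computable_fun g" for f g
    unfolding swapped_def by (intro computable_intros computable_comp[OF z] that)
  show "computable_pred (\<lambda>n. T (\<lambda>j. code_nth (pfst n) j = 1) (psnd n))"
    unfolding T_def next_word_def next_column_def next_copy_def
    by (intro computable_intros swapped computable_carry)
qed

end

section \<open>Divergence of the averages\<close>

text \<open>The errors at the two ends of a window are about \<open>e * (a + d)\<close> and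
  \<open>e * a\<close>. They are comparable to its length only if it does not start too late;
  \<open>a \<le> d\<close> gives the factor \<open>3\<close>. \<open>C\<close> absorbs the initial
  averages that are not yet close to \<open>l\<close>.\<close>

lemma cesaro_window:
  fixes S :: "nat \<Rightarrow> real"
  assumes lim: "(\<lambda>n. (1 / real n) * S n) \<longlonglongrightarrow> l" and e: "0 < e"
  obtains C where "0 \<le> C" "\<And>a d. a \<le> d \<Longrightarrow> \<bar>S (a + d) - S a - real d * l\<bar> \<le> 3 * e * real d + C"
proof -
  from LIMSEQ_D[OF lim e] obtain M where M: "\<And>n. M \<le> n \<Longrightarrow> \<bar>(1 / real n) * S n - l\<bar> < e" by auto
  define C where "C = (\<Sum>n\<le>M. \<bar>S n - real n * l\<bar>)"
  have C: "0 \<le> C" unfolding C_def by (rule sum_nonneg) simp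
  have bound: "\<bar>S n - real n * l\<bar> \<le> e * real n + C" for n
  proof (cases "n \<le> M")
    case True
    then have "\<bar>S n - real n * l\<bar> \<le> C" unfolding C_def by (intro member_le_sum) auto
    moreover have "0 \<le> e * real n" using e by simp
    ultimately show ?thesis by linarith
  next
    case False
    then have n: "0 < real n" by simp
    have "S n - real n * l = real n * ((1 / real n) * S n - l)" using n by (simp add: field_simps)
    then have "\<bar>S n - real n * l\<bar> = real n * \<bar>(1 / real n) * S n - l\<bar>" using n by (simp add: abs_mult)
    also have "\<dots> \<le> real n * e" using M[of n] False n by (intro mult_left_mono) auto
    finally show ?thesis using C by (simp add: mult.commute)
  qed
  show ?thesis
  proof
    show "0 \<le> 2 * C" using C by simp
    fix a d :: nat assume "a \<le> d"
    then have "e * real a \<le> e * real d" using e by simp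
    moreover have "S (a + d) - S a - real d * l = (S (a + d) - real (a + d) * l) - (S a - real a * l)"
      by (simp add: algebra_simps)
    moreover have "e * real (a + d) = e * real a + e * real d" by (simp add: algebra_simps)
    ultimately show "\<bar>S (a + d) - S a - real d * l\<bar> \<le> 3 * e * real d + 2 * C"
      using bound[of "a + d"] bound[of a] by linarith
  qed
qed

context tower
begin

section \<open>Numbers of ones in the two columns\<close>

definition ones :: "nat \<Rightarrow> nat \<Rightarrow> nat" where
  "ones n t = (\<Sum>q<height n. state n t q mod 2)"

lemma state_Suc_mod_2:
  assumes "q < height n"
  shows "state (Suc n) t (j * height n + q) mod 2 = state n (sub_column n t j) q mod 2"
proof -
  have "(j * height n + q) div height n = j" "(j * height n + q) mod height n = q" using assms by simp_all
  moreover have "(2::nat) ^ level n = 2 * height n" by (rule power_level)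
  ultimately show ?thesis by (simp add: mult.assoc)
qed

lemma sum_state_position:
  "(\<Sum>q\<in>{j * height n..<j * height n + height n}. state (Suc n) t q mod 2) = ones n (sub_column n t j)"
proof -
  have "(\<Sum>q\<in>{j * height n..<j * height n + height n}. state (Suc n) t q mod 2) =
      (\<Sum>q<height n. state (Suc n) t (j * height n + q) mod 2)"
    by (subst sum.atLeastLessThan_shift_0) (simp add: atLeast0LessThan)
  also have "\<dots> = ones n (sub_column n t j)"
    unfolding ones_def by (rule sum.cong[OF refl]) (simp only: state_Suc_mod_2 lessThan_iff)
  finally show ?thesis .
qed

lemma ones_Suc: "ones (Suc n) t = (\<Sum>j<2 ^ (n + 6). ones n (sub_column n t j))"
proof -
  have "ones (Suc n) t = (\<Sum>q<2 ^ (n + 6) * height n. state (Suc n) t q mod 2)"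
    by (simp only: ones_def height_Suc mult.commute)
  also have "\<dots> = (\<Sum>j<2 ^ (n + 6). \<Sum>q\<in>{j * height n..<j * height n + height n}. state (Suc n) t q mod 2)"
    by (rule sum.nat_group[symmetric])
  finally show ?thesis unfolding sum_state_position .
qed

definition gap :: "nat \<Rightarrow> real" where
  "gap n = real (ones n 1) - real (ones n 0)"

lemma card_swapped: "card ({..<2 ^ (n + 6)} \<inter> {j. swapped n j}) = of_bool (z n \<noteq> 0) * 2 ^ z n"
proof -
  have "{..<2 ^ (n + 6)} \<inter> {j. swapped n j} = {j. swapped n j}"
  proof -
    have "(2::nat) ^ (n + 3) \<le> 2 ^ (n + 6)" by (rule power_increasing) auto
    from less_le_trans[OF swapped_less this] show ?thesis by auto
  qed
  also have "\<dots> = (if z n = 0 then {} else {2 ^ z n..<2 * 2 ^ z n})"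
    by (auto simp: swapped_def)
  finally show ?thesis by simp
qed

text \<open>Relative decrease of \<open>gap\<close> in one step: the two shared positions contribute
  nothing, and a swapped position contributes with the opposite sign, hence counts twice.\<close>

definition loss :: "nat \<Rightarrow> real" where
  "loss n = 2 / 2 ^ (n + 6) + 2 * (of_bool (z n \<noteq> 0) * 2 ^ z n / 2 ^ (n + 6))"

lemma gap_Suc: "gap (Suc n) = gap n * 2 ^ (n + 6) * (1 - loss n)"
proof -
  let ?N = "2 ^ (n + 6) :: nat"
  have summand: "real (ones n (sub_column n 1 j)) - real (ones n (sub_column n 0 j)) =
      gap n * (1 - of_bool (j < 2) - 2 * of_bool (swapped n j))" for j
    using swapped_ge[of n j] by (auto simp: sub_column_def gap_def)
  have "gap (Suc n) = (\<Sum>j<?N. gap n * (1 - of_bool (j < 2) - 2 * of_bool (swapped n j)))"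
    unfolding gap_def[of "Suc n"] ones_Suc of_nat_sum sum_subtractf[symmetric] summand ..
  also have "\<dots> = gap n * (real ?N - (\<Sum>j<?N. of_bool (j < 2)) - 2 * (\<Sum>j<?N. of_bool (swapped n j)))"
    by (simp only: sum_distrib_left[symmetric] sum_subtractf sum_constant card_lessThan mult_1_right)
  also have "(\<Sum>j<?N. of_bool (j < 2)) = (2::real)"
  proof -
    have "{..<?N} \<inter> {j. j < 2} = {..<2}" using power_ge_64[of n] by auto
    then show ?thesis by (simp only: sum_of_bool_eq finite_lessThan card_lessThan of_nat_numeral)
  qed
  also have "(\<Sum>j<?N. of_bool (swapped n j)) = (of_bool (z n \<noteq> 0) * 2 ^ z n :: real)"
    by (simp only: sum_of_bool_eq finite_lessThan card_swapped) simp
  also have "gap n * (real ?N - 2 - 2 * (of_bool (z n \<noteq> 0) * 2 ^ z n)) = gap n * 2 ^ (n + 6) * (1 - loss n)"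
    by (simp add: loss_def field_simps)
  finally show ?thesis .
qed

end

text \<open>The total proportion of swapped positions is so small that the two columns of
  every level keep different frequencies of ones.\<close>

locale sparse_tower = tower +
  assumes density: "(\<Sum>k<n. of_bool (z k \<noteq> 0) * 2 ^ z k / 2 ^ (k + 6)) \<le> (1 / 8 :: real)"
begin

lemma sum_loss: "(\<Sum>k<n. loss k) \<le> 1 / 2"
proof -
  have "(\<Sum>k<n. 2 / 2 ^ (k + 6) :: real) = 1 / 16 - 1 / (16 * 2 ^ n)"
  proof (induction n)
    case (Suc n)
    show ?case unfolding sum.lessThan_Suc Suc by (simp add: power_add)
  qed simp
  then have "(\<Sum>k<n. 2 / 2 ^ (k + 6) :: real) \<le> 1 / 16" by simp
  then show ?thesis
    using density[of n] unfolding loss_def sum.distrib sum_distrib_left[symmetric] by linarith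
qed

lemma loss_nonneg: "0 \<le> loss n"
  by (simp add: loss_def)

text \<open>The Weierstrass inequality: a product of factors \<open>1 - loss k\<close> is at least
  \<open>1\<close> minus the sum of the losses.\<close>

lemma gap_ge: "real (height n) * (1 - (\<Sum>k<n. loss k)) \<le> gap n"
proof (induction n)
  case 0
  then show ?case by (simp add: gap_def ones_def height_def)
next
  case (Suc n)
  let ?W = "\<Sum>k<n. loss k"
  have W: "0 \<le> ?W" by (intro sum_nonneg loss_nonneg)
  have "loss n \<le> 1" using sum_loss[of "Suc n"] W by simp
  have "1 - (\<Sum>k<Suc n. loss k) \<le> (1 - ?W) * (1 - loss n)"
    using mult_nonneg_nonneg[OF W loss_nonneg[of n]] by (simp add: algebra_simps)
  then have "real (height (Suc n)) * (1 - (\<Sum>k<Suc n. loss k)) \<le>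
      real (height (Suc n)) * ((1 - ?W) * (1 - loss n))"
    by (intro mult_left_mono) auto
  also have "\<dots> = real (height n) * (1 - ?W) * (2 ^ (n + 6) * (1 - loss n))"
    by (simp add: height_Suc mult.assoc mult.left_commute)
  also have "\<dots> \<le> gap n * (2 ^ (n + 6) * (1 - loss n))"
    using Suc \<open>loss n \<le> 1\<close> by (intro mult_right_mono) auto
  also have "\<dots> = gap (Suc n)" by (simp add: gap_Suc mult.assoc)
  finally show ?case .
qed

lemma gap_ge_half: "real (height n) / 2 \<le> gap n"
proof -
  have "real (height n) * (1 / 2) \<le> real (height n) * (1 - (\<Sum>k<n. loss k))"
    using sum_loss[of n] by (intro mult_left_mono) auto
  with gap_ge[of n] show ?thesis by simp
qed

text \<open>If both the current copy and the next one are swapped, the orbit first traverses a full copy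
  of its current column of level \<open>n\<close> and then, in the second half of the column of level \<open>n + 1\<close>,
  only copies of the other one.\<close>

lemma windows:
  fixes \<omega> :: "nat \<Rightarrow> bool"
  defines "S k \<equiv> \<Sum>i<k. indicat_real {\<omega>. \<omega> 0} ((T ^^ i) \<omega>)"
  assumes sw: "swapped n (block \<omega> n)" "swapped n (Suc (block \<omega> n))"
  obtains t a b where "t < 2" "a \<le> height n" "S (a + height n) - S a = real (ones n t)"
    "b \<le> 2 ^ (n + 5) * height n"
    "S (b + 2 ^ (n + 5) * height n) - S b = 2 ^ (n + 5) * real (ones n (1 - t))"
proof -
  let ?H = "height n"
  define i where "i = block \<omega> n"
  have i: "4 \<le> i" "Suc i < 2 ^ (n + 3)" using swapped_ge[OF sw(1)] swapped_less[OF sw(2)] by (simp_all add: i_def)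
  obtain t q where t: "t < 2" and q: "q < ?H" and tq: "state n t q = prefix_value \<omega> (level n)"
    using state_surj[OF prefix_value_less] by metis
  define x0 where "x0 = i * ?H + q"
  have pos: "x0 div ?H = i" "x0 mod ?H = q" unfolding x0_def using q by simp_all
  have t': "1 - t < 2" by simp
  \<comment> \<open>The current copy has type \<open>t\<close> and is swapped, so the surrounding
    column of level \<open>n + 1\<close> has the other type \<open>1 - t\<close>.\<close>
  have sub: "sub_column n (1 - t) j = t" if "swapped n j" for j
    using that swapped_ge[OF that] t by (auto simp: sub_column_def less_2_cases_iff)
  have "state (Suc n) (1 - t) x0 = prefix_value \<omega> (level (Suc n))"
  proof -
    have "prefix_value \<omega> (level (Suc n)) = prefix_value \<omega> (level n) + 2 ^ level n * i"
      unfolding level.simps prefix_value_add i_def block_def ..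
    moreover have "sub_column n (1 - t) i = t" using sub[OF sw(1)] unfolding i_def .
    moreover have "sub_copy (1 - t) i = i" using i(1) by (simp add: sub_copy_def)
    ultimately show ?thesis unfolding state.simps pos tq[symmetric] by simp
  qed
  then have \<omega>: "\<omega> = splice_bits (Suc n) (state (Suc n) (1 - t) x0) \<omega>"
    by (simp only: splice_bits_prefix_value)
  define f where "f x = real (state (Suc n) (1 - t) x mod 2)" for x
  have f: "indicat_real {\<omega>. \<omega> 0} ((T ^^ k) \<omega>) = f (x0 + k)" if "x0 + k < height (Suc n)" for k
  proof -
    have "(T ^^ k) \<omega> = splice_bits (Suc n) (state (Suc n) (1 - t) (x0 + k)) \<omega>"
      using T_power_state[OF t' that] \<omega> by metis
    then show ?thesis
      using level_pos[of "Suc n"]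
      by (simp add: splice_bits_def f_def bit_0 indicator_def mod2_eq_if del: state.simps)
  qed
  have S: "S k = (\<Sum>x\<in>{x0..<x0 + k}. f x)" if "x0 + k \<le> height (Suc n)" for k
  proof -
    have "S k = (\<Sum>m<k. f (x0 + m))"
      unfolding S_def using that by (intro sum.cong refl f) simp
    also have "\<dots> = (\<Sum>x\<in>{x0..<x0 + k}. f x)"
      by (subst sum.atLeastLessThan_shift_0) (simp add: atLeast0LessThan)
    finally show ?thesis .
  qed
  have window: "S (a + d) - S a = (\<Sum>x\<in>{x0 + a..<x0 + a + d}. f x)" if "x0 + a + d \<le> height (Suc n)" for a d
  proof -
    have "S (a + d) = (\<Sum>x\<in>{x0..<x0 + a}. f x) + (\<Sum>x\<in>{x0 + a..<x0 + a + d}. f x)"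
      using that by (subst S) (simp_all add: sum.atLeastLessThan_concat add.assoc)
    then show ?thesis using S[of a] that by simp
  qed
  have copy: "(\<Sum>x\<in>{j * ?H..<j * ?H + ?H}. f x) = real (ones n (sub_column n (1 - t) j))" for j
    unfolding f_def of_nat_sum[symmetric] sum_state_position ..
  have Hs: "height (Suc n) = 2 ^ (n + 6) * ?H" by (simp add: height_Suc)
  have pow: "(2::nat) ^ (n + 3) \<le> 2 ^ (n + 5)" "(2::nat) ^ (n + 6) = 2 ^ (n + 5) + 2 ^ (n + 5)"
    by (intro power_increasing) (auto simp: power_add)
  show ?thesis
  proof (rule that[OF t])
    let ?a = "?H - q"
    have a: "x0 + ?a = Suc i * ?H" using q by (simp add: x0_def)
    show "?a \<le> ?H" by simp
    have "x0 + ?a + ?H = Suc (Suc i) * ?H" using a by simp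
    also have "\<dots> \<le> height (Suc n)" unfolding Hs using i pow by (intro mult_le_mono1) linarith
    finally show "S (?a + ?H) - S ?a = real (ones n t)"
      using copy[of "Suc i"] sub[OF sw(2)] by (subst window) (simp_all only: a i_def)
    \<comment> \<open>Swapped positions are below \<open>2 ^ (n + 3)\<close>, so from position
      \<open>2 ^ (n + 5)\<close> on the column holds only copies of its own type. The window starts
      no later than its length, as \<open>cesaro_window\<close> demands.\<close>
    let ?M = "2 ^ (n + 5) :: nat"
    let ?b = "?M * ?H - x0"
    have "x0 < Suc i * ?H" using q by (simp add: x0_def)
    also have "\<dots> \<le> ?M * ?H" using i pow by (intro mult_le_mono1) linarith
    finally have b: "x0 + ?b = ?M * ?H" by simp
    show "?b \<le> 2 ^ (n + 5) * ?H" by simp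
    have "S (?b + ?M * ?H) - S ?b = (\<Sum>x\<in>{?M * ?H..<?M * ?H + ?M * ?H}. f x)"
      by (subst window) (simp_all only: b Hs pow(2) add_mult_distrib)
    also have "\<dots> = (\<Sum>x<?M * ?H. f (?M * ?H + x))"
      by (subst sum.atLeastLessThan_shift_0) (simp add: atLeast0LessThan)
    also have "\<dots> = (\<Sum>j<?M. \<Sum>x\<in>{j * ?H..<j * ?H + ?H}. f (?M * ?H + x))"
      by (rule sum.nat_group[symmetric])
    also have "\<dots> = (\<Sum>j<?M. real (ones n (1 - t)))"
    proof (rule sum.cong[OF refl])
      fix j assume "j \<in> {..<?M}"
      have "(\<Sum>x\<in>{j * ?H..<j * ?H + ?H}. f (?M * ?H + x)) =
          (\<Sum>x\<in>{(?M + j) * ?H..<(?M + j) * ?H + ?H}. f x)"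
        by (simp only: sum.atLeastLessThan_shift_0[of _ "j * ?H"] sum.atLeastLessThan_shift_0[of _ "(?M + j) * ?H"])
          (simp add: algebra_simps)
      also have "\<dots> = real (ones n (sub_column n (1 - t) (?M + j)))" by (rule copy)
      also have "sub_column n (1 - t) (?M + j) = 1 - t"
      proof -
        have "\<not> swapped n (?M + j)" using swapped_less[of n "?M + j"] pow by linarith
        moreover have "\<not> ?M + j < 2" using i pow by linarith
        ultimately show ?thesis by (simp add: sub_column_def)
      qed
      finally show "(\<Sum>x\<in>{j * ?H..<j * ?H + ?H}. f (?M * ?H + x)) = real (ones n (1 - t))" .
    qed
    also have "\<dots> = 2 ^ (n + 5) * real (ones n (1 - t))" by simp
    finally show "S (?b + 2 ^ (n + 5) * ?H) - S ?b = 2 ^ (n + 5) * real (ones n (1 - t))" .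
  qed
qed

lemma not_convergent:
  assumes inf: "\<And>m. \<exists>n\<ge>m. swapped n (block \<omega> n) \<and> swapped n (Suc (block \<omega> n))"
  shows "\<not> convergent (\<lambda>n. (1 / real n) * (\<Sum>i<n. indicat_real {\<omega>. \<omega> 0} ((T ^^ i) \<omega>)))"
proof
  let ?S = "\<lambda>k. \<Sum>i<k. indicat_real {\<omega>. \<omega> 0} ((T ^^ i) \<omega>)"
  assume "convergent (\<lambda>n. (1 / real n) * ?S n)"
  then obtain l where "(\<lambda>n. (1 / real n) * ?S n) \<longlonglongrightarrow> l" unfolding convergent_def by blast
  \<comment> \<open>With \<open>e = 1 / 24\<close> either window fixes its number of ones per column
    up to \<open>height n / 8 + C\<close>. Then \<open>gap n\<close> is at most
    \<open>height n / 4 + 2 * C\<close>, against the lower bound \<open>height n / 2\<close>, which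
    fails once \<open>height n > 8 * C\<close>.\<close>
  then obtain C where C: "0 \<le> C"
    "\<And>a d. a \<le> d \<Longrightarrow> \<bar>?S (a + d) - ?S a - real d * l\<bar> \<le> 3 * (1 / 24) * real d + C"
    by (rule cesaro_window[of _ l "1 / 24"]) auto
  obtain m where m: "8 * C < real m" using reals_Archimedean2 by blast
  obtain n where n: "m \<le> n" "swapped n (block \<omega> n)" "swapped n (Suc (block \<omega> n))" using inf by blast
  let ?H = "real (height n)" and ?M = "2 ^ (n + 5) :: real"
  obtain t a b where t: "t < 2"
    and a: "a \<le> height n" "?S (a + height n) - ?S a = real (ones n t)"
    and b: "b \<le> 2 ^ (n + 5) * height n" "?S (b + 2 ^ (n + 5) * height n) - ?S b = ?M * real (ones n (1 - t))"
    by (rule windows[OF n(2,3)])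
  have 1: "\<bar>real (ones n t) - ?H * l\<bar> \<le> ?H / 8 + C"
    using C(2)[OF a(1)] unfolding a(2) by simp
  have "\<bar>?M * real (ones n (1 - t)) - ?M * ?H * l\<bar> \<le> ?M * ?H / 8 + C"
    using C(2)[OF b(1)] unfolding b(2) by simp
  also have "\<dots> \<le> ?M * (?H / 8 + C)"
  proof -
    have "1 \<le> ?M" by simp
    then have "1 * C \<le> ?M * C" using C(1) by (intro mult_right_mono)
    then show ?thesis by (simp add: algebra_simps)
  qed
  also have "?M * real (ones n (1 - t)) - ?M * ?H * l = ?M * (real (ones n (1 - t)) - ?H * l)"
    by (simp add: algebra_simps)
  also have "\<bar>\<dots>\<bar> = ?M * \<bar>real (ones n (1 - t)) - ?H * l\<bar>" by (simp add: abs_mult)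
  finally have 2: "\<bar>real (ones n (1 - t)) - ?H * l\<bar> \<le> ?H / 8 + C"
    by (simp only: mult_le_cancel_left_pos zero_less_power zero_less_numeral)
  have "\<bar>gap n\<bar> = \<bar>real (ones n t) - real (ones n (1 - t))\<bar>"
    using t by (auto simp: gap_def less_2_cases_iff)
  then have "?H / 2 \<le> ?H / 4 + 2 * C" using 1 2 gap_ge_half[of n] by linarith
  then have "?H \<le> 8 * C" by simp
  moreover have "real m \<le> ?H"
  proof -
    have "m \<le> level n - 1" using n(1) less_level[of n] by simp
    also have "\<dots> \<le> height n" unfolding height_def using less_exp[of "level n - 1"] by simp
    finally show ?thesis by simp
  qed
  ultimately show False using m by simp
qed

end

lemma computable_real_fun_first_bit: "computable_real_fun (indicat_real {\<omega>. \<omega> 0})"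
proof -
  define \<Phi> :: "(bool list \<times> int \<times> nat) set" where
    "\<Phi> = {(x, z, k). \<exists>b. x = [b] \<and> z = (if b then 2 ^ k else 0)}"
  \<comment> \<open>One bit of the argument gives the exact value \<open>0\<close> or
    \<open>2 ^ k / 2 ^ k\<close>; the factor \<open>2\<close> is due to \<open>int_encode\<close>,
    which doubles nonnegative numbers.\<close>
  let ?P = "\<lambda>n. pfst n = string_code [True] \<and> pfst (psnd n) = 2 * 2 ^ psnd (psnd n) \<or>
    pfst n = string_code [False] \<and> pfst (psnd n) = 0"
  have int_encode: "int_encode (2 ^ k) = 2 * 2 ^ k" "int_encode 0 = 0" for k
    by (simp_all add: int_encode_def sum_encode_def nat_power_eq)
  have "(\<lambda>(x, z, k). prod_encode (string_code x, prod_encode (int_encode z, k))) ` \<Phi> = {n. ?P n}"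
  proof (intro equalityI subsetI)
    fix n assume "n \<in> (\<lambda>(x, z, k). prod_encode (string_code x, prod_encode (int_encode z, k))) ` \<Phi>"
    then obtain b k where "n = prod_encode (string_code [b], prod_encode (int_encode (if b then 2 ^ k else 0), k))"
      unfolding \<Phi>_def by auto
    then show "n \<in> {n. ?P n}" by (cases b) (simp_all add: int_encode)
  next
    fix n assume P: "n \<in> {n. ?P n}"
    let ?k = "psnd (psnd n)"
    have n: "n = prod_encode (pfst n, prod_encode (pfst (psnd n), ?k))" by simp
    from P show "n \<in> (\<lambda>(x, z, k). prod_encode (string_code x, prod_encode (int_encode z, k))) ` \<Phi>"
    proof (elim CollectE disjE conjE)
      assume "pfst n = string_code [True]" "pfst (psnd n) = 2 * 2 ^ ?k"
      then have "prod_encode (pfst n, prod_encode (pfst (psnd n), ?k)) =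
          prod_encode (string_code [True], prod_encode (int_encode (2 ^ ?k), ?k))"
        by (simp only: int_encode)
      then show ?thesis using n by (intro image_eqI[of _ _ "([True], 2 ^ ?k, ?k)"]) (auto simp: \<Phi>_def)
    next
      assume "pfst n = string_code [False]" "pfst (psnd n) = 0"
      then have "prod_encode (pfst n, prod_encode (pfst (psnd n), ?k)) =
          prod_encode (string_code [False], prod_encode (int_encode 0, ?k))"
        by (simp only: int_encode)
      then show ?thesis using n by (intro image_eqI[of _ _ "([False], 0, ?k)"]) (auto simp: \<Phi>_def)
    qed
  qed
  moreover have "rec_enumerable {n. ?P n}"
    by (intro rec_enumerable_decidable computable_intros)
  moreover have "\<bar>indicat_real {\<omega>. \<omega> 0} \<omega> - real_of_int z / 2 ^ k\<bar> \<le> 1 / 2 ^ k"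
    if "(x, z, k) \<in> \<Phi>" "FinSeq x \<le> InfSeq \<omega>" for x z k \<omega>
    using that unfolding FinSeq_le_InfSeq_iff \<Phi>_def by (auto simp: indicator_def)
  moreover have "\<exists>x z. FinSeq x \<le> InfSeq \<omega> \<and> (x, z, k) \<in> \<Phi>" for \<omega> k
    unfolding FinSeq_le_InfSeq_iff \<Phi>_def by (intro exI[of _ "[\<omega> 0]"] exI) auto
  ultimately show ?thesis unfolding computable_real_fun_def by (intro exI[of _ \<Phi>]) (simp only:, blast)
qed

section \<open>The forced bits and their cost\<close>

lemma level_add_inject:
  assumes "level m + b = level n + c" "b < m + 6" "c < n + 6" shows "m = n \<and> b = c"
proof -
  have "\<not> k < l" if "level k + d = level l + e" "d < k + 6" for k l d e
    using level_mono[of "Suc k" l] that by (auto simp: Suc_le_eq)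
  from this[of m b n c] this[of n c m b] have "m = n" using assms by simp
  with assms show ?thesis by simp
qed

text \<open>Greedy choice, with the second component recording the cost already spent. As
  \<open>d\<close> is arbitrary, there is a later event at which \<open>\<sigma>\<close> covers both
  this cost and its own.\<close>

lemma event_levels:
  fixes \<sigma> w :: "nat \<Rightarrow> nat"
  assumes ev: "\<And>d k0. \<exists>k>k0. E k \<and> w k + d \<le> \<sigma> k"
  shows "\<exists>\<kappa>. strict_mono \<kappa> \<and> (\<forall>j. E (\<kappa> j)) \<and> (\<forall>j. (\<Sum>i<Suc j. w (\<kappa> i)) \<le> \<sigma> (\<kappa> j))"
proof -
  have "\<exists>f. \<forall>n. (E (fst (f n)) \<and> snd (f n) + w (fst (f n)) \<le> \<sigma> (fst (f n)) \<and> (n = 0 \<longrightarrow> snd (f n) = 0)) \<and>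
      (fst (f n) < fst (f (Suc n)) \<and> snd (f (Suc n)) = snd (f n) + w (fst (f n)))"
  proof (rule dependent_nat_choice)
    obtain k where "E k" "w k + 0 \<le> \<sigma> k" using ev by blast
    then show "\<exists>x. E (fst x) \<and> snd x + w (fst x) \<le> \<sigma> (fst x) \<and> ((0::nat) = 0 \<longrightarrow> snd x = 0)"
      by (intro exI[of _ "(k, 0)"]) simp
  next
    fix x :: "nat \<times> nat" and n :: nat
    obtain k where "fst x < k" "E k" "w k + (snd x + w (fst x)) \<le> \<sigma> k" using ev by blast
    then show "\<exists>y. (E (fst y) \<and> snd y + w (fst y) \<le> \<sigma> (fst y) \<and> (Suc n = 0 \<longrightarrow> snd y = 0)) \<and>
        (fst x < fst y \<and> snd y = snd x + w (fst x))"
      by (intro exI[of _ "(k, snd x + w (fst x))"]) (simp add: add.commute)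
  qed
  then obtain f where f: "\<And>n. E (fst (f n))" "\<And>n. snd (f n) + w (fst (f n)) \<le> \<sigma> (fst (f n))"
    "snd (f 0) = 0" "\<And>n. fst (f n) < fst (f (Suc n))" "\<And>n. snd (f (Suc n)) = snd (f n) + w (fst (f n))"
    by metis
  have "(\<Sum>i<n. w (fst (f i))) = snd (f n)" for n
    by (induction n) (simp_all add: f(3,5))
  then have "(\<Sum>i<Suc j. w (fst (f i))) \<le> \<sigma> (fst (f j))" for j
    using f(2,5)[of j] by simp
  then show ?thesis
    using f(1,4) by (intro exI[of _ "\<lambda>n. fst (f n)"]) (simp add: strict_mono_Suc_iff del: sum.lessThan_Suc)
qed

text \<open>The bits from \<open>z n\<close> on already place the block in the swapped interval. The
  additional zero at \<open>z n - 1\<close> keeps it in the lower half, so that its successor is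
  swapped as well.\<close>

lemma (in tower) swapped_block:
  assumes z: "z n \<noteq> 0" and \<omega>: "\<And>b. z n - 1 \<le> b \<Longrightarrow> b < n + 6 \<Longrightarrow> \<omega> (level n + b) \<longleftrightarrow> b = z n"
  shows "swapped n (block \<omega> n) \<and> swapped n (Suc (block \<omega> n))"
proof -
  define c where "c = z n - 1"
  define d where "d = n + 6 - c"
  have zc: "z n = Suc c" using z by (simp add: c_def)
  have d: "5 \<le> d" "n + 6 = c + d" using z_bounds[of n] z by (auto simp: c_def d_def)
  let ?lo = "prefix_value (\<lambda>j. \<omega> (level n + j)) c"
  have "prefix_value (\<lambda>j. \<omega> (level n + (c + j))) d = prefix_value (bit (2::nat)) d"
  proof (rule prefix_value_cong)
    fix j assume "j < d"
    then have "\<omega> (level n + (c + j)) \<longleftrightarrow> c + j = z n" using d(2) by (intro \<omega>) (simp_all add: c_def)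
    then have "\<omega> (level n + (c + j)) \<longleftrightarrow> j = 1" unfolding zc by simp
    then show "\<omega> (level n + (c + j)) = bit (2::nat) j" by (simp add: bit_2_iff)
  qed
  also have "\<dots> = 2"
  proof -
    have "(2::nat) ^ 5 \<le> 2 ^ d" using d(1) by (intro power_increasing) auto
    then show ?thesis by (simp add: prefix_value_bit)
  qed
  finally have "block \<omega> n = ?lo + 2 ^ z n"
    unfolding block_def d(2) prefix_value_add zc by simp
  moreover have "?lo < 2 ^ c" by (rule prefix_value_less)
  moreover have "(2::nat) ^ z n = 2 * 2 ^ c" by (simp add: zc)
  ultimately show ?thesis using z by (simp add: swapped_def)
qed

text \<open>By injectivity the fractions are distinct powers \<open>(1 / 2) ^ (m + 4)\<close>, and
  all of these sum to \<open>1 / 8\<close>. The exponent is the difference between the block length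
  \<open>k + 6\<close> and \<open>z k\<close>.\<close>

lemma event_density:
  fixes z w :: "nat \<Rightarrow> nat"
  assumes inj: "inj_on w {k. E k}" and le: "\<And>k. w k \<le> k"
    and z: "\<And>k. z k = (if E k then k + 2 - w k else 0)"
  shows "(\<Sum>k<n. of_bool (z k \<noteq> 0) * 2 ^ z k / 2 ^ (k + 6)) \<le> (1 / 8 :: real)"
proof -
  have summand: "of_bool (z k \<noteq> 0) * 2 ^ z k / 2 ^ (k + 6) = of_bool (E k) * ((1 / 2) ^ (w k + 4) :: real)" for k
  proof (cases "E k")
    case True
    with le[of k] have "k + 6 = z k + (w k + 4)" "z k \<noteq> 0" by (simp_all add: z)
    then show ?thesis using True by (simp only: power_add) (simp add: power_one_over field_simps)
  qed (simp add: z)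
  have "(\<Sum>k<n. of_bool (z k \<noteq> 0) * 2 ^ z k / 2 ^ (k + 6)) = (\<Sum>k\<in>{..<n} \<inter> {k. E k}. (1 / 2) ^ (w k + 4) :: real)"
    unfolding summand by (rule sum_of_bool_mult_eq) simp
  also have "\<dots> = (\<Sum>m\<in>w ` ({..<n} \<inter> {k. E k}). (1 / 2) ^ (m + 4))"
    using inj by (subst sum.reindex) (auto intro: inj_on_subset)
  also have "\<dots> \<le> (\<Sum>m<n. (1 / 2) ^ (m + 4))"
  proof (rule sum_mono2)
    show "w ` ({..<n} \<inter> {k. E k}) \<subseteq> {..<n}" using le by (auto intro: le_less_trans)
  qed auto
  also have "\<dots> = 1 / 8 - 1 / (8 * 2 ^ n)"
  proof (induction n)
    case (Suc n)
    show ?case unfolding sum.lessThan_Suc Suc by (simp add: power_add power_one_over)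
  qed simp
  also have "\<dots> \<le> 1 / 8" by simp
  finally show ?thesis .
qed

text \<open>A forced block meeting \<open>{..<n}\<close> starts at
  \<open>level (\<kappa> j) < n\<close>, so the last one has \<open>\<kappa> j < n\<close>. The
  total cost up to it is at most \<open>\<sigma> (\<kappa> j)\<close>, hence at most
  \<open>\<sigma> n\<close> by monotonicity.\<close>

lemma card_forced_positions:
  fixes \<kappa> c w \<sigma> :: "nat \<Rightarrow> nat"
  assumes \<kappa>: "strict_mono \<kappa>" and \<sigma>: "mono \<sigma>"
    and c: "\<And>j. \<kappa> j + 6 - c j \<le> w (\<kappa> j)" and sum: "\<And>j. (\<Sum>i<Suc j. w (\<kappa> i)) \<le> \<sigma> (\<kappa> j)"
  shows "card ((\<Union>j. (+) (level (\<kappa> j)) ` {c j..<\<kappa> j + 6}) \<inter> {..<n}) \<le> \<sigma> n"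
proof -
  let ?B = "\<lambda>j. (+) (level (\<kappa> j)) ` {c j..<\<kappa> j + 6}"
  define J where "J = (LEAST j. n \<le> level (\<kappa> j))"
  have "n \<le> level (\<kappa> n)"
    using strict_mono_imp_increasing[OF \<kappa>, of n] less_level[of "\<kappa> n"] by simp
  then have J: "n \<le> level (\<kappa> J)" unfolding J_def by (rule LeastI)
  have "(\<Union>j. ?B j) \<inter> {..<n} \<subseteq> (\<Union>j<J. ?B j)"
  proof
    fix p assume "p \<in> (\<Union>j. ?B j) \<inter> {..<n}"
    then obtain j where j: "p \<in> ?B j" "p < n" by blast
    then have "level (\<kappa> j) < level (\<kappa> J)" using J by auto
    then have "j < J" using \<kappa> level_mono by (metis leD leI strict_mono_less_eq)
    with j(1) show "p \<in> (\<Union>j<J. ?B j)" by blast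
  qed
  then have "card ((\<Union>j. ?B j) \<inter> {..<n}) \<le> card (\<Union>j<J. ?B j)" by (intro card_mono) auto
  also have "\<dots> \<le> (\<Sum>j<J. card (?B j))" by (rule card_UN_le) simp
  also have "\<dots> \<le> (\<Sum>j<J. w (\<kappa> j))"
    using c by (intro sum_mono) (auto intro: order_trans[OF card_image_le])
  also have "\<dots> \<le> \<sigma> n"
  proof (cases J)
    case (Suc j)
    have "level (\<kappa> j) < n" using not_less_Least[of j "\<lambda>j. n \<le> level (\<kappa> j)"] Suc unfolding J_def by simp
    then have "\<kappa> j \<le> n" using less_level[of "\<kappa> j"] by simp
    then have "\<sigma> (\<kappa> j) \<le> \<sigma> n" using \<sigma> by (rule monoD[rotated])
    with sum[of j] show ?thesis unfolding Suc by simp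
  qed simp
  finally show ?thesis .
qed

theorem theorem3:
  fixes \<psi> :: "(bool list \<times> bool list) set"
  assumes "optimal_decoder \<psi>"
  shows "\<exists>T :: (nat \<Rightarrow> bool) \<Rightarrow> (nat \<Rightarrow> bool).
    computable_transformation T \<and> measure_preserving bernoulli_half T \<and>
    (\<forall>\<sigma> :: nat \<Rightarrow> nat. mono \<sigma> \<longrightarrow> \<not> bdd_above (range \<sigma>) \<longrightarrow> computable_fun \<sigma> \<longrightarrow>
      (\<exists>\<omega> :: nat \<Rightarrow> bool.
        (\<forall>n. ereal_of_enat (Km \<psi> (seq_prefix \<omega> n)) \<ge> ereal (real n - real (\<sigma> n))) \<and>
        (\<exists>A :: (nat \<Rightarrow> bool) set. computable_real_fun (indicat_real A) \<and>
          \<not> convergent (\<lambda>n. (1 / real n) * (\<Sum>i<n. indicat_real A ((T ^^ i) \<omega>))))))"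
proof -
  from assms have \<psi>: "computable_operation \<psi>" unfolding optimal_decoder_def by blast
  from exists_events[OF assms] obtain E where E: "computable_pred E" "inj_on pfst {k. E k}"
    and events: "\<forall>\<sigma> :: nat \<Rightarrow> nat. mono \<sigma> \<longrightarrow> \<not> bdd_above (range \<sigma>) \<longrightarrow> computable_fun \<sigma> \<longrightarrow>
      (\<forall>d k0. \<exists>k>k0. E k \<and> pfst k + d \<le> \<sigma> k)"
    by (elim exE conjE)
  have pfst_le: "pfst k \<le> k" for k
    using le_prod_encode_1[of "pfst k" "psnd k"] by simp
  \<comment> \<open>The bound \<open>pfst k \<le> k\<close> keeps \<open>z k \<ge> 2\<close>, away
    from the shared positions, and the summand \<open>2\<close> keeps the swapped positions within
    the first eighth of the column.\<close>
  define z where "z k = (if E k then k + 2 - pfst k else 0)" for k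
  interpret sparse_tower z
  proof
    show "z k = 0 \<or> 2 \<le> z k \<and> z k \<le> k + 2" for k
      using pfst_le[of k] by (cases "E k") (auto simp: z_def)
    show "(\<Sum>k<n. of_bool (z k \<noteq> 0) * 2 ^ z k / 2 ^ (k + 6)) \<le> (1 / 8 :: real)" for n
      using E(2) pfst_le z_def by (rule event_density)
  qed
  have "computable_fun z" unfolding z_def[abs_def] by (intro computable_intros E)
  then have "computable_transformation T" by (rule T_computable)
  moreover have "\<exists>\<omega>. (\<forall>n. ereal_of_enat (Km \<psi> (seq_prefix \<omega> n)) \<ge> ereal (real n - real (\<sigma> n))) \<and>
      (\<exists>A. computable_real_fun (indicat_real A) \<and>
        \<not> convergent (\<lambda>n. (1 / real n) * (\<Sum>i<n. indicat_real A ((T ^^ i) \<omega>))))"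
    if \<sigma>: "mono \<sigma>" "\<not> bdd_above (range \<sigma>)" "computable_fun \<sigma>" for \<sigma> :: "nat \<Rightarrow> nat"
  proof -
    \<comment> \<open>An event costs \<open>pfst k + 5\<close> bits, those of its block from
      \<open>z k - 1\<close> to \<open>k + 5\<close>.\<close>
    have ev: "\<exists>k>k0. E k \<and> (pfst k + 5) + d \<le> \<sigma> k" for d k0
    proof -
      have "\<exists>k>k0. E k \<and> pfst k + (5 + d) \<le> \<sigma> k" 
        using events[THEN spec, THEN mp, OF \<sigma>(1), THEN mp, OF \<sigma>(2), THEN mp, OF \<sigma>(3)] by (elim allE)
      then show ?thesis by (simp only: add.assoc)
    qed
    obtain \<kappa> where \<kappa>: "strict_mono \<kappa>" "\<And>j. E (\<kappa> j)"
      and sum: "\<And>j. (\<Sum>i<Suc j. pfst (\<kappa> i) + 5) \<le> \<sigma> (\<kappa> j)"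
      using event_levels[where w = "\<lambda>k. pfst k + 5", OF ev] by metis
    let ?c = "\<lambda>j. z (\<kappa> j) - 1"
    let ?F = "\<Union>j. (+) (level (\<kappa> j)) ` {?c j..<\<kappa> j + 6}"
    \<comment> \<open>Among the forced bits of a chosen block only the one at \<open>z\<close> is a
      one; since blocks are disjoint (\<open>level_add_inject\<close>), a single pattern serves all
      of them.\<close>
    let ?a = "\<lambda>p. \<exists>j. p = level (\<kappa> j) + z (\<kappa> j)"
    have z: "z (\<kappa> j) = \<kappa> j + 2 - pfst (\<kappa> j)" for j using \<kappa>(2) by (simp add: z_def)
    have card: "card (?F \<inter> {..<n}) \<le> \<sigma> n" for n
    proof (rule card_forced_positions[OF \<kappa>(1) \<sigma>(1) _ sum])
      show "\<kappa> j + 6 - (z (\<kappa> j) - 1) \<le> pfst (\<kappa> j) + 5" for j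
        using pfst_le[of "\<kappa> j"] by (simp add: z)
    qed
    from exists_small_deficiency[OF \<psi> card, of ?a] obtain \<omega> where forced: "\<forall>p\<in>?F. \<omega> p = ?a p"
      and Km: "\<forall>n. enat (n - \<sigma> n) \<le> Km \<psi> (seq_prefix \<omega> n)"
      by (elim exE conjE)
    have "swapped (\<kappa> j) (block \<omega> (\<kappa> j)) \<and> swapped (\<kappa> j) (Suc (block \<omega> (\<kappa> j)))" for j
    proof (rule swapped_block)
      show "z (\<kappa> j) \<noteq> 0" using pfst_le[of "\<kappa> j"] by (simp add: z Suc_diff_le)
      fix b assume b: "z (\<kappa> j) - 1 \<le> b" "b < \<kappa> j + 6"
      then have "\<omega> (level (\<kappa> j) + b) = ?a (level (\<kappa> j) + b)" 
        by (intro bspec[OF forced] UN_I[of j] imageI) simp_all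
      also have "\<dots> \<longleftrightarrow> b = z (\<kappa> j)"
      proof
        assume "?a (level (\<kappa> j) + b)"
        then obtain i where i: "level (\<kappa> j) + b = level (\<kappa> i) + z (\<kappa> i)" by blast
        have "z (\<kappa> i) < \<kappa> i + 6" by (simp add: z)
        from level_add_inject[OF i b(2) this] show "b = z (\<kappa> j)" by simp
      qed blast
      finally show "\<omega> (level (\<kappa> j) + b) \<longleftrightarrow> b = z (\<kappa> j)" .
    qed
    then have "\<exists>n\<ge>m. swapped n (block \<omega> n) \<and> swapped n (Suc (block \<omega> n))" for m
      using strict_mono_imp_increasing[OF \<kappa>(1), of m] by blast
    then have "\<not> convergent (\<lambda>n. (1 / real n) * (\<Sum>i<n. indicat_real {\<omega>. \<omega> 0} ((T ^^ i) \<omega>)))"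
      by (rule not_convergent)
    moreover have "ereal (real n - real (\<sigma> n)) \<le> ereal_of_enat (Km \<psi> (seq_prefix \<omega> n))" for n
    proof -
      have "ereal (real n - real (\<sigma> n)) \<le> ereal_of_enat (enat (n - \<sigma> n))" by simp
      also have "\<dots> \<le> ereal_of_enat (Km \<psi> (seq_prefix \<omega> n))"
        using Km by (simp only: ereal_of_enat_le_iff)
      finally show ?thesis .
    qed
    ultimately show ?thesis using computable_real_fun_first_bit by blast
  qed
  ultimately show ?thesis using T_measure_preserving by blast
qed

end
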